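(* Let $\lambda\in\underline{\mathrm{DC}}_\tau$ with $\tau\ge2$. For each $r\in\,]0,1[$, the fundamental solution $f_\delta$ belongs to the space $\mathcal G^\odot_{\tau/2}(\lambda,B_r)$, which is quasianalytic at $\lambda$ if $\tau=2$. Thus, if $0<r_2<r_1$ and $g\in B_{r_1}$, the corresponding solution $f_g$ belongs to the space $\mathcal G^\odot_{\tau/2}(\lambda,B_{r_2})$, which is quasianalytic at $\lambda$ if $\tau=2$.
   Context: $\mathbb D=\{|q|<1\}$, $\mathbb E=\{|q|>1\}$, $\mathbb S^1=\{|q|=1\}$. $B_r$ is the Banach space of bounded holomorphic functions on $\{|z|<r\}$ vanishing at $0$ (sup norm); $(\sum A_nz^n)\odot(\sum B_nz^n)=\sum A_nB_nz^n$. **Diophantine points.** $\underline{\mathrm{DC}}_\tau$ is the set of $e^{2\pi iy}$, $y\in\mathbb R\setminus\mathbb Q$, for which there is $\gamma>0$ with $|y-n/m|\ge\gamma m^{-\tau}$ for all rationals $n/m$ ($m\ge1$). **Solutions.** For $g=\sum_{n\ge1}g_nz^n\in B_{r_1}$, $f_g(q,z)=\sum_{n\ge1}g_n\frac{z^n}{q^n-1}$ ($q\in\mathbb D\cup\mathbb E$), viewed as a function of $q$ with values in $B_{r_2}$, $0<r_2<r_1$. $f_\delta=\sum_{n\ge1}\frac{z^n}{q^n-1}$ corresponds to $\delta(z)=z/(1-z)$. **Gevrey classes.** For $\lambda\in\mathbb S^1$, $\sigma>0$ and a Banach space $B$, $\mathcal G^+_\sigma(\lambda,B)$ is the space of $B$-valued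 functions $f$ for which there are an open disk $\Delta\subset\mathbb E$ tangent to $\mathbb S^1$ at $\lambda$ on which $f$ is holomorphic, a formal series $\sum a_nQ^n\in B[[Q]]$ and $c_0,c_1>0$ with $\|f(q)-\sum_{n<N}a_n(q-\lambda)^n\|\le c_0c_1^N\Gamma(1+N\sigma)|q-\lambda|^N$ for all $N\ge0$, $q\in\Delta$. $\mathcal G_\sigma(\lambda,B)$ is the space of functions $f$ satisfying this property both on a disk $\Delta^-\subset\mathbb D$ and on a disk $\Delta^+\subset\mathbb E$ tangent to $\mathbb S^1$ at $\lambda$, with the same series, which is the asymptotic expansion of $f$ at $\lambda$. **Cardioid classes.** $\mathcal G^<_\sigma(\lambda,B)$ (resp. $\mathcal G^>_\sigma(\lambda,B)$) is the space of $B$-valued functions $f$ such that $u\mapsto f(\lambda(1+i(u-1)^2))$ (resp. $u\mapsto f(\lambda(1-i(u-1)^2))$) defines a function of $\mathcal G^+_\sigma(1,B)$. Thus $f$ is analytic in the image of a disk tangent to $\mathbb S^1$ at $u=1$, a domain bounded by a cardioid with its cusp at $\lambda$ and its axis tangent to $\mathbb S^1$ at $\lambda$. **The functions $\delta^<_\lambda,\delta^>_\lambda$.** Write $\lambda=e^{2\pi i\alpha}$, and let $\mathbb S^<_\lambda=\{e^{2\pi ix}:x\in\,]\alpha-\frac12,\alpha[\}$, $\mathbb S^>_\lambda=\{e^{2\pi ix}:x\in\,]\alpha,\alpha+\frac12[\}$. With $\mathcal R_n=\{\Lambda:\Lambda^n=1\}$, for $\bullet\in\{<,>\}$ put $\delta^\bullet_{n,\ell}=\frac1n\sum_{\Lambda\in\mathcal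 R_n\cap\mathbb S^\bullet_\lambda}\Lambda^{-\ell}$ ($n\ge1$, $0\le\ell\le n-1$) and $\delta^\bullet_\lambda(q)(z)=\sum_{\ell\ge0,\,n\ge\ell+1}\delta^\bullet_{n,\ell}\,q^\ell z^n$. **The space $\mathcal G^\odot$.** $\mathcal G^\odot_\sigma(\lambda,B_r)$ is the subspace of $\mathcal G_{2\sigma}(\lambda,B_r)$ consisting of the functions $f$ such that $q\mapsto f(q)\odot\delta^<_\lambda(q)$ extends (from open disks $\Delta^-\subset\mathbb D$ and $\Delta^+\subset\mathbb E$ tangent to $\mathbb S^1$ at $\lambda$, on which $f$ is holomorphic) to a function of $\mathcal G^<_\sigma(\lambda,B_r)$ and $q\mapsto f(q)\odot\delta^>_\lambda(q)$ extends to a function of $\mathcal G^>_\sigma(\lambda,B_r)$. Such a space is quasianalytic at $\lambda$ if any two of its members with the same asymptotic expansion at $\lambda$ coincide (near $\lambda$, on open disks $\Delta^-\subset\mathbb D$ and $\Delta^+\subset\mathbb E$ tangent to $\mathbb S^1$ at $\lambda$). *)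

theory Defs
  imports "HOL-Complex_Analysis.Complex_Analysis"
begin

definition diophantine_points :: "real \<Rightarrow> complex set" where
  "diophantine_points \<tau> = {cis (2 * pi * y) | y. y \<notin> \<rat> \<and>
     (\<exists>\<gamma>>0. \<forall>n::int. \<forall>m::nat. m \<ge> 1 \<longrightarrow>
        \<bar>y - real_of_int n / real m\<bar> \<ge> \<gamma> * real m powr (- \<tau>))}"


section \<open>The Banach space of bounded holomorphic functions vanishing at the origin\<close>

text \<open>
  An element of B r is a total function, of which only the values on the disk of radius r
  matter: B-valued functions are compared pointwise on that disk. Accordingly a B-valued function
  of q has type complex to complex to complex, and only its values at the points q of the
  domain under consideration are required to lie in B r.
\<close>

definition B :: "real \<Rightarrow> (complex \<Rightarrow> complex) set" where
  "B r = {A. A holomorphic_on ball 0 r \<and> bounded (A ` ball 0 r) \<and> A 0 = 0}"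

definition B_norm :: "real \<Rightarrow> (complex \<Rightarrow> complex) \<Rightarrow> real" where
  "B_norm r A = (SUP z\<in>ball 0 r. norm (A z))"

definition B_holomorphic_on :: "real \<Rightarrow> (complex \<Rightarrow> complex \<Rightarrow> complex) \<Rightarrow> complex set \<Rightarrow> bool" where
  "B_holomorphic_on r f \<Delta> \<longleftrightarrow> (\<forall>q\<in>\<Delta>. f q \<in> B r \<and>
     (\<exists>D\<in>B r. ((\<lambda>w. B_norm r (\<lambda>z. (f w z - f q z) / (w - q) - D z)) \<longlongrightarrow> 0) (at q within \<Delta>)))"

definition taylor_coeff :: "(complex \<Rightarrow> complex) \<Rightarrow> nat \<Rightarrow> complex" where
  "taylor_coeff A n = fps_nth (fps_expansion A 0) n"

definition hadamard :: "(complex \<Rightarrow> complex) \<Rightarrow> (complex \<Rightarrow> complex) \<Rightarrow> complex \<Rightarrow> complex"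
    (infixl "\<odot>" 70) where
  "A \<odot> C = (\<lambda>z. \<Sum>n. taylor_coeff A n * taylor_coeff C n * z ^ n)"


section \<open>Solutions of the small divisor problem\<close>

definition solution :: "(complex \<Rightarrow> complex) \<Rightarrow> complex \<Rightarrow> complex \<Rightarrow> complex" where
  "solution g q z = (\<Sum>n. taylor_coeff g (Suc n) * (z ^ Suc n / (q ^ Suc n - 1)))"

definition fundamental_solution :: "complex \<Rightarrow> complex \<Rightarrow> complex" where
  "fundamental_solution q z = (\<Sum>n. z ^ Suc n / (q ^ Suc n - 1))"


section \<open>Gevrey classes\<close>

text \<open>
  For a point of the unit circle, these are exactly the open disks contained in the exterior
  (resp. interior) of the unit disk and tangent to the unit circle at that point.
\<close>

definition outer_disks :: "complex \<Rightarrow> complex set set" where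
  "outer_disks lam = {ball (of_real (1 + \<rho>) * lam) \<rho> | \<rho>. 0 < \<rho>}"

definition inner_disks :: "complex \<Rightarrow> complex set set" where
  "inner_disks lam = {ball (of_real (1 - \<rho>) * lam) \<rho> | \<rho>. 0 < \<rho> \<and> \<rho> < 1}"

definition gevrey_asymptotic_on ::
    "real \<Rightarrow> complex \<Rightarrow> real \<Rightarrow> complex set \<Rightarrow> (complex \<Rightarrow> complex \<Rightarrow> complex) \<Rightarrow>
     (nat \<Rightarrow> complex \<Rightarrow> complex) \<Rightarrow> bool" where
  "gevrey_asymptotic_on \<sigma> lam r \<Delta> f a \<longleftrightarrow>
     B_holomorphic_on r f \<Delta> \<and> (\<forall>n. a n \<in> B r) \<and>
     (\<exists>c0>0. \<exists>c1>0. \<forall>N. \<forall>q\<in>\<Delta>.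
        B_norm r (\<lambda>z. f q z - (\<Sum>n<N. a n z * (q - lam) ^ n))
          \<le> c0 * c1 ^ N * Gamma (1 + real N * \<sigma>) * norm (q - lam) ^ N)"

definition gevrey_plus :: "real \<Rightarrow> complex \<Rightarrow> real \<Rightarrow> (complex \<Rightarrow> complex \<Rightarrow> complex) set" where
  "gevrey_plus \<sigma> lam r = {f. \<exists>\<Delta>\<in>outer_disks lam. \<exists>a. gevrey_asymptotic_on \<sigma> lam r \<Delta> f a}"

definition gevrey_expansion ::
    "real \<Rightarrow> complex \<Rightarrow> real \<Rightarrow> (complex \<Rightarrow> complex \<Rightarrow> complex) \<Rightarrow>
     (nat \<Rightarrow> complex \<Rightarrow> complex) \<Rightarrow> bool" where
  "gevrey_expansion \<sigma> lam r f a \<longleftrightarrow>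
     (\<exists>\<Delta>m\<in>inner_disks lam. gevrey_asymptotic_on \<sigma> lam r \<Delta>m f a) \<and>
     (\<exists>\<Delta>p\<in>outer_disks lam. gevrey_asymptotic_on \<sigma> lam r \<Delta>p f a)"

definition gevrey :: "real \<Rightarrow> complex \<Rightarrow> real \<Rightarrow> (complex \<Rightarrow> complex \<Rightarrow> complex) set" where
  "gevrey \<sigma> lam r = {f. \<exists>a. gevrey_expansion \<sigma> lam r f a}"


section \<open>Cardioid classes and the functions delta\<close>

text \<open>Lower and Upper stand for the superscripts < and >.\<close>

datatype side = Lower | Upper

fun side_sign :: "side \<Rightarrow> complex" where
  "side_sign Lower = 1"
| "side_sign Upper = -1"

definition gevrey_cardioid ::
    "side \<Rightarrow> real \<Rightarrow> complex \<Rightarrow> real \<Rightarrow> (complex \<Rightarrow> complex \<Rightarrow> complex) set" where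
  "gevrey_cardioid s \<sigma> lam r =
     {f. (\<lambda>u. f (lam * (1 + side_sign s * \<i> * (u - 1)\<^sup>2))) \<in> gevrey_plus \<sigma> 1 r}"

fun half_circle :: "side \<Rightarrow> complex \<Rightarrow> complex set" where
  "half_circle Lower lam =
     {cis (2 * pi * x) | x \<alpha>. lam = cis (2 * pi * \<alpha>) \<and> \<alpha> - 1/2 < x \<and> x < \<alpha>}"
| "half_circle Upper lam =
     {cis (2 * pi * x) | x \<alpha>. lam = cis (2 * pi * \<alpha>) \<and> \<alpha> < x \<and> x < \<alpha> + 1/2}"

definition delta_coeff :: "side \<Rightarrow> complex \<Rightarrow> nat \<Rightarrow> nat \<Rightarrow> complex" where
  "delta_coeff s lam n l =
     1 / of_nat n * (\<Sum>\<Lambda>\<in>{\<Lambda>. \<Lambda> ^ n = 1} \<inter> half_circle s lam. inverse (\<Lambda> ^ l))"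

text \<open>
  The double series converges absolutely for norm z < min 1 (1 / norm q), so that for every q it
  defines a germ at the origin, which is all that the Hadamard product depends on.
\<close>

definition delta_fun :: "side \<Rightarrow> complex \<Rightarrow> complex \<Rightarrow> complex \<Rightarrow> complex" where
  "delta_fun s lam q z =
     (\<Sum>\<^sub>\<infinity>(l, n)\<in>{(l, n). n \<ge> l + 1}. delta_coeff s lam n l * q ^ l * z ^ n)"


section \<open>The quasianalytic space\<close>

text \<open>
  The cardioid of the extension h does not contain a full tangent disk, so h lives on the union of
  the cardioid and the two disks; it is B-valued and holomorphic on each of them.
\<close>

definition hadamard_extends ::
    "side \<Rightarrow> real \<Rightarrow> complex \<Rightarrow> real \<Rightarrow> (complex \<Rightarrow> complex \<Rightarrow> complex) \<Rightarrow> bool" where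
  "hadamard_extends s \<sigma> lam r f \<longleftrightarrow>
     (\<exists>\<Delta>m\<in>inner_disks lam. \<exists>\<Delta>p\<in>outer_disks lam.
        B_holomorphic_on r f \<Delta>m \<and> B_holomorphic_on r f \<Delta>p \<and>
        (\<exists>h\<in>gevrey_cardioid s \<sigma> lam r.
           B_holomorphic_on r h \<Delta>m \<and> B_holomorphic_on r h \<Delta>p \<and>
           (\<forall>q\<in>\<Delta>m \<union> \<Delta>p. \<forall>z\<in>ball 0 r. h q z = (f q \<odot> delta_fun s lam q) z)))"

definition gevrey_odot :: "real \<Rightarrow> complex \<Rightarrow> real \<Rightarrow> (complex \<Rightarrow> complex \<Rightarrow> complex) set" where
  "gevrey_odot \<sigma> lam r =
     {f \<in> gevrey (2 * \<sigma>) lam r.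
        hadamard_extends Lower \<sigma> lam r f \<and> hadamard_extends Upper \<sigma> lam r f}"

definition gevrey_odot_quasianalytic :: "real \<Rightarrow> complex \<Rightarrow> real \<Rightarrow> bool" where
  "gevrey_odot_quasianalytic \<sigma> lam r \<longleftrightarrow>
     (\<forall>f1\<in>gevrey_odot \<sigma> lam r. \<forall>f2\<in>gevrey_odot \<sigma> lam r. \<forall>a.
        gevrey_expansion (2 * \<sigma>) lam r f1 a \<and> gevrey_expansion (2 * \<sigma>) lam r f2 a \<longrightarrow>
        (\<exists>\<Delta>m\<in>inner_disks lam. \<exists>\<Delta>p\<in>outer_disks lam.
           \<forall>q\<in>\<Delta>m \<union> \<Delta>p. \<forall>z\<in>ball 0 r. f1 q z = f2 q z))"

end

theory Submission
  imports Defs "HOL-Real_Asymp.Real_Asymp"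
begin

text \<open>
  Expanding $1/(q^n-1)$ into partial fractions over the roots of unity of order $n$, the Hadamard
  product with $\<delta>^<$ or $\<delta>^>$ merely keeps the poles lying on one of the two half circles. On a
  disk tangent to the circle at $\<lambda>$, and likewise on a cardioid with cusp $\<lambda>$ that opens away
  from the retained half circle, the distance from $q$ to a pole $\<Lambda>$ is at least a multiple of
  $|\<lambda>-\<Lambda>|^2$, and the Diophantine condition bounds $|\<lambda>-\<Lambda>|$ from below by a power of $n$. The
  $N$-th Taylor remainder is thus dominated by a sum of $\<theta>^n n^{sN+m}$ with $\<theta><1$, that is by
  $\<Gamma>(1+sN)$ up to geometric factors; in the cardioid, $q-\<lambda>$ is quadratic in the variable $u-1$,
  which halves $s$.

  If two members of the space have the same expansion at $\<lambda>$ and $\<tau>=2$, their Hadamard products with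
  $\<delta>^<$ have extensions to the cardioid with the same Gevrey-1 expansion, as is seen coefficientwise
  on a radius. In the variable $w=1/(u-1)$ the difference of the extensions decays exponentially on
  a half plane, hence vanishes by a Phragmen-Lindelof argument. The same holds for $\<delta>^>$, and since
  the coefficients of $\<delta>^<$ and $\<delta>^>$ add up to $1$, the two functions coincide.
\<close>

section \<open>Functions with values in the spaces B\<close>

text \<open>Why cardioids are needed: in the variable w = 1/(q - \<lambda>), suitably rotated, a
  tangent disk is a half plane. For \<tau> = 2, flatness of Gevrey order 2 there means decay like
  exp(-c |w|^(1/2)), which the nonzero function exp(-w^(1/2)) also has, so an expansion on tangent
  disks does not by itself determine a function. A square root of q - \<lambda> lowers the order to
  1, for which a half plane is just wide enough. The image of the disk then straddles the circle on
  one side of \<lambda>, where poles accumulate, and the Hadamard product removes exactly the poles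
  of that side.

  The quadratic contact costs little: in the exact remainder of the geometric series for 1/(q -
  \<Lambda>), the point q occurs in one denominator only, the others being powers of \<lambda> -
  \<Lambda>. The loss is a power of n independent of N.

  Cardioid and tangent disks share pieces of the radius through \<lambda>; this radius transports
  information from the disk to the cardioid, and back to the disks on both sides of the
  circle.\<close>

lemma B_bounded_above: "A \<in> B r \<Longrightarrow> bdd_above ((\<lambda>z. norm (A z)) ` ball 0 r)"
  unfolding B_def bounded_iff bdd_above_def by auto

lemma norm_le_B_norm: "A \<in> B r \<Longrightarrow> z \<in> ball 0 r \<Longrightarrow> norm (A z) \<le> B_norm r A"
  unfolding B_norm_def by (rule cSUP_upper) (use B_bounded_above in auto)

lemma B_norm_leI:
  assumes "r > 0" "\<And>z. z \<in> ball 0 r \<Longrightarrow> norm (A z) \<le> c"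
  shows "B_norm r A \<le> c"
  unfolding B_norm_def by (rule cSUP_least) (use assms in auto)

lemma B_norm_nonneg: "A \<in> B r \<Longrightarrow> r > 0 \<Longrightarrow> 0 \<le> B_norm r A"
  using norm_le_B_norm[of A r 0] norm_ge_zero[of "A 0"] by (smt (verit) centre_in_ball)

lemma B_I:
  assumes "A holomorphic_on ball 0 r" "\<And>z. z \<in> ball 0 r \<Longrightarrow> norm (A z) \<le> M" "A 0 = 0"
  shows "A \<in> B r"
  using assms(1,3) assms(2)[unfolded mem_ball] unfolding B_def bounded_iff
  by (auto simp: dist_norm intro!: exI[of _ M] assms(2))

lemma B_boundedE:
  assumes "A \<in> B r"
  obtains M where "M \<ge> 0" "\<And>z. z \<in> ball 0 r \<Longrightarrow> norm (A z) \<le> M"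
proof -
  obtain M where "\<forall>x\<in>A ` ball 0 r. norm x \<le> M" using assms unfolding B_def bounded_iff by auto
  hence "max M 0 \<ge> 0" "\<And>z. z \<in> ball 0 r \<Longrightarrow> norm (A z) \<le> max M 0" by force+
  thus ?thesis using that by blast
qed

lemma B_diff: "A \<in> B r \<Longrightarrow> C \<in> B r \<Longrightarrow> (\<lambda>z. A z - C z) \<in> B r"
proof -
  assume A: "A \<in> B r" and C: "C \<in> B r"
  obtain M where "\<And>z. z \<in> ball 0 r \<Longrightarrow> norm (A z) \<le> M" using B_boundedE[OF A] by blast
  moreover obtain M' where "\<And>z. z \<in> ball 0 r \<Longrightarrow> norm (C z) \<le> M'" using B_boundedE[OF C] by blast
  ultimately have "norm (A z - C z) \<le> M + M'" if "z \<in> ball 0 r" for z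
    using that by (meson add_mono norm_triangle_le_diff)
  thus ?thesis using A C by (intro B_I[where M="M+M'"]) (auto simp: B_def intro!: holomorphic_intros)
qed

lemma B_cmult: "A \<in> B r \<Longrightarrow> (\<lambda>z. A z * c) \<in> B r"
proof -
  assume A: "A \<in> B r"
  obtain M where "\<And>z. z \<in> ball 0 r \<Longrightarrow> norm (A z) \<le> M" using B_boundedE[OF A] by blast
  hence "norm (A z * c) \<le> M * norm c" if "z \<in> ball 0 r" for z
    using that by (simp add: norm_mult mult_right_mono)
  thus ?thesis using A by (intro B_I[where M="M*norm c"]) (auto simp: B_def intro!: holomorphic_intros)
qed

lemma B_zero: "(\<lambda>z. 0) \<in> B r"
  by (rule B_I[where M=0]) auto

lemma B_sum: "(\<And>n. n \<in> I \<Longrightarrow> A n \<in> B r) \<Longrightarrow> (\<lambda>z. \<Sum>n\<in>I. A n z) \<in> B r"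
proof (induction I rule: infinite_finite_induct)
  case (insert i I)
  have "(\<lambda>z. A i z - (0 - (\<Sum>n\<in>I. A n z))) \<in> B r"
    using insert by (intro B_diff B_zero) auto
  thus ?case using insert by simp
qed (auto simp: B_zero)

lemma B_holomorphic_on_B: "B_holomorphic_on r f \<Delta> \<Longrightarrow> q \<in> \<Delta> \<Longrightarrow> f q \<in> B r"
  unfolding B_holomorphic_on_def by auto

text \<open>Convergence in norm implies convergence at each \<open>z\<close>. As
  \<open>B_norm\<close> is a real supremum, it dominates values only for members of
  \<open>B r\<close>, so the difference quotient is first shown to lie there.\<close>

lemma B_holomorphic_on_pointwise:
  assumes f: "B_holomorphic_on r f \<Delta>" and z: "z \<in> ball 0 r"
  shows "(\<lambda>q. f q z) holomorphic_on \<Delta>"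
  unfolding holomorphic_on_def field_differentiable_def
proof
  fix q assume q: "q \<in> \<Delta>"
  then obtain D where D: "D \<in> B r"
    and lim: "((\<lambda>w. B_norm r (\<lambda>z. (f w z - f q z) / (w - q) - D z)) \<longlongrightarrow> 0) (at q within \<Delta>)"
    using f unfolding B_holomorphic_on_def by blast
  have "((\<lambda>w. (f w z - f q z) / (w - q) - D z) \<longlongrightarrow> 0) (at q within \<Delta>)"
  proof (rule Lim_null_comparison[OF _ lim])
    show "\<forall>\<^sub>F w in at q within \<Delta>. norm ((f w z - f q z) / (w - q) - D z)
            \<le> B_norm r (\<lambda>z. (f w z - f q z) / (w - q) - D z)"
      unfolding eventually_at_filter
    proof (rule always_eventually, intro allI impI)
      fix w assume "w \<noteq> q" "w \<in> \<Delta>"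
      have "(\<lambda>z. (f w z - f q z) * inverse (w - q) - D z) \<in> B r"
        using B_holomorphic_on_B[OF f] q D \<open>w \<in> \<Delta>\<close> by (intro B_diff B_cmult) auto
      thus "norm ((f w z - f q z) / (w - q) - D z)
            \<le> B_norm r (\<lambda>z. (f w z - f q z) / (w - q) - D z)"
        using norm_le_B_norm[OF _ z] by (simp add: field_class.field_divide_inverse)
    qed
  qed
  hence "((\<lambda>w. (f w z - f q z) / (w - q)) \<longlongrightarrow> D z) (at q within \<Delta>)"
    using Lim_null by blast
  thus "\<exists>f'. ((\<lambda>q. f q z) has_field_derivative f') (at q within \<Delta>)"
    unfolding has_field_derivative_iff by blast
qed

text \<open>Taylor's formula with Cauchy's bound 2! M / (e/2)^2 = 8 M / e^2 for the second
  derivative. The constant sees \<open>g\<close> only through \<open>M\<close> and \<open>e\<close>,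
  hence is uniform over a bounded family; this turns pointwise derivatives into derivatives in
  norm.\<close>

lemma difference_quotient_bound:
  assumes g: "g holomorphic_on ball q (2*e)" and e: "e > 0"
    and M: "\<And>w. w \<in> ball q (2*e) \<Longrightarrow> norm (g w) \<le> M" and w: "w \<in> ball q e" "w \<noteq> q"
  shows "norm ((g w - g q) / (w - q) - deriv g q) \<le> 8 * M / e\<^sup>2 * norm (w - q)"
proof -
  have "norm (g w - (\<Sum>i\<le>1. (deriv ^^ i) g q * (w-q) ^ i / (fact i)))
      \<le> (8 * M / e\<^sup>2) * cmod(w - q)^(Suc 1) / fact 1"
  proof (rule complex_Taylor[where S="ball q e" and f="\<lambda>i. (deriv ^^ i) g", simplified id_apply funpow_0])
    fix i x assume x: "x \<in> ball q e"
    have "(deriv ^^ i) g holomorphic_on ball q (2*e)" by (rule holomorphic_higher_deriv[OF g]) auto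
    moreover have "x \<in> ball q (2*e)" using x e by auto
    ultimately have "((deriv ^^ i) g has_field_derivative deriv ((deriv ^^ i) g) x) (at x)"
      by (meson holomorphic_derivI open_ball)
    thus "((deriv ^^ i) g has_field_derivative (deriv ^^ Suc i) g x) (at x within ball q e)"
      by (auto intro: has_field_derivative_at_within)
  next
    fix x assume x: "x \<in> ball q e"
    have sub: "cball x (e/2) \<subseteq> ball q (2*e)"
    proof
      fix y assume "y \<in> cball x (e/2)"
      thus "y \<in> ball q (2*e)" using x e dist_triangle[of q y x] by auto
    qed
    have "norm ((deriv ^^ 2) g x) \<le> fact 2 * M / (e/2)^2"
    proof (rule Cauchy_inequality)
      show "g holomorphic_on ball x (e/2)" 
        by (rule holomorphic_on_subset[OF g]) (use sub ball_subset_cball in blast)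
      show "continuous_on (cball x (e/2)) g"
        by (rule continuous_on_subset[OF holomorphic_on_imp_continuous_on[OF g] sub])
      show "cmod (g y) \<le> M" if "norm (x - y) = e/2" for y
        by (rule M) (use sub that in \<open>auto simp: subset_eq dist_norm\<close>)
    qed (use e in auto)
    thus "cmod ((deriv ^^ Suc 1) g x) \<le> 8 * M / e\<^sup>2" by (simp add: numeral_2_eq_2 field_simps)
  qed (use w e in auto)
  hence 1: "norm (g w - g q - deriv g q * (w - q)) \<le> 8 * M / e\<^sup>2 * norm (w - q)^2"
    by (simp add: algebra_simps power2_eq_square)
  have "(g w - g q) / (w - q) - deriv g q = (g w - g q - deriv g q * (w - q)) / (w - q)"
    using w by (simp add: field_simps)
  hence "norm ((g w - g q) / (w - q) - deriv g q) = norm (g w - g q - deriv g q * (w - q)) / norm (w - q)"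
    by (simp add: norm_divide)
  also have "\<dots> \<le> 8 * M / e\<^sup>2 * norm (w - q)^2 / norm (w - q)"
    by (rule divide_right_mono[OF 1]) auto
  also have "\<dots> = 8 * M / e\<^sup>2 * norm (w - q)" by (simp add: power2_eq_square)
  finally show ?thesis .
qed

text \<open>For a bounded family the Cauchy estimates are uniform in \<open>z\<close>, so holomorphy
  at each \<open>z\<close> upgrades to holomorphy in norm. The derivative \<open>D\<close> must
  itself lie in \<open>B r\<close>: it is holomorphic in \<open>z\<close> as a uniform limit of
  difference quotients.\<close>

lemma B_holomorphic_onI:
  assumes op: "open \<Delta>" and fB: "\<And>q. q \<in> \<Delta> \<Longrightarrow> f q \<in> B r"
    and hol: "\<And>z. z \<in> ball 0 r \<Longrightarrow> (\<lambda>q. f q z) holomorphic_on \<Delta>"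
    and M: "\<And>q z. q \<in> \<Delta> \<Longrightarrow> z \<in> ball 0 r \<Longrightarrow> norm (f q z) \<le> M" and r: "r > 0"
  shows "B_holomorphic_on r f \<Delta>"
  unfolding B_holomorphic_on_def
proof (intro ballI conjI)
  fix q assume q: "q \<in> \<Delta>"
  show "f q \<in> B r" by (rule fB[OF q])
  obtain e' where e': "e' > 0" "ball q e' \<subseteq> \<Delta>" using op q open_contains_ball by blast
  define e where "e = e'/2"
  have e: "e > 0" "ball q (2*e) \<subseteq> \<Delta>" using e' by (auto simp: e_def)
  have M0: "M \<ge> 0" using M[OF q, of 0] r norm_ge_zero[of "f q 0"] by (smt (verit) centre_in_ball)
  define D where "D z = deriv (\<lambda>w. f w z) q" for z
  have bd: "norm ((f w z - f q z) / (w - q) - D z) \<le> 8 * M / e\<^sup>2 * norm (w - q)"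
    if "w \<in> ball q e" "w \<noteq> q" "z \<in> ball 0 r" for w z
    unfolding D_def using that e M holomorphic_on_subset[OF hol e(2)]
    by (intro difference_quotient_bound[where g="\<lambda>w. f w z"]) auto
  \<comment> \<open>Points tending to \<open>q\<close> at which the quotients are taken; the 2 keeps
    them strictly inside \<open>ball q e\<close> from n = 0 on.\<close>
  define \<epsilon> where "\<epsilon> n = e / (real n + 2)" for n
  define s where "s n = q + of_real (\<epsilon> n)" for n
  have "0 < \<epsilon> n" "\<epsilon> n < e" for n
    using e by (auto simp: \<epsilon>_def field_simps add_pos_nonneg)
  hence s: "s n \<in> ball q e" "s n \<noteq> q" "norm (s n - q) = e / (real n + 2)" for n
    unfolding s_def \<epsilon>_def[symmetric] by (auto simp add: dist_norm less_imp_neq[symmetric] less_imp_le)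
  have sD: "s n \<in> \<Delta>" for n using s(1)[of n] e by (auto simp: subset_eq)
  have "D holomorphic_on ball 0 r"
  proof (rule holomorphic_uniform_sequence[where f="\<lambda>n z. (f (s n) z - f q z) / (s n - q)"])
    show "(\<lambda>z. (f (s n) z - f q z) / (s n - q)) holomorphic_on ball 0 r" for n
      using fB[OF q] fB[OF sD, of n] s(2)[of n] by (auto simp: B_def intro!: holomorphic_intros)
    fix x :: complex assume "x \<in> ball 0 r"
    then obtain d where d: "d > 0" "cball x d \<subseteq> ball 0 r"
      using open_contains_cball[of "ball 0 r"] by (metis open_ball)
    have "uniform_limit (cball x d) (\<lambda>n z. (f (s n) z - f q z) / (s n - q)) D sequentially"
    proof (rule uniform_limitI)
      fix \<epsilon> :: real assume \<epsilon>: "\<epsilon> > 0"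
      have "(\<lambda>n. 8 * M / e\<^sup>2 * (e / (real n + 2))) \<longlonglongrightarrow> 0"
        by real_asymp
      hence "\<forall>\<^sub>F n in sequentially. 8 * M / e\<^sup>2 * (e / (real n + 2)) < \<epsilon>"
        using \<epsilon> order_tendstoD(2) by blast
      thus "\<forall>\<^sub>F n in sequentially. \<forall>z\<in>cball x d. dist ((f (s n) z - f q z) / (s n - q)) (D z) < \<epsilon>"
      proof eventually_elim
        case (elim n)
        show ?case
        proof
          fix z assume "z \<in> cball x d"
          hence "z \<in> ball 0 r" using d by auto
          from bd[OF s(1,2) this, of n] elim show "dist ((f (s n) z - f q z) / (s n - q)) (D z) < \<epsilon>"
            unfolding dist_norm s(3) by linarith
        qed
      qed
    qed
    thus "\<exists>d. 0 < d \<and> cball x d \<subseteq> ball 0 r \<and>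
       uniform_limit (cball x d) (\<lambda>n z. (f (s n) z - f q z) / (s n - q)) D sequentially" using d by blast
  qed auto
  moreover have "norm (D z) \<le> fact 1 * M / e^1" if "z \<in> ball 0 r" for z
  proof -
    have sub: "cball q e \<subseteq> \<Delta>" using e by force
    have "norm ((deriv ^^ 1) (\<lambda>w. f w z) q) \<le> fact 1 * M / e^1"
    proof (rule Cauchy_inequality)
      show "(\<lambda>w. f w z) holomorphic_on ball q e"
        by (rule holomorphic_on_subset[OF hol[OF that]]) (use sub ball_subset_cball in blast)
      show "continuous_on (cball q e) (\<lambda>w. f w z)"
        by (rule continuous_on_subset[OF holomorphic_on_imp_continuous_on[OF hol[OF that]] sub])
      show "cmod (f y z) \<le> M" if "norm (q - y) = e" for y
        by (rule M) (use sub that \<open>z \<in> ball 0 r\<close> in \<open>auto simp: subset_eq dist_norm\<close>)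
    qed (use e in auto)
    thus ?thesis by (simp add: D_def)
  qed
  moreover have "D 0 = 0"
  proof -
    have "D 0 = deriv (\<lambda>w. 0) q" unfolding D_def
    proof (rule deriv_cong_ev)
      have "\<forall>\<^sub>F w in nhds q. w \<in> \<Delta>" using op q by (simp add: eventually_nhds_in_open)
      thus "\<forall>\<^sub>F w in nhds q. f w 0 = 0"
        by eventually_elim (use fB in \<open>auto simp: B_def\<close>)
    qed auto
    thus ?thesis by simp
  qed
  ultimately have DB: "D \<in> B r" by (rule B_I)
  have "((\<lambda>w. B_norm r (\<lambda>z. (f w z - f q z) / (w - q) - D z)) \<longlongrightarrow> 0) (at q within \<Delta>)"
  proof (rule Lim_null_comparison)
    show "((\<lambda>w. 8 * M / e\<^sup>2 * norm (w - q)) \<longlongrightarrow> 0) (at q within \<Delta>)"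
      using e(1) by (auto intro!: tendsto_eq_intros)
    have "\<forall>\<^sub>F w in at q within \<Delta>. w \<in> ball q e"
      using e(1) by (auto simp: eventually_at dist_commute)
    moreover have "\<forall>\<^sub>F w in at q within \<Delta>. w \<in> \<Delta> \<and> w \<noteq> q" by (auto simp: eventually_at_filter)
    ultimately show "\<forall>\<^sub>F w in at q within \<Delta>. norm (B_norm r (\<lambda>z. (f w z - f q z) / (w - q) - D z))
         \<le> 8 * M / e\<^sup>2 * norm (w - q)"
    proof eventually_elim
      case (elim w)
      have "(\<lambda>z. (f w z - f q z) * inverse (w - q) - D z) \<in> B r"
        using fB q DB elim by (intro B_diff B_cmult) auto
      hence "0 \<le> B_norm r (\<lambda>z. (f w z - f q z) / (w - q) - D z)"
        using B_norm_nonneg r by (simp add: field_class.field_divide_inverse)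
      moreover have "B_norm r (\<lambda>z. (f w z - f q z) / (w - q) - D z) \<le> 8 * M / e\<^sup>2 * norm (w - q)"
        using elim bd r by (intro B_norm_leI) auto
      ultimately show ?case by simp
    qed
  qed
  thus "\<exists>D\<in>B r. ((\<lambda>w. B_norm r (\<lambda>z. (f w z - f q z) / (w - q) - D z)) \<longlongrightarrow> 0) (at q within \<Delta>)"
    using DB by blast
qed

lemma B_holomorphic_on_subset:
  assumes "B_holomorphic_on r f \<Delta>" "\<Delta>' \<subseteq> \<Delta>"
  shows "B_holomorphic_on r f \<Delta>'"
  using assms unfolding B_holomorphic_on_def by (meson subsetD tendsto_within_subset)

section \<open>Taylor coefficients and roots of unity\<close>

lemma taylor_coeff_eqI:
  assumes "R > 0" and sums: "\<And>z. z \<in> ball 0 R \<Longrightarrow> (\<lambda>n. a n * z ^ n) sums A z"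
  shows "taylor_coeff A n = a n"
proof -
  have "conv_radius a \<ge> norm (of_real (R/2) :: complex)"
    using sums[of "of_real (R/2)"] assms(1) by (intro conv_radius_geI sums_summable) auto
  hence "fps_conv_radius (Abs_fps a) > 0" using assms(1)
    by (auto simp: fps_conv_radius_def less_le_trans[rotated])
  moreover have "\<forall>\<^sub>F z in nhds 0. eval_fps (Abs_fps a) z = A z"
    using eventually_nhds_in_open[of "ball 0 R" 0] assms(1)
    by (auto simp: eval_fps_def elim!: eventually_mono intro!: sums_unique[symmetric] sums)
  ultimately have "A has_fps_expansion Abs_fps a" by (simp add: has_fps_expansion_def)
  thus ?thesis unfolding taylor_coeff_def by (subst fps_expansion_eqI) auto
qed

lemma taylor_coeff_cong:
  assumes "R > 0" "\<And>z. z \<in> ball 0 R \<Longrightarrow> A z = C z"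
  shows "taylor_coeff A n = taylor_coeff C n"
proof -
  have "\<forall>\<^sub>F z in nhds 0. A z = C z"
    using eventually_nhds_in_open[of "ball 0 R" 0] assms by (auto elim!: eventually_mono)
  thus ?thesis unfolding taylor_coeff_def fps_expansion_def by (simp add: higher_deriv_cong_ev)
qed

lemma taylor_coeff_sums:
  assumes "A holomorphic_on ball 0 r" "z \<in> ball 0 r"
  shows "(\<lambda>n. taylor_coeff A n * z ^ n) sums A z"
  using holomorphic_power_series[OF assms] by (simp add: taylor_coeff_def fps_expansion_def)

lemma taylor_coeff_bound:
  assumes A: "A holomorphic_on ball 0 r" and \<rho>: "0 < \<rho>" "\<rho> < r"
    and M: "\<And>z. z \<in> ball 0 r \<Longrightarrow> norm (A z) \<le> M"
  shows "norm (taylor_coeff A n) \<le> M / \<rho> ^ n"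
proof -
  have sub: "cball 0 \<rho> \<subseteq> ball 0 r" using \<rho> by auto
  have "norm ((deriv ^^ n) A 0) \<le> fact n * M / \<rho> ^ n"
  proof (rule Cauchy_inequality)
    show "A holomorphic_on ball 0 \<rho>" by (rule holomorphic_on_subset[OF A]) (use \<rho> in auto)
    show "continuous_on (cball 0 \<rho>) A"
      by (rule continuous_on_subset[OF holomorphic_on_imp_continuous_on[OF A] sub])
  qed (use \<rho> M in auto)
  hence "norm ((deriv ^^ n) A 0) / fact n \<le> M / \<rho> ^ n" by (simp add: pos_divide_le_eq mult_ac)
  thus ?thesis by (simp add: taylor_coeff_def fps_expansion_def norm_divide)
qed

lemma taylor_coeff_0: "taylor_coeff A 0 = A 0"
  by (simp add: taylor_coeff_def fps_expansion_def)

lemma holomorphic_on_suminf: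
  assumes S: "open S" and g: "\<And>n. g n holomorphic_on S"
    and M: "\<And>n x. x \<in> S \<Longrightarrow> norm (g n x) \<le> M n" "summable M"
  shows "(\<lambda>x. \<Sum>n. g n x) holomorphic_on S"
proof (rule holomorphic_uniform_sequence[OF S, where f="\<lambda>N x. \<Sum>n<N. g n x"])
  show "(\<lambda>x. \<Sum>n<N. g n x) holomorphic_on S" for N using g by (intro holomorphic_intros)
  fix x assume "x \<in> S"
  then obtain d where d: "d > 0" "cball x d \<subseteq> S" using S open_contains_cball by blast
  moreover have "uniform_limit (cball x d) (\<lambda>N x. \<Sum>n<N. g n x) (\<lambda>x. \<Sum>n. g n x) sequentially"
    by (rule Weierstrass_m_test[OF M(1) M(2)]) (use d in auto)
  ultimately show "\<exists>d. 0 < d \<and> cball x d \<subseteq> S \<and>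
      uniform_limit (cball x d) (\<lambda>N x. \<Sum>n<N. g n x) (\<lambda>x. \<Sum>n. g n x) sequentially" by blast
qed

section \<open>Partial fractions of 1/(q^n - 1) over the roots of unity lying in a set\<close>

definition root_mean :: "complex set \<Rightarrow> nat \<Rightarrow> complex \<Rightarrow> complex" where
  "root_mean X n q = (\<Sum>\<Lambda>\<in>{\<Lambda>. \<Lambda> ^ n = 1} \<inter> X. \<Lambda> / (q - \<Lambda>)) / of_nat n"

text \<open>The coefficient of z^n in \<open>delta_fun\<close>. Multiplied by 1/(q^n - 1) it yields
  the partial fractions whose poles lie on the half circle.\<close>

definition delta_poly :: "side \<Rightarrow> complex \<Rightarrow> nat \<Rightarrow> complex \<Rightarrow> complex" where
  "delta_poly s lam n q = (\<Sum>l<n. delta_coeff s lam n l * q ^ l)"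

lemma finite_roots_Int: "n \<ge> 1 \<Longrightarrow> finite ({\<Lambda>::complex. \<Lambda> ^ n = 1} \<inter> X)"
  using finite_roots_unity[of n] by auto

lemma card_roots_Int_le: "n \<ge> 1 \<Longrightarrow> card ({\<Lambda>::complex. \<Lambda> ^ n = 1} \<inter> X) \<le> n"
  using card_mono[OF finite_roots_unity[of n], of "{\<Lambda>::complex. \<Lambda> ^ n = 1} \<inter> X"]
    card_complex_roots_unity[of n] by auto

lemma norm_root_unity: "n \<ge> 1 \<Longrightarrow> \<Lambda> ^ n = 1 \<Longrightarrow> norm (\<Lambda>::complex) = 1"
  by (metis norm_one norm_power norm_ge_zero power_eq_1_iff not_one_le_zero)

text \<open>Multiplication by the primitive root \<open>w\<close> permutes the roots and multiplies
  the sum by w^(-l), which differs from 1 because n does not divide l.\<close>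

lemma sum_root_unity_powers:
  fixes n l :: nat
  assumes "0 < l" "l < n"
  shows "(\<Sum>\<Lambda>\<in>{\<Lambda>::complex. \<Lambda> ^ n = 1}. inverse (\<Lambda> ^ l)) = 0"
proof -
  define w where "w = cis (2 * pi / real n)"
  have "w ^ n = cis (real n * (2 * pi / real n))" by (simp only: w_def Complex.DeMoivre)
  also have "real n * (2 * pi / real n) = 2 * pi" using assms by simp
  finally have "w ^ n = cis (2 * pi)" .
  hence w: "w ^ n = 1" "w \<noteq> 0" by (simp, simp add: w_def)
  have "w ^ l \<noteq> 1"
  proof
    assume "w ^ l = 1"
    hence "cis (2 * pi * real l / real n) = 1" by (simp add: w_def Complex.DeMoivre mult_ac)
    hence "cos (2 * pi * real l / real n) = 1" by (metis cis.sel(1) one_complex.sel(1))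
    then obtain k :: int where k: "2 * pi * real l / real n = of_int k * 2 * pi"
      using cos_one_2pi_int by blast
    hence "real l = of_int k * real n" using assms by (simp add: field_simps)
    hence "int l = k * int n" by (metis of_int_eq_iff of_int_mult of_int_of_nat_eq)
    thus False using assms by (metis dvd_triv_right int_dvd_int_iff nat_dvd_not_less)
  qed
  let ?S = "\<Sum>\<Lambda>\<in>{\<Lambda>::complex. \<Lambda> ^ n = 1}. inverse (\<Lambda> ^ l)"
  have "?S = (\<Sum>\<Lambda>\<in>{\<Lambda>::complex. \<Lambda> ^ n = 1}. inverse ((w * \<Lambda>) ^ l))"
    by (rule sum.reindex_bij_witness[where i="\<lambda>x. w * x" and j="\<lambda>x. x / w"])
       (use w in \<open>auto simp: power_divide power_mult_distrib\<close>)
  also have "\<dots> = inverse (w ^ l) * ?S" by (simp add: power_mult_distrib sum_distrib_left)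
  finally show ?thesis using \<open>w ^ l \<noteq> 1\<close> by (metis inverse_1 inverse_eq_iff_eq mult_cancel_right1)
qed

lemma sum_root_powers:
  fixes q :: complex
  assumes "\<Lambda> ^ n = 1" "n \<ge> 1" "q \<noteq> \<Lambda>"
  shows "(\<Sum>l<n. inverse (\<Lambda> ^ l) * q ^ l) = (q ^ n - 1) * (\<Lambda> / (q - \<Lambda>))"
proof -
  have "\<Lambda> \<noteq> 0" using assms by (metis power_0_left not_one_le_zero zero_neq_one)
  have "(\<Sum>l<n. inverse (\<Lambda> ^ l) * q ^ l) = (\<Sum>l<n. (q / \<Lambda>) ^ l)"
    by (simp add: power_divide field_simps)
  also have "\<dots> = ((q / \<Lambda>) ^ n - 1) / (q / \<Lambda> - 1)"
    by (rule geometric_sum) (use assms \<open>\<Lambda> \<noteq> 0\<close> in auto)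
  also have "\<dots> = (q ^ n - 1) * (\<Lambda> / (q - \<Lambda>))"
    using assms \<open>\<Lambda> \<noteq> 0\<close> by (simp add: power_divide divide_simps)
  finally show ?thesis .
qed

lemma sum_weighted_root_powers:
  assumes "n \<ge> 1" "q ^ n \<noteq> 1"
  shows "(\<Sum>l<n. 1 / of_nat n * (\<Sum>\<Lambda>\<in>{\<Lambda>. \<Lambda> ^ n = 1} \<inter> X. inverse (\<Lambda> ^ l)) * q ^ l)
    = (q ^ n - 1) * root_mean X n q"
proof -
  have "(\<Sum>l<n. 1 / of_nat n * (\<Sum>\<Lambda>\<in>{\<Lambda>. \<Lambda> ^ n = 1} \<inter> X. inverse (\<Lambda> ^ l)) * q ^ l)
    = (\<Sum>l<n. \<Sum>\<Lambda>\<in>{\<Lambda>. \<Lambda> ^ n = 1} \<inter> X. inverse (\<Lambda> ^ l) * q ^ l) / of_nat n"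
    by (simp add: sum_distrib_right sum_divide_distrib)
  also have "\<dots> = (\<Sum>\<Lambda>\<in>{\<Lambda>. \<Lambda> ^ n = 1} \<inter> X. \<Sum>l<n. inverse (\<Lambda> ^ l) * q ^ l) / of_nat n"
    by (subst sum.swap) simp
  also have "\<dots> = (\<Sum>\<Lambda>\<in>{\<Lambda>. \<Lambda> ^ n = 1} \<inter> X. (q ^ n - 1) * (\<Lambda> / (q - \<Lambda>))) / of_nat n"
    by (intro arg_cong2[where f="(/)"] sum.cong sum_root_powers refl) (use assms in auto)
  finally show ?thesis by (simp add: root_mean_def sum_distrib_left)
qed

lemma sum_all_root_powers:
  fixes q :: complex
  assumes "n \<ge> 1"
  shows "(\<Sum>l<n. 1 / of_nat n * (\<Sum>\<Lambda>\<in>{\<Lambda>::complex. \<Lambda> ^ n = 1}. inverse (\<Lambda> ^ l)) * q ^ l) = 1"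
proof -
  have "(\<Sum>l<n. 1 / of_nat n * (\<Sum>\<Lambda>\<in>{\<Lambda>::complex. \<Lambda> ^ n = 1}. inverse (\<Lambda> ^ l)) * q ^ l)
      = (\<Sum>l<n. if l = 0 then 1 else 0)"
    using assms sum_root_unity_powers[of _ n] card_complex_roots_unity[of n] by (intro sum.cong) auto
  thus ?thesis using assms by simp
qed

text \<open>The weighted power sum over all roots is evaluated twice: only l = 0 survives, giving 1,
  while geometric sums in q/\<Lambda> give \<open>(q ^ n - 1) * root_mean UNIV n q\<close>.\<close>

lemma inverse_power_minus_one_eq:
  assumes "n \<ge> 1" "q ^ n \<noteq> 1"
  shows "1 / (q ^ n - 1) = root_mean UNIV n q"
  using sum_weighted_root_powers[OF assms, of UNIV] sum_all_root_powers[OF assms(1), of q] assms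
  by (simp add: field_simps)

lemma delta_poly_eq:
  assumes "n \<ge> 1" "q ^ n \<noteq> 1"
  shows "delta_poly s lam n q = (q ^ n - 1) * root_mean (half_circle s lam) n q"
  unfolding delta_poly_def delta_coeff_def by (rule sum_weighted_root_powers[OF assms])

text \<open>Replaces intervals of arguments by the sign of \<open>Im (\<Lambda> / lam)\<close>, the
  form in which distances to the poles can be estimated. The principal argument of
  \<open>\<Lambda> / lam\<close> selects the representative x.\<close>

lemma half_circle_eq:
  assumes "norm lam = 1"
  shows "half_circle Lower lam = {\<Lambda>. norm \<Lambda> = 1 \<and> Im (\<Lambda> / lam) < 0}"
    and "half_circle Upper lam = {\<Lambda>. norm \<Lambda> = 1 \<and> Im (\<Lambda> / lam) > 0}"
proof -
  define \<alpha> where "\<alpha> = Arg lam / (2 * pi)"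
  have lam: "lam = cis (2 * pi * \<alpha>)" using assms cis_Arg[of lam]
    by (cases "lam = 0") (auto simp: \<alpha>_def sgn_div_norm)
  have quot: "cis (2 * pi * x) / cis (2 * pi * \<beta>) = cis (2 * pi * (x - \<beta>))" for x \<beta>
    by (simp add: cis_divide algebra_simps)
  have repr: "\<exists>x. \<Lambda> = cis (2 * pi * x) \<and> Arg (\<Lambda> / lam) = 2 * pi * (x - \<alpha>)" if "norm \<Lambda> = 1" for \<Lambda>
  proof -
    have "\<Lambda> / lam = cis (Arg (\<Lambda> / lam))" using that assms cis_Arg[of "\<Lambda>/lam"]
      by (cases "\<Lambda> / lam = 0") (auto simp: sgn_div_norm norm_divide)
    hence "\<Lambda> = cis (Arg (\<Lambda> / lam)) * cis (2 * pi * \<alpha>)" using lam assms by (auto simp: field_simps)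
    hence "\<Lambda> = cis (2 * pi * (Arg (\<Lambda> / lam) / (2 * pi) + \<alpha>))" by (simp add: cis_mult algebra_simps)
    thus ?thesis by (intro exI[of _ "Arg (\<Lambda> / lam) / (2 * pi) + \<alpha>"]) auto
  qed
  have nz: "\<Lambda> / lam \<noteq> 0" if "norm \<Lambda> = 1" for \<Lambda> using that assms by auto
  show "half_circle Lower lam = {\<Lambda>. norm \<Lambda> = 1 \<and> Im (\<Lambda> / lam) < 0}"
  proof (intro set_eqI iffI)
    fix \<Lambda> assume "\<Lambda> \<in> half_circle Lower lam"
    then obtain x \<beta> where x: "\<Lambda> = cis (2 * pi * x)" "lam = cis (2 * pi * \<beta>)" "\<beta> - 1/2 < x" "x < \<beta>"
      by auto
    have "sin (2 * pi * (\<beta> - x)) > 0"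
      using x mult_strict_left_mono[of "\<beta> - x" "1/2" "2 * pi"] by (intro sin_gt_zero) auto
    moreover have "Im (\<Lambda> / lam) = - sin (2 * pi * (\<beta> - x))"
      using sin_minus[of "2 * pi * (\<beta> - x)"] unfolding x quot by (simp add: algebra_simps)
    ultimately show "\<Lambda> \<in> {\<Lambda>. norm \<Lambda> = 1 \<and> Im (\<Lambda> / lam) < 0}" using x by auto
  next
    fix \<Lambda> assume L: "\<Lambda> \<in> {\<Lambda>. norm \<Lambda> = 1 \<and> Im (\<Lambda> / lam) < 0}"
    then obtain x where x: "\<Lambda> = cis (2 * pi * x)" "Arg (\<Lambda> / lam) = 2 * pi * (x - \<alpha>)"
      using repr by auto
    have "Arg (\<Lambda> / lam) < 0" "Arg (\<Lambda> / lam) > -pi" using L Arg_neg_iff[of "\<Lambda>/lam"] mpi_less_Arg by auto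
    hence *: "2 * pi * (x - \<alpha>) < 0" "2 * pi * (x - \<alpha>) > - pi" using x(2) by auto
    hence "x < \<alpha>" "\<alpha> - 1/2 < x"
      using mult_left_mono[of "x - \<alpha>" "-1/2" "2 * pi"]
      by (auto simp: mult_less_0_iff pi_gt_zero[THEN order.asym]) (smt (verit))
    thus "\<Lambda> \<in> half_circle Lower lam" using x lam by auto
  qed
  show "half_circle Upper lam = {\<Lambda>. norm \<Lambda> = 1 \<and> Im (\<Lambda> / lam) > 0}"
  proof (intro set_eqI iffI)
    fix \<Lambda> assume "\<Lambda> \<in> half_circle Upper lam"
    then obtain x \<beta> where x: "\<Lambda> = cis (2 * pi * x)" "lam = cis (2 * pi * \<beta>)" "\<beta> < x" "x < \<beta> + 1/2"
      by auto
    have "sin (2 * pi * (x - \<beta>)) > 0"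
      using x mult_strict_left_mono[of "x - \<beta>" "1/2" "2 * pi"] by (intro sin_gt_zero) auto
    moreover have "Im (\<Lambda> / lam) = sin (2 * pi * (x - \<beta>))"
      using x quot by simp
    ultimately show "\<Lambda> \<in> {\<Lambda>. norm \<Lambda> = 1 \<and> Im (\<Lambda> / lam) > 0}" using x by auto
  next
    fix \<Lambda> assume L: "\<Lambda> \<in> {\<Lambda>. norm \<Lambda> = 1 \<and> Im (\<Lambda> / lam) > 0}"
    then obtain x where x: "\<Lambda> = cis (2 * pi * x)" "Arg (\<Lambda> / lam) = 2 * pi * (x - \<alpha>)"
      using repr by auto
    have "Arg (\<Lambda> / lam) > 0" "Arg (\<Lambda> / lam) < pi" using L Arg_lt_pi[of "\<Lambda>/lam"] by auto
    hence *: "2 * pi * (x - \<alpha>) > 0" "2 * pi * (x - \<alpha>) < pi" using x(2) by auto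
    hence "\<alpha> < x" "x < \<alpha> + 1/2"
      using mult_left_mono[of "1/2" "x - \<alpha>" "2 * pi"]
      by (auto simp: zero_less_mult_iff pi_gt_zero[THEN order.asym])
    thus "\<Lambda> \<in> half_circle Upper lam" using x lam by auto
  qed
qed

text \<open>The only points of the circle off both half circles are \<open>lam\<close> and
  \<open>- lam\<close>. If one of them were an n-th root of unity, then lam^(2n) = 1, so all roots
  are counted exactly once.\<close>

lemma delta_poly_Lower_plus_Upper:
  assumes lam: "norm lam = 1" "\<And>n. n \<ge> 1 \<Longrightarrow> lam ^ n \<noteq> 1" and n: "n \<ge> 1"
  shows "delta_poly Lower lam n q + delta_poly Upper lam n q = 1"
proof -
  let ?R = "{\<Lambda>::complex. \<Lambda> ^ n = 1}"
  have "Im (\<Lambda> / lam) \<noteq> 0" if "\<Lambda> ^ n = 1" for \<Lambda>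
  proof
    assume Im: "Im (\<Lambda> / lam) = 0"
    have "norm (\<Lambda> / lam) = 1" using norm_root_unity[OF n that] lam by (simp add: norm_divide)
    hence "\<bar>Re (\<Lambda> / lam)\<bar> = 1" using cmod_eq_Re[OF Im] by simp
    hence "Re (\<Lambda> / lam) = 1 \<or> Re (\<Lambda> / lam) = - 1" by linarith
    hence "\<Lambda> / lam = 1 \<or> \<Lambda> / lam = -1" using Im unfolding complex_eq_iff by simp
    moreover have "lam \<noteq> 0" using lam by auto
    ultimately have "lam = \<Lambda> \<or> lam = - \<Lambda>" by (auto simp: divide_eq_eq)
    hence "lam\<^sup>2 = \<Lambda>\<^sup>2" by auto
    hence "lam ^ (2 * n) = (\<Lambda> ^ n)\<^sup>2" by (metis power_mult mult.commute)
    hence "lam ^ (n * 2) = 1" using that by (simp add: mult.commute)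
    thus False using lam(2)[of "n * 2"] n by auto
  qed
  hence R: "?R \<inter> half_circle Lower lam \<union> ?R \<inter> half_circle Upper lam = ?R"
    unfolding half_circle_eq[OF lam(1)] using norm_root_unity[OF n] by (auto simp: not_less less_le)
  have "?R \<inter> half_circle Lower lam \<inter> (?R \<inter> half_circle Upper lam) = {}"
    unfolding half_circle_eq[OF lam(1)] by auto
  hence "(\<Sum>\<Lambda>\<in>?R \<inter> half_circle Lower lam. inverse (\<Lambda> ^ l)) + (\<Sum>\<Lambda>\<in>?R \<inter> half_circle Upper lam. inverse (\<Lambda> ^ l))
      = (\<Sum>\<Lambda>\<in>?R. inverse (\<Lambda> ^ l))" for l
    using finite_roots_Int[OF n] by (subst sum.union_disjoint[symmetric]) (auto simp: R simp del: half_circle.simps)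
  hence "delta_poly Lower lam n q + delta_poly Upper lam n q
     = (\<Sum>l<n. 1 / of_nat n * (\<Sum>\<Lambda>\<in>?R. inverse (\<Lambda> ^ l)) * q ^ l)"
    unfolding delta_poly_def delta_coeff_def sum.distrib[symmetric] distrib_right[symmetric] distrib_left[symmetric] by simp
  thus ?thesis using sum_all_root_powers[OF n] by simp
qed

lemma norm_delta_coeff_le: "n \<ge> 1 \<Longrightarrow> norm (delta_coeff s lam n l) \<le> 1"
proof -
  assume n: "n \<ge> 1"
  let ?R = "{\<Lambda>::complex. \<Lambda> ^ n = 1} \<inter> half_circle s lam"
  have "norm (\<Sum>\<Lambda>\<in>?R. inverse (\<Lambda> ^ l)) \<le> (\<Sum>\<Lambda>\<in>?R. 1)"
    by (rule sum_norm_le) (use norm_root_unity[OF n] in \<open>auto simp: norm_inverse norm_power\<close>)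
  also have "\<dots> \<le> real n" using card_roots_Int_le[OF n, of "half_circle s lam"] by simp
  finally show ?thesis using n by (simp add: delta_coeff_def norm_mult norm_divide divide_simps)
qed

text \<open>Coefficients of modulus at most 1 are dominated by binomial coefficients. The result is
  a clean n-th power, valid for every \<open>q\<close> and easy to use in geometric series.\<close>

lemma norm_delta_poly_sum_le:
  assumes "n \<ge> 1"
  shows "(\<Sum>l<n. norm (delta_coeff s lam n l * q ^ l)) \<le> (1 + norm q) ^ n"
proof -
  have "(\<Sum>l<n. norm (delta_coeff s lam n l * q ^ l)) \<le> (\<Sum>l<n. of_nat (n choose l) * norm q ^ l)"
  proof (rule sum_mono)
    fix l assume "l \<in> {..<n}"
    hence "n choose l \<ge> 1" by (simp add: Suc_leI)
    hence "1 \<le> real (n choose l)" by linarith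
    thus "norm (delta_coeff s lam n l * q ^ l) \<le> of_nat (n choose l) * norm q ^ l"
      using norm_delta_coeff_le[OF assms, of s lam l]
      by (auto simp: norm_mult norm_power intro!: mult_right_mono)
  qed
  also have "\<dots> \<le> (\<Sum>l\<le>n. of_nat (n choose l) * norm q ^ l)"
    by (rule sum_mono2) auto
  also have "\<dots> = (norm q + 1) ^ n" by (simp add: binomial_ring)
  finally show ?thesis by (simp add: add.commute)
qed

text \<open>For |z| < 1/(1 + |q|) the double series converges absolutely, so it may be summed over l
  first.\<close>

lemma taylor_coeff_delta_fun: "taylor_coeff (delta_fun s lam q) n = delta_poly s lam n q"
proof (rule taylor_coeff_eqI)
  show "1 / (1 + norm q) > 0" by (simp add: add_pos_nonneg)
  fix z :: complex assume z: "z \<in> ball 0 (1 / (1 + norm q))"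
  define t where "t = (\<lambda>(n::nat, l::nat). delta_coeff s lam n l * q ^ l * z ^ n)"
  have small: "(1 + norm q) * norm z < 1" using z by (simp add: field_simps add_pos_nonneg)
  have bound: "(\<Sum>l<n. norm (t (n, l))) \<le> ((1 + norm q) * norm z) ^ n" for n
  proof (cases "n \<ge> 1")
    case True
    have "(\<Sum>l<n. norm (t (n, l))) = (\<Sum>l<n. norm (delta_coeff s lam n l * q ^ l)) * norm z ^ n"
      by (simp add: t_def sum_distrib_right norm_mult norm_power)
    also have "\<dots> \<le> (1 + norm q) ^ n * norm z ^ n"
      by (intro mult_right_mono norm_delta_poly_sum_le True) auto
    finally show ?thesis by (simp add: power_mult_distrib)
  qed (simp add: not_le)
  have "summable (\<lambda>n. \<Sum>l<n. norm (t (n, l)))"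
    by (rule summable_comparison_test'[where g="\<lambda>n. ((1 + norm q) * norm z) ^ n" and N=0])
       (use bound small in \<open>auto intro!: summable_geometric simp: abs_mult sum_nonneg\<close>)
  hence "(\<lambda>x. norm (t x)) summable_on Sigma UNIV (\<lambda>n. {..<n})"
    by (subst Infinite_Sum.abs_summable_on_Sigma_iff) (auto simp: summable_on_UNIV_nonneg_real_iff sum_nonneg)
  hence "t summable_on Sigma UNIV (\<lambda>n. {..<n})" by (rule abs_summable_summable)
  hence "(t has_sum infsum t (Sigma UNIV (\<lambda>n. {..<n}))) (Sigma UNIV (\<lambda>n. {..<n}))" by simp
  moreover have "infsum t (Sigma UNIV (\<lambda>n. {..<n})) = delta_fun s lam q z"
    unfolding delta_fun_def
    by (rule infsum_reindex_bij_witness[where i="\<lambda>(l,n). (n,l)" and j="\<lambda>(l,n). (n,l)"])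
       (auto simp: t_def)
  ultimately have "(t has_sum delta_fun s lam q z) (Sigma UNIV (\<lambda>n. {..<n}))" by simp
  hence "((\<lambda>n. \<Sum>l<n. t (n, l)) has_sum delta_fun s lam q z) UNIV"
    by (rule has_sum_SigmaD) (auto intro!: has_sum_finite)
  hence "(\<lambda>n. \<Sum>l<n. t (n, l)) sums delta_fun s lam q z" by (rule has_sum_imp_sums)
  thus "(\<lambda>n. delta_poly s lam n q * z ^ n) sums delta_fun s lam q z"
    by (simp add: t_def delta_poly_def sum_distrib_right)
qed

section \<open>Gevrey estimates for series of modes\<close>

text \<open>On [x, x+1] the integrand t^a exp(-t) of \<open>Gamma (1 + a)\<close> is at least x^a
  exp(-(x+1)), which is where the factor \<open>exp 1\<close> comes from.\<close>

lemma powr_exp_le_Gamma: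
  fixes x a :: real
  assumes "x > 0" "a \<ge> 0"
  shows "x powr a * exp (- x) \<le> exp 1 * Gamma (1 + a)"
proof -
  have I: "((\<lambda>t. t powr a / exp t) has_integral Gamma (1 + a)) {0..}"
    using Gamma_integral_real[of "1 + a"] assms by simp
  have "(\<lambda>t. t powr a / exp t) integrable_on {x..x+1}"
    by (rule integrable_continuous_interval) (use assms in \<open>auto intro!: continuous_intros\<close>)
  then obtain i where i: "((\<lambda>t. t powr a / exp t) has_integral i) {x..x+1}" by blast
  have "((\<lambda>t. x powr a / exp (x + 1)) has_integral (x powr a / exp (x + 1))) {x..x+1}"
    using has_integral_const_real[of "x powr a / exp (x + 1)" x "x + 1"] by simp
  hence "x powr a / exp (x + 1) \<le> i"
    by (rule has_integral_le[OF _ i]) (use assms in \<open>auto intro!: frac_le powr_mono2\<close>)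
  also have "i \<le> Gamma (1 + a)" by (rule has_integral_subset_le[OF _ i I]) (use assms in auto)
  finally have "x powr a / exp (x + 1) \<le> Gamma (1 + a)" .
  thus ?thesis by (simp add: exp_add exp_minus field_simps)
qed

text \<open>Removes from the argument of \<open>Gamma\<close> a shift that does not depend on the
  Gevrey index N, at the price of a polynomial in N.\<close>

lemma Gamma_add_nat_le:
  fixes x :: real
  assumes "x \<ge> 0"
  shows "Gamma (1 + x + real m) \<le> (x + real m) ^ m * Gamma (1 + x)"
proof (induction m)
  case (Suc m)
  have "Gamma (1 + x + real (Suc m)) = (1 + x + real m) * Gamma (1 + x + real m)"
  proof -
    have "1 + x + real m \<notin> \<int>\<^sub>\<le>\<^sub>0" using assms nonpos_Ints_nonpos by force
    from Gamma_plus1[OF this] show ?thesis by (simp add: algebra_simps)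
  qed
  also have "\<dots> \<le> (1 + x + real m) * ((x + real m) ^ m * Gamma (1 + x))"
    using Suc assms by (intro mult_left_mono) auto
  also have "\<dots> \<le> (1 + x + real m) * ((1 + x + real m) ^ m * Gamma (1 + x))"
    using assms by (intro mult_left_mono mult_right_mono power_mono) auto
  finally show ?case by (simp add: add_ac mult_ac)
qed simp

lemma power_le_fact_exp: "x \<ge> 0 \<Longrightarrow> x ^ m \<le> fact m * exp (x::real)"
proof -
  assume "x \<ge> 0"
  hence "x ^ m / fact m \<le> (\<Sum>n. x ^ n / fact n)"
    using sum_le_suminf[of "\<lambda>n. x ^ n / fact n" "{m}"] summable_exp[of x]
    by (auto simp: divide_inverse mult_ac)
  also have "\<dots> = exp x" by (simp add: exp_def divide_inverse mult_ac)
  finally show ?thesis by (simp add: field_simps)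
qed

text \<open>The decay \<theta>^n = exp(-2 \<epsilon> n) is split in two: one half bounds the power
  of n by \<epsilon>^(-a) times \<open>Gamma (1 + a)\<close>, the other half makes the sum converge.
  The polynomial (s N + m)^m caused by the shift m is absorbed into exp(s N + m), that is, into
  c1^N.\<close>

lemma geometric_powr_sum_Gamma_bound:
  fixes \<theta> s :: real and m :: nat
  assumes \<theta>: "0 < \<theta>" "\<theta> < 1" and s: "s \<ge> 0"
  shows "\<exists>c0>0. \<exists>c1>0. \<forall>N::nat. summable (\<lambda>n. \<theta> ^ n * real (Suc n) powr (s * real N + real m))
     \<and> (\<Sum>n. \<theta> ^ n * real (Suc n) powr (s * real N + real m)) \<le> c0 * c1 ^ N * Gamma (1 + real N * s)"
proof -
  define \<epsilon> where "\<epsilon> = - ln \<theta> / 2"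
  have \<epsilon>: "\<epsilon> > 0" using \<theta> by (auto simp: \<epsilon>_def)
  have \<theta>\<epsilon>: "\<theta> = exp (- 2 * \<epsilon>)" using \<theta> by (simp add: \<epsilon>_def)
  define W where "W = exp \<epsilon> * (\<Sum>n. exp (- \<epsilon>) ^ n)"
  have geo: "summable (\<lambda>n. exp (- \<epsilon>) ^ n)" using \<epsilon> by (intro summable_geometric) auto
  have W: "W > 0" unfolding W_def using geo by (intro mult_pos_pos suminf_pos) auto
  have main: "summable (\<lambda>n. \<theta> ^ n * real (Suc n) powr a) \<and>
      (\<Sum>n. \<theta> ^ n * real (Suc n) powr a) \<le> \<epsilon> powr (- a) * exp 1 * Gamma (1 + a) * W" if a: "a \<ge> 0" for a
  proof -
    define C where "C = \<epsilon> powr (- a) * exp 1 * Gamma (1 + a)"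
    have le: "\<theta> ^ n * real (Suc n) powr a \<le> C * (exp \<epsilon> * exp (- \<epsilon>) ^ n)" for n
    proof -
      have "(\<epsilon> * real (Suc n)) powr a * exp (- (\<epsilon> * real (Suc n))) \<le> exp 1 * Gamma (1 + a)"
        using \<epsilon> a by (intro powr_exp_le_Gamma) auto
      hence "real (Suc n) powr a \<le> C * exp (\<epsilon> * real (Suc n))"
        using \<epsilon> by (simp add: C_def powr_mult powr_minus exp_minus field_simps del: of_nat_Suc)
      hence "\<theta> ^ n * real (Suc n) powr a \<le> \<theta> ^ n * (C * exp (\<epsilon> * real (Suc n)))"
        using \<theta> by (intro mult_left_mono) auto
      also have "\<dots> = C * (exp \<epsilon> * exp (- \<epsilon>) ^ n)"
        by (simp add: \<theta>\<epsilon> exp_of_nat_mult[symmetric] exp_add[symmetric] algebra_simps)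
      finally show ?thesis .
    qed
    have sm: "summable (\<lambda>n. C * (exp \<epsilon> * exp (- \<epsilon>) ^ n))" using geo by (intro summable_mult)
    have sm2: "summable (\<lambda>n. \<theta> ^ n * real (Suc n) powr a)"
      by (rule summable_comparison_test'[OF sm, of 0]) (use le \<theta> in auto)
    have "(\<Sum>n. \<theta> ^ n * real (Suc n) powr a) \<le> (\<Sum>n. C * (exp \<epsilon> * exp (- \<epsilon>) ^ n))"
      by (rule suminf_le[OF le sm2 sm])
    also have "\<dots> = C * W" unfolding W_def using geo by (simp add: suminf_mult summable_mult)
    finally show ?thesis using sm2 by (simp add: C_def)
  qed
  define c0 where "c0 = \<epsilon> powr (- real m) * exp 1 * W * fact m * exp (real m)"
  define c1 where "c1 = \<epsilon> powr (- s) * exp s"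
  have "(\<Sum>n. \<theta> ^ n * real (Suc n) powr (s * real N + real m)) \<le> c0 * c1 ^ N * Gamma (1 + real N * s)" for N :: nat
  proof -
    let ?x = "s * real N"
    have x: "?x \<ge> 0" using s by simp
    have "Gamma (1 + (?x + real m)) \<le> (?x + real m) ^ m * Gamma (1 + ?x)"
      using Gamma_add_nat_le[OF x, of m] by (simp add: add_ac)
    also have "\<dots> \<le> fact m * exp (?x + real m) * Gamma (1 + ?x)"
      using x by (intro mult_right_mono power_le_fact_exp) auto
    finally have G: "Gamma (1 + (?x + real m)) \<le> fact m * exp (?x + real m) * Gamma (1 + ?x)" .
    have "(\<Sum>n. \<theta> ^ n * real (Suc n) powr (?x + real m))
       \<le> \<epsilon> powr (- (?x + real m)) * exp 1 * Gamma (1 + (?x + real m)) * W"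
      using main[of "?x + real m"] x by simp
    also have "\<dots> \<le> \<epsilon> powr (- (?x + real m)) * exp 1 * (fact m * exp (?x + real m) * Gamma (1 + ?x)) * W"
      using G W by (intro mult_left_mono mult_right_mono) auto
    also have "\<dots> = c0 * c1 ^ N * Gamma (1 + real N * s)"
    proof -
      have "\<epsilon> powr (- (?x + real m)) = (\<epsilon> powr (- s)) ^ N * \<epsilon> powr (- real m)"
        using \<epsilon> by (simp add: powr_realpow[symmetric] powr_powr powr_add[symmetric] algebra_simps)
      moreover have "exp (?x + real m) = exp s ^ N * exp (real m)"
        by (simp add: exp_add exp_of_nat_mult[symmetric] mult_ac)
      ultimately show ?thesis by (simp add: c0_def c1_def power_mult_distrib mult_ac)
    qed
    finally show ?thesis .
  qed
  moreover have "c0 > 0" "c1 > 0" using W \<epsilon> by (auto simp: c0_def c1_def)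
  moreover have "summable (\<lambda>n. \<theta> ^ n * real (Suc n) powr (s * real N + real m))" for N :: nat
    using main[of "s * real N + real m"] s by simp
  ultimately show ?thesis by blast
qed

text \<open>The sequence \<open>c\<close> carries the decay in \<open>z\<close> and \<open>d\<close>
  the dependence on \<open>q\<close>. Solutions, their Hadamard products and their expansion
  coefficients all have this form. Summation starts at z^1 because elements of \<open>B r\<close>
  vanish at 0.\<close>

definition mode_series :: "(nat \<Rightarrow> complex) \<Rightarrow> (nat \<Rightarrow> complex) \<Rightarrow> complex \<Rightarrow> complex" where
  "mode_series c d z = (\<Sum>n. c n * d n * z ^ Suc n)"

context
  fixes r M \<theta> :: real and c :: "nat \<Rightarrow> complex"
  assumes r: "r > 0" and \<theta>: "0 < \<theta>" "\<theta> < 1" and M: "M \<ge> 0"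
    and c: "\<And>n. norm (c n) * r ^ Suc n \<le> M * \<theta> ^ n"
begin

lemma mode_term_bound:
  assumes d: "norm (d n) \<le> K * real (Suc n) powr b" and K: "K \<ge> 0" and z: "z \<in> ball 0 r"
  shows "norm (c n * d n * z ^ Suc n) \<le> M * K * (\<theta> ^ n * real (Suc n) powr b)"
proof -
  have "norm (c n * d n * z ^ Suc n) = norm (c n) * norm z ^ Suc n * norm (d n)"
    by (simp add: norm_mult norm_power)
  also have "\<dots> \<le> norm (c n) * r ^ Suc n * norm (d n)"
    using z by (intro mult_right_mono mult_left_mono power_mono) auto
  also have "\<dots> \<le> M * \<theta> ^ n * (K * real (Suc n) powr b)"
    using M \<theta> K d by (intro mult_mono c) auto
  finally show ?thesis by (simp add: mult_ac)
qed

lemma summable_weights: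
  assumes "b \<ge> 0"
  shows "summable (\<lambda>n. \<theta> ^ n * real (Suc n) powr b)"
proof -
  obtain c0 c1 where "\<forall>N::nat. summable (\<lambda>n. \<theta> ^ n * real (Suc n) powr (b * real N + real 0))
     \<and> (\<Sum>n. \<theta> ^ n * real (Suc n) powr (b * real N + real 0)) \<le> c0 * c1 ^ N * Gamma (1 + real N * b)"
    using geometric_powr_sum_Gamma_bound[OF \<theta> assms, of 0] by blast
  from this[rule_format, of 1] show ?thesis by simp
qed

lemma mode_series_summable:
  assumes "\<And>n. norm (d n) \<le> K * real (Suc n) powr b" "b \<ge> 0" "K \<ge> 0" "z \<in> ball 0 r"
  shows "summable (\<lambda>n. c n * d n * z ^ Suc n)"
  by (rule summable_comparison_test'[OF summable_mult[OF summable_weights[OF assms(2)], of "M * K"], of 0])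
     (rule mode_term_bound[OF assms(1,3,4)])

lemma mode_series_bound:
  assumes "\<And>n. norm (d n) \<le> K * real (Suc n) powr b" "b \<ge> 0" "K \<ge> 0" "z \<in> ball 0 r"
  shows "norm (mode_series c d z) \<le> M * K * (\<Sum>n. \<theta> ^ n * real (Suc n) powr b)"
proof -
  have "norm (mode_series c d z) \<le> (\<Sum>n. M * K * (\<theta> ^ n * real (Suc n) powr b))"
    unfolding mode_series_def
    by (rule norm_suminf_le) (use mode_term_bound assms summable_mult[OF summable_weights[OF assms(2)]] in auto)
  thus ?thesis using summable_weights[OF assms(2)] by (simp add: suminf_mult)
qed

lemma mode_series_B:
  assumes d: "\<And>n. norm (d n) \<le> K * real (Suc n) powr b" "b \<ge> 0" "K \<ge> 0"
  shows "mode_series c d \<in> B r"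
proof (rule B_I[OF _ mode_series_bound[OF d]])
  show "mode_series c d holomorphic_on ball 0 r"
    unfolding mode_series_def
    by (rule holomorphic_on_suminf[OF _ _ _ summable_mult[OF summable_weights[OF d(2)], of "M * K"]])
       (auto intro!: holomorphic_intros mode_term_bound d simp del: of_nat_Suc power_Suc)
qed (auto simp: mode_series_def)

lemma mode_series_B_holomorphic:
  assumes \<Delta>: "open \<Delta>" and \<phi>: "\<And>n. \<phi> n holomorphic_on \<Delta>"
    and d: "\<And>n t. t \<in> \<Delta> \<Longrightarrow> norm (\<phi> n t) \<le> K * real (Suc n) powr b" "b \<ge> 0" "K \<ge> 0"
  shows "B_holomorphic_on r (\<lambda>t. mode_series c (\<lambda>n. \<phi> n t)) \<Delta>"
proof (rule B_holomorphic_onI[OF \<Delta> _ _ mode_series_bound[OF d] r])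
  show "mode_series c (\<lambda>n. \<phi> n t) \<in> B r" if "t \<in> \<Delta>" for t
    by (rule mode_series_B[OF d(1)[OF that] d(2,3)])
  show "(\<lambda>t. mode_series c (\<lambda>n. \<phi> n t) z) holomorphic_on \<Delta>" if z: "z \<in> ball 0 r" for z
    unfolding mode_series_def
    by (rule holomorphic_on_suminf[OF \<Delta> _ _ summable_mult[OF summable_weights[OF d(2)], of "M * K"]])
       (use z in \<open>auto intro!: holomorphic_intros \<phi> mode_term_bound d simp del: of_nat_Suc power_Suc\<close>)
qed

text \<open>Each order of the expansion may lose a factor n^s in mode n; the geometric decay of
  \<open>c\<close> pays for it, and the price is \<open>Gamma (1 + N * s)\<close>. The exponent m
  leaves room for a loss common to all orders.\<close>

lemma gevrey_asymptotic_mode_series: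
  fixes s A K :: real and m :: nat
  assumes \<Delta>: "open \<Delta>" and \<phi>: "\<And>n. \<phi> n holomorphic_on \<Delta>"
    and s: "s \<ge> 0" and K: "K \<ge> 0" and A: "A > 0"
    and rem: "\<And>n N t. t \<in> \<Delta> \<Longrightarrow> norm (\<phi> n t - (\<Sum>k<N. p n k * (t - t0) ^ k))
        \<le> K * A ^ N * real (Suc n) powr (s * real N + real m) * norm (t - t0) ^ N"
    and p: "\<And>n k. norm (p n k) \<le> K * A ^ k * real (Suc n) powr (s * real k + real m)"
  shows "gevrey_asymptotic_on s t0 r \<Delta> (\<lambda>t. mode_series c (\<lambda>n. \<phi> n t)) (\<lambda>k. mode_series c (\<lambda>n. p n k))"
  unfolding gevrey_asymptotic_on_def
proof (intro conjI allI)
  \<comment> \<open>The remainder estimate at N = 0 is a bound for the modes themselves.\<close>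
  have b: "norm (\<phi> n t) \<le> K * real (Suc n) powr (real m)" if "t \<in> \<Delta>" for n t
    using rem[OF that, of n 0] by simp
  show "B_holomorphic_on r (\<lambda>t. mode_series c (\<lambda>n. \<phi> n t)) \<Delta>"
    by (rule mode_series_B_holomorphic[OF \<Delta> \<phi> b]) (use K in auto)
  show "mode_series c (\<lambda>n. p n k) \<in> B r" for k
    by (rule mode_series_B[OF p]) (use K A s in auto)
  obtain c0 c1 where c01: "c0 > 0" "c1 > 0" and
    G: "\<And>N::nat. (\<Sum>n. \<theta> ^ n * real (Suc n) powr (s * real N + real m)) \<le> c0 * c1 ^ N * Gamma (1 + real N * s)"
    using geometric_powr_sum_Gamma_bound[OF \<theta> s, of m] by blast
  \<comment> \<open>\<open>M * K + 1\<close> instead of \<open>M * K\<close>, because the Gevrey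
    constants have to be positive while \<open>M\<close> or \<open>K\<close> may vanish.\<close>
  have "B_norm r (\<lambda>z. mode_series c (\<lambda>n. \<phi> n t) z - (\<Sum>k<N. mode_series c (\<lambda>n. p n k) z * (t - t0) ^ k))
     \<le> ((M * K + 1) * c0) * (A * c1) ^ N * Gamma (1 + real N * s) * norm (t - t0) ^ N"
    if t: "t \<in> \<Delta>" for N t
  proof (rule B_norm_leI[OF r])
    fix z :: complex assume z: "z \<in> ball 0 r"
    let ?d = "\<lambda>n. \<phi> n t - (\<Sum>k<N. p n k * (t - t0) ^ k)"
    have sm: "summable (\<lambda>n. c n * \<phi> n t * z ^ Suc n)"
      by (rule mode_series_summable[OF b[OF t]]) (use K z in auto)
    have smp: "summable (\<lambda>n. c n * p n k * z ^ Suc n)" for k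
      by (rule mode_series_summable[OF p]) (use K A s z in auto)
    have "(\<Sum>k<N. mode_series c (\<lambda>n. p n k) z * (t - t0) ^ k)
      = (\<Sum>k<N. \<Sum>n. c n * p n k * z ^ Suc n * (t - t0) ^ k)"
      unfolding mode_series_def by (intro sum.cong refl suminf_mult2 smp)
    also have "\<dots> = (\<Sum>n. \<Sum>k<N. c n * p n k * z ^ Suc n * (t - t0) ^ k)"
      by (rule suminf_sum[symmetric]) (intro summable_mult2 smp)
    finally have "mode_series c (\<lambda>n. \<phi> n t) z - (\<Sum>k<N. mode_series c (\<lambda>n. p n k) z * (t - t0) ^ k)
      = (\<Sum>n. c n * \<phi> n t * z ^ Suc n) - (\<Sum>n. \<Sum>k<N. c n * p n k * z ^ Suc n * (t - t0) ^ k)"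
      by (simp add: mode_series_def)
    also have "\<dots> = (\<Sum>n. c n * \<phi> n t * z ^ Suc n - (\<Sum>k<N. c n * p n k * z ^ Suc n * (t - t0) ^ k))"
      by (rule suminf_diff[OF sm]) (intro summable_sum summable_mult2 smp)
    also have "\<dots> = mode_series c ?d z"
      unfolding mode_series_def by (simp add: algebra_simps sum_distrib_left)
    finally have eq: "mode_series c (\<lambda>n. \<phi> n t) z - (\<Sum>k<N. mode_series c (\<lambda>n. p n k) z * (t - t0) ^ k)
        = mode_series c ?d z" .
    have "norm (mode_series c ?d z) \<le> M * (K * A ^ N * norm (t - t0) ^ N) * (\<Sum>n. \<theta> ^ n * real (Suc n) powr (s * real N + real m))"
      by (rule mode_series_bound) (use rem[OF t, of _ N] K A s z in \<open>auto simp: mult_ac\<close>)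
    also have "\<dots> \<le> M * (K * A ^ N * norm (t - t0) ^ N) * (c0 * c1 ^ N * Gamma (1 + real N * s))"
      using M K A by (intro mult_left_mono G) auto
    also have "\<dots> = (M * K) * (c0 * (A * c1) ^ N * Gamma (1 + real N * s) * norm (t - t0) ^ N)"
      by (simp add: power_mult_distrib mult_ac)
    also have "\<dots> \<le> (M * K + 1) * (c0 * (A * c1) ^ N * Gamma (1 + real N * s) * norm (t - t0) ^ N)"
      using c01 A s by (intro mult_right_mono mult_nonneg_nonneg Gamma_real_nonneg) (auto simp: add_pos_nonneg)
    finally show "norm (mode_series c (\<lambda>n. \<phi> n t) z - (\<Sum>k<N. mode_series c (\<lambda>n. p n k) z * (t - t0) ^ k))
       \<le> ((M * K + 1) * c0) * (A * c1) ^ N * Gamma (1 + real N * s) * norm (t - t0) ^ N"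
      unfolding eq by (simp add: mult_ac)
  qed
  moreover have "(M * K + 1) * c0 > 0" "A * c1 > 0" using M K c01 A by (auto simp: add_nonneg_pos)
  ultimately show "\<exists>c0>0. \<exists>c1>0. \<forall>N. \<forall>t\<in>\<Delta>.
      B_norm r (\<lambda>z. mode_series c (\<lambda>n. \<phi> n t) z - (\<Sum>k<N. mode_series c (\<lambda>n. p n k) z * (t - t0) ^ k))
       \<le> c0 * c1 ^ N * Gamma (1 + real N * s) * norm (t - t0) ^ N" by blast
qed

end

section \<open>Partial fractions on tangent disks and cardioids\<close>

text \<open>The geometric series in x/y with its exact remainder. With x = q - lam and y = lam -
  \<Lambda>, only the single factor x + y = q - \<Lambda> of the denominator depends on
  \<open>q\<close>.\<close>

lemma cauchy_kernel_remainder: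
  fixes x y :: "'a :: field"
  assumes "y \<noteq> 0" "x + y \<noteq> 0"
  shows "1 / (x + y) - (\<Sum>j<J. (- 1) ^ j / y ^ Suc j * x ^ j) = (- x) ^ J / (y ^ J * (x + y))"
proof (induction J)
  case (Suc J)
  have "1 / (x + y) - (\<Sum>j<Suc J. (- 1) ^ j / y ^ Suc j * x ^ j)
     = (- x) ^ J / (y ^ J * (x + y)) - (- x) ^ J / y ^ Suc J"
    using Suc by (simp add: algebra_simps power_minus[of x])
  also have "\<dots> = (- x) ^ Suc J / (y ^ Suc J * (x + y))"
    using assms by (simp add: divide_simps) (simp add: algebra_simps)
  finally show ?case .
qed simp

text \<open>The j-th Taylor coefficient of \<open>root_mean X n\<close> at
  \<open>lam\<close>.\<close>

definition root_mean_coeff :: "complex \<Rightarrow> complex set \<Rightarrow> nat \<Rightarrow> nat \<Rightarrow> complex" where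
  "root_mean_coeff lam X n j =
     (\<Sum>\<Lambda>\<in>{\<Lambda>. \<Lambda> ^ n = 1} \<inter> X. \<Lambda> * ((- 1) ^ j / (lam - \<Lambda>) ^ Suc j)) / of_nat n"

lemma norm_sum_roots_le:
  assumes "n \<ge> 1" "\<And>\<Lambda>. \<Lambda> ^ n = 1 \<Longrightarrow> \<Lambda> \<in> X \<Longrightarrow> norm (\<Lambda> * g \<Lambda>) \<le> C" "C \<ge> 0"
  shows "norm ((\<Sum>\<Lambda>\<in>{\<Lambda>::complex. \<Lambda> ^ n = 1} \<inter> X. \<Lambda> * g \<Lambda>) / of_nat n) \<le> C"
proof -
  have "norm (\<Sum>\<Lambda>\<in>{\<Lambda>::complex. \<Lambda> ^ n = 1} \<inter> X. \<Lambda> * g \<Lambda>) \<le> real (card ({\<Lambda>::complex. \<Lambda> ^ n = 1} \<inter> X)) * C"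
    by (rule sum_norm_bound) (use assms in auto)
  also have "\<dots> \<le> real n * C" using card_roots_Int_le[OF assms(1)] assms(3) by (intro mult_right_mono) auto
  finally show ?thesis using assms(1) by (simp add: norm_divide divide_simps mult.commute)
qed

context
  fixes lam :: complex and n :: nat and X :: "complex set" and D :: real
  assumes n: "n \<ge> 1" and D: "D > 0"
    and sep: "\<And>\<Lambda>. \<Lambda> ^ n = 1 \<Longrightarrow> norm (lam - \<Lambda>) \<ge> D"
begin

lemma root_mean_coeff_bound: "norm (root_mean_coeff lam X n j) \<le> (1 / D) ^ Suc j"
  unfolding root_mean_coeff_def
proof (rule norm_sum_roots_le[OF n])
  fix \<Lambda> :: complex assume L: "\<Lambda> ^ n = 1"
  have "1 / norm (lam - \<Lambda>) ^ Suc j \<le> 1 / D ^ Suc j"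
    using sep[OF L] D by (intro frac_le power_mono) auto
  thus "norm (\<Lambda> * ((- 1) ^ j / (lam - \<Lambda>) ^ Suc j)) \<le> (1 / D) ^ Suc j"
    using norm_root_unity[OF n L] by (simp add: norm_mult norm_divide norm_power power_one_over)
qed (use D in auto)

text \<open>Of the exponent J + 2, J comes from the powers of lam - \<Lambda> and 2 from the one
  factor q - \<Lambda>, bounded below by \<kappa> D^2. Averaging over at most n roots adds no
  further loss.\<close>

lemma root_mean_remainder:
  assumes \<kappa>: "\<kappa> > 0" and q: "\<And>\<Lambda>. \<Lambda> ^ n = 1 \<Longrightarrow> \<Lambda> \<in> X \<Longrightarrow> norm (q - \<Lambda>) \<ge> \<kappa> * norm (lam - \<Lambda>) ^ 2"
  shows "norm (root_mean X n q - (\<Sum>j<J. root_mean_coeff lam X n j * (q - lam) ^ j))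
     \<le> 1 / \<kappa> * (1 / D) ^ (J + 2) * norm (q - lam) ^ J"
proof -
  let ?R = "{\<Lambda>. \<Lambda> ^ n = 1} \<inter> X"
  let ?g = "\<lambda>\<Lambda>. 1 / (q - \<Lambda>) - (\<Sum>j<J. (- 1) ^ j / (lam - \<Lambda>) ^ Suc j * (q - lam) ^ j)"
  have "(\<Sum>j<J. root_mean_coeff lam X n j * (q - lam) ^ j)
      = (\<Sum>j<J. \<Sum>\<Lambda>\<in>?R. \<Lambda> * ((- 1) ^ j / (lam - \<Lambda>) ^ Suc j) * (q - lam) ^ j) / of_nat n"
    unfolding root_mean_coeff_def sum_divide_distrib sum_distrib_right
    by (intro sum.cong refl) simp
  also have "(\<Sum>j<J. \<Sum>\<Lambda>\<in>?R. \<Lambda> * ((- 1) ^ j / (lam - \<Lambda>) ^ Suc j) * (q - lam) ^ j)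
     = (\<Sum>\<Lambda>\<in>?R. \<Lambda> * (\<Sum>j<J. (- 1) ^ j / (lam - \<Lambda>) ^ Suc j * (q - lam) ^ j))"
    unfolding sum_distrib_left by (subst sum.swap) (simp add: mult.assoc)
  finally have "root_mean X n q - (\<Sum>j<J. root_mean_coeff lam X n j * (q - lam) ^ j)
     = (\<Sum>\<Lambda>\<in>?R. \<Lambda> * ?g \<Lambda>) / of_nat n"
    by (simp add: root_mean_def diff_divide_distrib right_diff_distrib sum_subtractf)
  also have "norm \<dots> \<le> 1 / \<kappa> * (1 / D) ^ (J + 2) * norm (q - lam) ^ J"
  proof (rule norm_sum_roots_le[OF n])
    fix \<Lambda> assume L: "\<Lambda> ^ n = 1" "\<Lambda> \<in> X"
    let ?y = "norm (lam - \<Lambda>)"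
    have y: "?y \<ge> D" "?y > 0" using sep[OF L(1)] D by auto
    hence pos: "\<kappa> * ?y ^ 2 > 0" using \<kappa> by auto
    with q[OF L] have q0: "norm (q - \<Lambda>) > 0" by linarith
    have "?g \<Lambda> = (- (q - lam)) ^ J / ((lam - \<Lambda>) ^ J * (q - \<Lambda>))"
      using cauchy_kernel_remainder[of "lam - \<Lambda>" "q - lam" J] y q0 by auto
    hence "norm (\<Lambda> * ?g \<Lambda>) = norm (q - lam) ^ J / (?y ^ J * norm (q - \<Lambda>))"
      using norm_root_unity[OF n L(1)] by (simp add: norm_mult norm_divide norm_power norm_minus_commute)
    also have "\<dots> \<le> norm (q - lam) ^ J / (D ^ J * (\<kappa> * D ^ 2))"
    proof (intro divide_left_mono mult_mono power_mono)
      show "\<kappa> * D\<^sup>2 \<le> norm (q - \<Lambda>)"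
        by (rule order_trans[OF mult_left_mono[OF power_mono[OF y(1)]] q[OF L]]) (use \<kappa> D in auto)
    qed (use y D \<kappa> q0 in auto)
    also have "\<dots> = 1 / \<kappa> * (1 / D) ^ (J + 2) * norm (q - lam) ^ J"
      by (simp add: power_one_over power_add power2_eq_square)
    finally show "norm (\<Lambda> * ?g \<Lambda>) \<le> 1 / \<kappa> * (1 / D) ^ (J + 2) * norm (q - lam) ^ J" .
  qed (use D \<kappa> in auto)
  finally show ?thesis .
qed

end

text \<open>A series in x^e truncated before x^N keeps N/e terms, rounded up. For e = 2 this passes
  from q - lam to its square root, the cardioid variable.\<close>

lemma sum_multiples:
  fixes g :: "nat \<Rightarrow> 'a :: comm_ring_1"
  assumes e: "e \<in> {1, 2::nat}"
  shows "(\<Sum>k<N. (if e dvd k then g (k div e) else 0) * x ^ k) = (\<Sum>j<(N + e - 1) div e. g j * (x ^ e) ^ j)"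
proof -
  have "(\<Sum>k<N. (if e dvd k then g (k div e) else 0) * x ^ k)
      = (\<Sum>k\<in>{k. k < N \<and> e dvd k}. g (k div e) * x ^ k)"
    by (rule sum.mono_neutral_cong_right) auto
  also have "\<dots> = (\<Sum>j<(N + e - 1) div e. g j * (x ^ e) ^ j)"
    by (rule sum.reindex_bij_witness[where i="\<lambda>j. e * j" and j="\<lambda>k. k div e"])
       (use e in \<open>auto simp: power_mult simp flip: power_mult\<close>)
  finally show ?thesis .
qed

text \<open>Handles tangent disks (e = 1) and cardioids (e = 2) together. A remainder of order N in
  \<open>t\<close> is one of order about N/e in q - lam, and each order costs a factor n^\<tau>;
  hence the Gevrey order \<tau>/e.\<close>

lemma gevrey_asymptotic_root_mean:
  fixes \<tau> \<gamma> \<kappa> r M \<theta> :: real and c :: "nat \<Rightarrow> complex" and e :: nat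
  assumes r: "r > 0" and \<theta>: "0 < \<theta>" "\<theta> < 1" and M: "M \<ge> 0"
    and c: "\<And>n. norm (c n) * r ^ Suc n \<le> M * \<theta> ^ n"
    and \<tau>: "\<tau> \<ge> 0" and \<gamma>: "0 < \<gamma>" "\<gamma> \<le> 1"
    and sep: "\<And>n \<Lambda>. n \<ge> 1 \<Longrightarrow> \<Lambda> ^ n = 1 \<Longrightarrow> norm (lam - \<Lambda>) \<ge> \<gamma> * real n powr (- \<tau>)"
    and e: "e \<in> {1, 2::nat}" and \<mu>: "norm \<mu> = 1"
    and \<Delta>: "open \<Delta>" "\<Delta> \<subseteq> ball t0 1" and \<kappa>: "0 < \<kappa>" "\<kappa> \<le> 1"
    and far: "\<And>t \<Lambda>. t \<in> \<Delta> \<Longrightarrow> norm \<Lambda> = 1 \<Longrightarrow> \<Lambda> \<in> X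
       \<Longrightarrow> norm (lam + \<mu> * (t - t0) ^ e - \<Lambda>) \<ge> \<kappa> * norm (lam - \<Lambda>) ^ 2"
  shows "\<exists>a. gevrey_asymptotic_on (\<tau> / real e) t0 r \<Delta>
     (\<lambda>t. mode_series c (\<lambda>n. root_mean X (Suc n) (lam + \<mu> * (t - t0) ^ e))) a"
proof -
  define D where "D n = \<gamma> * real (Suc n) powr (- \<tau>)" for n
  have D: "D n > 0" for n using \<gamma> by (auto simp: D_def)
  have sepD: "norm (lam - \<Lambda>) \<ge> D n" if "\<Lambda> ^ Suc n = 1" for n \<Lambda>
    using sep[of "Suc n" \<Lambda>] that by (simp add: D_def)
  have invD: "(1 / D n) ^ i = (1 / \<gamma>) ^ i * real (Suc n) powr (\<tau> * real i)" for n i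
    by (simp add: D_def powr_minus power_mult_distrib power_divide powr_realpow[symmetric] powr_powr
        field_simps del: of_nat_Suc)
  define p where "p n k = (if e dvd k then root_mean_coeff lam X (Suc n) (k div e) * \<mu> ^ (k div e) else 0)" for n k
  \<comment> \<open>Rounding J up adds less than 1 to N/e and the remainder has exponent J + 2, so 3
    \<tau> covers the excess over \<tau> N/e.\<close>
  define m where "m = nat \<lceil>3 * \<tau>\<rceil>"
  have m: "real m \<ge> 3 * \<tau>" by (simp add: m_def real_nat_ceiling_ge)
  define K where "K = (1 / \<gamma>) ^ 2 / \<kappa>"
  have e0: "e > 0" using e by auto
  \<comment> \<open>The two conditions on i serve different factors: i <= N + 2 bounds the power of
    1/\<gamma>, and i <= N/e + 3 the sharper power of n.\<close>
  have Dpow_le: "(1 / D n) ^ i \<le> (1 / \<gamma>) ^ 2 * (1 / \<gamma>) ^ N * real (Suc n) powr (\<tau> / real e * real N + real m)"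
    if i: "i \<le> N + 2" "real i \<le> real N / real e + 3" for i n N
  proof -
    have "(1 / \<gamma>) ^ i \<le> (1 / \<gamma>) ^ (N + 2)" using \<gamma> i by (intro power_increasing) auto
    moreover have "real (Suc n) powr (\<tau> * real i) \<le> real (Suc n) powr (\<tau> / real e * real N + real m)"
    proof (rule powr_mono)
      have "\<tau> * real i \<le> \<tau> * (real N / real e + 3)" using \<tau> i by (intro mult_left_mono) auto
      thus "\<tau> * real i \<le> \<tau> / real e * real N + real m" using m by (simp add: algebra_simps)
    qed auto
    ultimately have "(1 / \<gamma>) ^ i * real (Suc n) powr (\<tau> * real i)
       \<le> (1 / \<gamma>) ^ (N + 2) * real (Suc n) powr (\<tau> / real e * real N + real m)"
      using \<gamma> by (intro mult_mono) auto
    moreover have "(1 / \<gamma>) ^ (N + 2) = (1 / \<gamma>) ^ 2 * (1 / \<gamma>) ^ N" by (simp only: power_add mult.commute)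
    ultimately show ?thesis unfolding invD by (simp only:)
  qed
  have nz: "lam + \<mu> * (t - t0) ^ e \<noteq> \<Lambda>" if "t \<in> \<Delta>" "\<Lambda> ^ Suc n = 1" "\<Lambda> \<in> X" for t \<Lambda> n
  proof -
    have "norm (lam - \<Lambda>) > 0" using sepD[OF that(2)] D[of n] by linarith
    hence "0 < \<kappa> * norm (lam - \<Lambda>) ^ 2" using \<kappa> by auto
    moreover have "norm \<Lambda> = 1" using norm_root_unity[of "Suc n"] that by auto
    ultimately have "norm (lam + \<mu> * (t - t0) ^ e - \<Lambda>) > 0" using far[OF that(1) _ that(3)] by fastforce
    thus ?thesis by auto
  qed
  have "gevrey_asymptotic_on (\<tau> / real e) t0 r \<Delta>
     (\<lambda>t. mode_series c (\<lambda>n. root_mean X (Suc n) (lam + \<mu> * (t - t0) ^ e))) (\<lambda>k. mode_series c (\<lambda>n. p n k))"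
  proof (rule gevrey_asymptotic_mode_series[where A="1 / \<gamma>" and K=K and m=m and \<theta>=\<theta> and M=M])
    show "(\<lambda>t. root_mean X (Suc n) (lam + \<mu> * (t - t0) ^ e)) holomorphic_on \<Delta>" for n
      unfolding root_mean_def by (auto intro!: holomorphic_intros dest: nz)
    show "norm (p n k) \<le> K * (1 / \<gamma>) ^ k * real (Suc n) powr (\<tau> / real e * real k + real m)" for n k
    proof (cases "e dvd k")
      case True
      have "norm (p n k) \<le> (1 / D n) ^ Suc (k div e)"
        using root_mean_coeff_bound[of "Suc n" "D n" lam X "k div e"] sepD D True \<mu>
        by (simp add: p_def norm_mult norm_power)
      also have "\<dots> \<le> (1 / \<gamma>) ^ 2 * (1 / \<gamma>) ^ k * real (Suc n) powr (\<tau> / real e * real k + real m)"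
        by (rule Dpow_le) (use True e in auto)
      also have "\<dots> \<le> ((1 / \<gamma>) ^ 2 / \<kappa>) * (1 / \<gamma>) ^ k * real (Suc n) powr (\<tau> / real e * real k + real m)"
      proof (intro mult_right_mono)
        show "(1 / \<gamma>)\<^sup>2 \<le> (1 / \<gamma>)\<^sup>2 / \<kappa>" using \<kappa> \<gamma> by (simp add: field_simps)
      qed (use \<gamma> in auto)
      finally show ?thesis by (simp add: K_def)
    qed (use \<kappa> \<gamma> in \<open>auto simp: p_def K_def\<close>)
    show "norm (root_mean X (Suc n) (lam + \<mu> * (t - t0) ^ e) - (\<Sum>k<N. p n k * (t - t0) ^ k))
        \<le> K * (1 / \<gamma>) ^ N * real (Suc n) powr (\<tau> / real e * real N + real m) * norm (t - t0) ^ N"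
      if t: "t \<in> \<Delta>" for n N t
    proof -
      define J where "J = (N + e - 1) div e"
      define q where "q = lam + \<mu> * (t - t0) ^ e"
      have J: "J \<le> N" "N \<le> e * J" "real J \<le> real N / real e + 1" using e by (auto simp: J_def)
      have "(\<Sum>k<N. p n k * (t - t0) ^ k)
          = (\<Sum>j<J. (root_mean_coeff lam X (Suc n) j * \<mu> ^ j) * ((t - t0) ^ e) ^ j)"
        unfolding p_def J_def by (rule sum_multiples[OF e, of "\<lambda>j. root_mean_coeff lam X (Suc n) j * \<mu> ^ j"])
      also have "\<dots> = (\<Sum>j<J. root_mean_coeff lam X (Suc n) j * (q - lam) ^ j)"
        by (simp add: q_def power_mult_distrib mult.assoc)
      finally have eq: "(\<Sum>k<N. p n k * (t - t0) ^ k) = (\<Sum>j<J. root_mean_coeff lam X (Suc n) j * (q - lam) ^ j)" .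
      have "norm (root_mean X (Suc n) q - (\<Sum>j<J. root_mean_coeff lam X (Suc n) j * (q - lam) ^ j))
          \<le> 1 / \<kappa> * (1 / D n) ^ (J + 2) * norm (q - lam) ^ J"
        by (rule root_mean_remainder)
           (use D sepD \<kappa> far[OF t] norm_root_unity[of "Suc n"] in \<open>auto simp: q_def\<close>)
      also have "\<dots> \<le> 1 / \<kappa> * (1 / D n) ^ (J + 2) * norm (t - t0) ^ N"
      proof (rule mult_left_mono)
        have "norm (q - lam) ^ J = norm (t - t0) ^ (e * J)"
          using \<mu> by (simp add: q_def norm_mult norm_power power_mult)
        \<comment> \<open>Here the rounding up matters: N <= e J, and |t - t0| < 1, so the higher
          power is the smaller one.\<close>
        also have "\<dots> \<le> norm (t - t0) ^ N"
          using t \<Delta>(2) J by (intro power_decreasing) (auto simp: dist_norm norm_minus_commute)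
        finally show "norm (q - lam) ^ J \<le> norm (t - t0) ^ N" .
      qed (use \<kappa> D[of n] in auto)
      also have "\<dots> \<le> 1 / \<kappa> * ((1 / \<gamma>) ^ 2 * (1 / \<gamma>) ^ N * real (Suc n) powr (\<tau> / real e * real N + real m)) * norm (t - t0) ^ N"
        using \<kappa> J by (intro mult_right_mono mult_left_mono Dpow_le) auto
      finally show ?thesis unfolding eq q_def[symmetric] by (simp add: K_def)
    qed
  qed (use r \<theta> M c \<Delta> \<tau> \<gamma> \<kappa> in \<open>auto simp: K_def\<close>)
  thus ?thesis by blast
qed

section \<open>Distance from tangent disks and cardioids to the poles\<close>

lemma tangent_disk_distance:
  fixes \<rho> :: real and lam \<Lambda> q :: complex
  assumes lam: "norm lam = 1" and \<Lambda>: "norm \<Lambda> = 1" and \<rho>: "\<bar>\<rho>\<bar> \<le> 1 / 2"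
    and q: "q \<in> ball (of_real (1 + \<rho>) * lam) \<bar>\<rho>\<bar>"
  shows "norm (q - \<Lambda>) \<ge> 1 / 6 * norm (lam - \<Lambda>) ^ 2"
proof -
  let ?c = "of_real (1 + \<rho>) * lam" and ?d = "norm (lam - \<Lambda>)"
  \<comment> \<open>Law of cosines for the centre ?c, with signed \<rho> so that inner and outer
    disks are treated alike. It factors as a difference of squares; the factor 1/6 arises from 1 +
    \<rho> >= 1/2 and from the second factor being at most 3.\<close>
  have "norm (?c - \<Lambda>) ^ 2 = \<rho>\<^sup>2 + (1 + \<rho>) * ?d ^ 2"
  proof -
    have 1: "(Re lam)\<^sup>2 + (Im lam)\<^sup>2 = 1" "(Re \<Lambda>)\<^sup>2 + (Im \<Lambda>)\<^sup>2 = 1"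
      using lam \<Lambda> by (metis cmod_power2 one_power2)+
    have "((1 + \<rho>) * Re lam - Re \<Lambda>)\<^sup>2 + ((1 + \<rho>) * Im lam - Im \<Lambda>)\<^sup>2
      = \<rho>\<^sup>2 * ((Re lam)\<^sup>2 + (Im lam)\<^sup>2) + \<rho> * ((Re lam)\<^sup>2 + (Im lam)\<^sup>2 - ((Re \<Lambda>)\<^sup>2 + (Im \<Lambda>)\<^sup>2))
        + (1 + \<rho>) * ((Re lam - Re \<Lambda>)\<^sup>2 + (Im lam - Im \<Lambda>)\<^sup>2)"
      by (simp add: power2_eq_square algebra_simps)
    thus ?thesis using 1 by (simp add: cmod_power2)
  qed
  hence prod: "(norm (?c - \<Lambda>) - \<bar>\<rho>\<bar>) * (norm (?c - \<Lambda>) + \<bar>\<rho>\<bar>) = (1 + \<rho>) * ?d ^ 2"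
    by (simp add: algebra_simps power2_eq_square)
  have "norm ?c = 1 + \<rho>" using lam \<rho> by (simp add: norm_mult del: of_real_add)
  hence "norm (?c - \<Lambda>) \<le> 2 + \<rho>" using norm_triangle_ineq4[of ?c \<Lambda>] \<Lambda> by linarith
  hence S: "norm (?c - \<Lambda>) + \<bar>\<rho>\<bar> \<le> 3" using \<rho> by linarith
  have "1 / 2 * ?d ^ 2 \<le> (1 + \<rho>) * ?d ^ 2" using \<rho> by (intro mult_right_mono) (auto simp: abs_le_iff)
  also have "\<dots> \<le> (norm (?c - \<Lambda>) - \<bar>\<rho>\<bar>) * 3"
  proof (cases "norm (?c - \<Lambda>) - \<bar>\<rho>\<bar> \<ge> 0")
    \<comment> \<open>A negative first factor would force lam = \<Lambda> by the product identity,
      but then that factor is 0.\<close>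
    case False
    hence "(norm (?c - \<Lambda>) - \<bar>\<rho>\<bar>) * (norm (?c - \<Lambda>) + \<bar>\<rho>\<bar>) \<le> 0" by (intro mult_nonpos_nonneg) auto
    moreover have "(1 + \<rho>) * ?d ^ 2 \<ge> 0" using \<rho> by auto
    ultimately have "(1 + \<rho>) * ?d ^ 2 = 0" using prod by linarith
    hence "?d = 0" using \<rho> by (auto simp: abs_le_iff)
    hence "lam = \<Lambda>" by simp
    hence "?c - \<Lambda> = of_real \<rho> * lam" by (simp add: algebra_simps)
    hence "norm (?c - \<Lambda>) = \<bar>\<rho>\<bar>" using lam by (simp add: norm_mult)
    thus ?thesis using False by simp
  qed (subst prod[symmetric], intro mult_left_mono S)
  finally have "1 / 6 * ?d ^ 2 \<le> norm (?c - \<Lambda>) - \<bar>\<rho>\<bar>" by simp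
  also have "norm (?c - \<Lambda>) - \<bar>\<rho>\<bar> \<le> norm (q - \<Lambda>)"
    using q norm_triangle_ineq[of "?c - q" "q - \<Lambda>"] by (simp add: dist_norm)
  finally show ?thesis .
qed

text \<open>Three regimes, with q = 1 + i v^2 and d = |1 - \<Lambda>|. If |v|^2 <= d/2, the triangle
  inequality suffices. Otherwise, if |Im v| <= |Re v|, then Im q >= 0 while \<open>\<Lambda>\<close>
  lies at least d/2 below the real axis. If |Im v| > |Re v|, real parts separate: |Re (q - 1)| is at
  least 2 |v|^3 because \<open>v\<close> is in the tangent disk, whereas Re (1 - \<Lambda>) = d^2/2
  is only of order |v|^4.\<close>

lemma cardioid_distance_from_one:
  assumes \<Lambda>: "norm \<Lambda> = 1" "Im \<Lambda> < 0" and v: "v \<in> ball (of_real (1/4)) (1/4)"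
  shows "norm (1 + \<i> * v ^ 2 - \<Lambda>) \<ge> 1 / 4 * norm (1 - \<Lambda>) ^ 2"
proof -
  define d where "d = norm (1 - \<Lambda>)"
  define x y where "x = Re v" and "y = Im v"
  define w where "w = x\<^sup>2 + y\<^sup>2"
  define n where "n = norm v"
  have nw: "n\<^sup>2 = w" by (simp add: n_def w_def x_def y_def cmod_power2)
  have n0: "n \<ge> 0" by (simp add: n_def)
  have "(x - 1/4)\<^sup>2 + y\<^sup>2 < (1/4)\<^sup>2"
  proof -
    have "norm (v - of_real (1/4)) < 1/4" using v by (simp add: dist_norm norm_minus_commute)
    hence "norm (v - of_real (1/4)) ^ 2 < (1/4)^2" by (intro power_strict_mono) auto
    thus ?thesis by (simp add: cmod_power2 x_def y_def)
  qed
  \<comment> \<open>This is the disk in the form Re (1/v) > 2; its quantitative use is to keep Re v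
    away from 0.\<close>
  hence wx: "2 * w < x" by (simp add: w_def power2_eq_square algebra_simps)
  have xn: "x \<le> n" unfolding x_def n_def by (rule complex_Re_le_cmod)
  have n_half: "n < 1/2"
  proof -
    have "2 * n * n < 1 * n" using wx xn nw by (simp add: power2_eq_square)
    thus ?thesis using n0 by (metis mult_less_cancel_right_disj not_less less_divide_eq_numeral1(1) mult.commute)
  qed
  define a b where "a = Re \<Lambda>" and "b = - Im \<Lambda>"
  have ab: "a\<^sup>2 + b\<^sup>2 = 1" "b > 0" using \<Lambda> cmod_power2[of \<Lambda>] by (auto simp: a_def b_def)
  have "d\<^sup>2 = (1 - a)\<^sup>2 + b\<^sup>2" by (simp add: d_def cmod_power2 a_def b_def)
  hence d2: "d\<^sup>2 = 2 - 2 * a" using ab by (simp add: power2_diff)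
  have d0: "d \<ge> 0" "d \<le> 2" using norm_triangle_ineq4[of 1 \<Lambda>] \<Lambda> by (auto simp: d_def)
  have Re: "Re (1 + \<i> * v ^ 2 - \<Lambda>) = d\<^sup>2 / 2 - 2 * x * y"
    using d2 by (simp add: power2_eq_square x_def y_def a_def)
  have Im: "Im (1 + \<i> * v ^ 2 - \<Lambda>) = x\<^sup>2 - y\<^sup>2 + b"
    by (simp add: power2_eq_square x_def y_def b_def)
  show ?thesis
  proof (cases "w \<le> d / 2")
    case True
    have "norm (1 - \<Lambda>) \<le> norm (1 + \<i> * v ^ 2 - \<Lambda>) + norm (\<i> * v ^ 2)"
      using norm_triangle_ineq4[of "1 + \<i> * v ^ 2 - \<Lambda>" "\<i> * v ^ 2"] by (simp add: algebra_simps)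
    moreover have "norm (\<i> * v ^ 2) = w" using nw by (simp add: norm_mult norm_power n_def)
    ultimately have "norm (1 + \<i> * v ^ 2 - \<Lambda>) \<ge> d / 2" using True by (simp add: d_def)
    moreover have "d * d \<le> 2 * d" using d0 by (intro mult_right_mono) auto
    ultimately show ?thesis unfolding d_def[symmetric] power2_eq_square by linarith
  next
    case False
    hence dw: "d < 2 * w" by simp
    have "w < 1 / 4" using n_half n0 nw power_strict_mono[of n "1/2" 2] by (simp add: power2_eq_square)
    hence dh: "d < 1 / 2" using dw by simp
    \<comment> \<open>Close to 1 the chord from 1 to \<open>\<Lambda>\<close> is nearly
      vertical.\<close>
    have "b \<ge> d / 2"
    proof (rule power2_le_imp_le)
      have "b\<^sup>2 = d\<^sup>2 * (1 - d\<^sup>2 / 4)"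
      proof -
        have "a = 1 - d\<^sup>2 / 2" using d2 by linarith
        hence "b\<^sup>2 = 1 - (1 - d\<^sup>2 / 2)\<^sup>2" using ab by simp
        thus ?thesis by (simp add: power2_eq_square algebra_simps)
      qed
      moreover have "d\<^sup>2 \<le> 1" using dh d0 by (simp add: abs_square_le_1)
      hence "d\<^sup>2 * (1/4) \<le> d\<^sup>2 * (1 - d\<^sup>2 / 4)" by (intro mult_left_mono) auto
      ultimately show "(d / 2)\<^sup>2 \<le> b\<^sup>2" by (simp add: power_divide)
    qed (use ab in auto)
    show ?thesis
    proof (cases "y\<^sup>2 \<le> x\<^sup>2")
      case True
      have "norm (1 + \<i> * v ^ 2 - \<Lambda>) \<ge> d / 2"
        using abs_Im_le_cmod[of "1 + \<i> * v ^ 2 - \<Lambda>"] True \<open>b \<ge> d / 2\<close> unfolding Im by linarith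
      moreover have "d * d \<le> 2 * d" using d0 by (intro mult_right_mono) auto
      ultimately show ?thesis unfolding d_def[symmetric] power2_eq_square by linarith
    next
      \<comment> \<open>The cubic lower bound \<open>2 * n * w\<close> for 2 x |y| beats d^2 < 4
        w^2, since w = n^2 and n < 1/2 give 4 w^2 <= 2 n w.\<close>
      case F2: False
      have "n\<^sup>2 \<le> 4 * y\<^sup>2" using F2 nw zero_le_power2[of y] unfolding w_def by linarith
      hence "n\<^sup>2 \<le> (2 * \<bar>y\<bar>)\<^sup>2" by (simp add: power_mult_distrib)
      hence ny: "n \<le> 2 * \<bar>y\<bar>" by (rule power2_le_imp_le) auto
      have x0: "x > 0" using wx nw by (smt (verit) zero_le_power2)
      have "n * (2 * w) \<le> (2 * \<bar>y\<bar>) * x"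
        using ny wx n0 nw by (intro mult_mono) (auto simp: w_def)
      hence big: "2 * n * w \<le> 2 * x * \<bar>y\<bar>" by (simp add: mult_ac)
      have "d * d \<le> (2 * w) * (2 * w)" using dw d0 by (intro mult_mono) auto
      hence d4: "d\<^sup>2 \<le> 4 * w * w" by (simp add: power2_eq_square)
      have "w = n * n" using nw by (simp add: power2_eq_square)
      have "n * w \<ge> 0" using n0 \<open>w = n * n\<close> by auto
      have "w * w = (n * w) * n" using \<open>w = n * n\<close> by simp
      also have "\<dots> \<le> (n * w) * (1 / 2)" using n_half \<open>n * w \<ge> 0\<close> by (intro mult_left_mono) auto
      finally have "4 * w * w \<le> 2 * (n * w)" by simp
      hence "d\<^sup>2 \<le> 2 * x * \<bar>y\<bar>" using d4 big by linarith
      moreover have "\<bar>Re (1 + \<i> * v ^ 2 - \<Lambda>)\<bar> \<ge> 2 * x * \<bar>y\<bar> - d\<^sup>2 / 2"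
      proof -
        have "\<bar>2 * x * y\<bar> = 2 * x * \<bar>y\<bar>" using x0 by (simp add: abs_mult)
        moreover have "\<bar>d\<^sup>2 / 2\<bar> = d\<^sup>2 / 2" by simp
        ultimately show ?thesis unfolding Re by linarith
      qed
      ultimately have "\<bar>Re (1 + \<i> * v ^ 2 - \<Lambda>)\<bar> \<ge> d\<^sup>2 / 2" by linarith
      hence "norm (1 + \<i> * v ^ 2 - \<Lambda>) \<ge> d\<^sup>2 / 2" using abs_Re_le_cmod order_trans by blast
      moreover have "d\<^sup>2 \<ge> 0" by simp
      ultimately show ?thesis unfolding d_def[symmetric] by linarith
    qed
  qed
qed

text \<open>Division by \<open>lam\<close> moves the cusp to 1. Complex conjugation reduces the
  upper side to the lower one, as it changes the sign of \<i> and exchanges the half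
  circles.\<close>

lemma cardioid_distance:
  assumes lam: "norm lam = 1" and \<Lambda>: "\<Lambda> \<in> half_circle s lam" and t: "t \<in> ball (1 + of_real (1/4)) (1/4)"
  shows "norm (lam + lam * side_sign s * \<i> * (t - 1) ^ 2 - \<Lambda>) \<ge> 1 / 4 * norm (lam - \<Lambda>) ^ 2"
proof -
  have lam0: "lam \<noteq> 0" using lam by auto
  let ?v = "t - 1"
  have v: "?v \<in> ball (of_real (1/4)) (1/4)" using t by (simp add: dist_norm algebra_simps)
  have L: "norm \<Lambda> = 1" using \<Lambda> half_circle_eq[OF lam] by (cases s) (auto simp del: half_circle.simps)
  have *: "norm (1 + side_sign s * \<i> * ?v ^ 2 - \<Lambda> / lam) \<ge> 1 / 4 * norm (1 - \<Lambda> / lam) ^ 2"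
  proof (cases s)
    case Lower
    have "Im (\<Lambda> / lam) < 0" using \<Lambda> Lower half_circle_eq[OF lam] by (auto simp del: half_circle.simps)
    thus ?thesis using cardioid_distance_from_one[of "\<Lambda> / lam" ?v] v L lam Lower by (simp add: norm_divide)
  next
    case Upper
    let ?w = "1 + \<i> * (cnj ?v) ^ 2 - cnj (\<Lambda> / lam)"
    have "Im (\<Lambda> / lam) > 0" using \<Lambda> Upper half_circle_eq[OF lam] by (auto simp del: half_circle.simps)
    hence "Im (cnj (\<Lambda> / lam)) < 0" by (simp only: cnj.sel neg_less_0_iff_less)
    moreover have "cnj ?v \<in> ball (of_real (1/4)) (1/4)"
    proof -
      have "norm (of_real (1/4) - cnj ?v) = norm (cnj (of_real (1/4) - ?v))" by simp
      also have "\<dots> = norm (of_real (1/4) - ?v)" by (rule complex_mod_cnj)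
      finally show ?thesis using v by (simp add: dist_norm)
    qed
    moreover have "norm (cnj (\<Lambda> / lam)) = 1" using L lam by (simp add: norm_divide)
    ultimately have "norm ?w \<ge> 1 / 4 * norm (1 - cnj (\<Lambda> / lam)) ^ 2" by (intro cardioid_distance_from_one)
    moreover have "norm ?w = norm (1 + side_sign s * \<i> * ?v ^ 2 - \<Lambda> / lam)"
    proof -
      have "cnj ?w = 1 + side_sign s * \<i> * ?v ^ 2 - \<Lambda> / lam" using Upper by simp
      thus ?thesis by (metis complex_mod_cnj)
    qed
    moreover have "norm (1 - cnj (\<Lambda> / lam)) = norm (1 - \<Lambda> / lam)"
      by (metis complex_cnj_diff complex_cnj_one complex_mod_cnj)
    ultimately show ?thesis by simp
  qed
  have "lam + lam * side_sign s * \<i> * ?v ^ 2 - \<Lambda> = lam * (1 + side_sign s * \<i> * ?v ^ 2 - \<Lambda> / lam)"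
    using lam0 by (simp add: field_simps)
  moreover have "lam - \<Lambda> = lam * (1 - \<Lambda> / lam)" using lam0 by (simp add: field_simps)
  ultimately show ?thesis using * lam by (simp only: norm_mult mult_1)
qed

section \<open>The solutions belong to the quasianalytic space\<close>

lemma norm_cis_minus_one_ge:
  assumes "\<bar>x\<bar> \<le> pi"
  shows "norm (cis x - 1) \<ge> \<bar>x\<bar> / 3"
proof -
  \<comment> \<open>The norm is 2 |sin t| with t at most pi/2 < 2; there t^3/6 <= 2t/3, so sin t >=
    t/3.\<close>
  define t where "t = \<bar>x\<bar> / 2"
  have t: "0 \<le> t" "t \<le> 2" using assms pi_less_4 by (auto simp: t_def)
  have "\<bar>sin t - (\<Sum>m<3. sin_coeff m * t ^ m)\<bar> \<le> inverse (fact 3) * \<bar>t\<bar> ^ 3"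
    by (rule Maclaurin_sin_bound)
  hence "\<bar>sin t - t\<bar> \<le> t ^ 3 / 6" using t
    by (simp add: numeral_3_eq_3 sin_coeff_def fact_numeral)
  hence "sin t \<ge> t - t ^ 3 / 6" by linarith
  moreover have "t ^ 3 \<le> 4 * t"
  proof -
    have "t ^ 3 = t * t ^ 2" by (simp add: power3_eq_cube power2_eq_square)
    also have "\<dots> \<le> t * 2 ^ 2" using t by (intro mult_left_mono power_mono) auto
    finally show ?thesis by simp
  qed
  ultimately have "sin t \<ge> t / 3" by simp
  moreover have "norm (cis x - 1) = 2 * \<bar>sin t\<bar>"
  proof (rule power2_eq_imp_eq)
    have "(norm (cis x - 1))\<^sup>2 = (cos (2 * t) - 1)\<^sup>2 + (sin (2 * t))\<^sup>2"
      by (cases "x \<ge> 0") (auto simp: cmod_power2 t_def)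
    also have "\<dots> = 2 - 2 * cos (2 * t)" using sin_cos_squared_add[of "2 * t"] by (simp add: power2_diff)
    also have "\<dots> = (2 * \<bar>sin t\<bar>)\<^sup>2" by (simp add: cos_double_sin power_mult_distrib)
    finally show "(norm (cis x - 1))\<^sup>2 = (2 * \<bar>sin t\<bar>)\<^sup>2" .
  qed auto
  ultimately show ?thesis by (simp add: t_def)
qed

text \<open>The angle between \<open>lam\<close> and an n-th root of unity is 2 pi times the
  distance from y to some k/n. Chord and angle are comparable up to the factor 3, which is smaller
  than 2 pi.\<close>

lemma diophantine_points_separation:
  assumes "lam \<in> diophantine_points \<tau>"
  shows "norm lam = 1"
    and "\<exists>\<gamma>>0. \<gamma> \<le> 1 \<and> (\<forall>n \<Lambda>. n \<ge> 1 \<longrightarrow> \<Lambda> ^ n = 1 \<longrightarrow> norm (lam - \<Lambda>) \<ge> \<gamma> * real n powr (- \<tau>))"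
proof -
  obtain y \<gamma> where lam: "lam = cis (2 * pi * y)" and \<gamma>: "\<gamma> > 0"
    and dio: "\<And>k::int. \<And>m::nat. m \<ge> 1 \<Longrightarrow> \<bar>y - real_of_int k / real m\<bar> \<ge> \<gamma> * real m powr (- \<tau>)"
    using assms unfolding diophantine_points_def by blast
  show n1: "norm lam = 1" by (simp add: lam)
  have "norm (lam - \<Lambda>) \<ge> \<gamma> * real n powr (- \<tau>)" if n: "n \<ge> 1" and L: "\<Lambda> ^ n = 1" for n \<Lambda>
  proof -
    \<comment> \<open>The principal value ensures |\<psi>| <= pi for the chord estimate; the integer
      k found below is the one that goes with this branch.\<close>
    define \<psi> where "\<psi> = Arg (\<Lambda> / lam)"
    have nL: "norm \<Lambda> = 1" by (rule norm_root_unity[OF n L])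
    have "\<Lambda> / lam \<noteq> 0" using nL n1 by auto
    hence "cis \<psi> = \<Lambda> / lam" using cis_Arg[of "\<Lambda> / lam"] nL n1
      by (simp add: \<psi>_def sgn_div_norm norm_divide)
    hence L': "\<Lambda> = cis (2 * pi * y + \<psi>)" using n1 unfolding lam cis_mult[symmetric]
      by (auto simp: field_simps)
    hence "cis (real n * (2 * pi * y + \<psi>)) = 1" using L by (simp add: Complex.DeMoivre)
    hence "cos (real n * (2 * pi * y + \<psi>)) = 1" by (metis cis.sel(1) one_complex.sel(1))
    then obtain k :: int where k: "real n * (2 * pi * y + \<psi>) = of_int k * 2 * pi"
      using cos_one_2pi_int by blast
    have "\<psi> = - (2 * pi * (y - of_int k / real n))" using n k by (simp add: field_simps)
    hence "\<bar>\<psi>\<bar> = 2 * pi * \<bar>y - of_int k / real n\<bar>" by (simp add: abs_mult)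
    hence "\<bar>\<psi>\<bar> \<ge> 2 * pi * (\<gamma> * real n powr (- \<tau>))" using dio[OF n, of k] by simp
    moreover have "3 * (\<gamma> * real n powr (- \<tau>)) \<le> 2 * pi * (\<gamma> * real n powr (- \<tau>))"
      using \<gamma> pi_ge_two by (intro mult_right_mono) auto
    moreover have "norm (lam - \<Lambda>) = norm (cis \<psi> - 1)"
    proof -
      have "\<Lambda> - lam = lam * (cis \<psi> - 1)" using \<open>cis \<psi> = \<Lambda> / lam\<close> n1 by (auto simp: field_simps)
      thus ?thesis using n1 by (metis norm_minus_commute norm_mult mult_1)
    qed
    moreover have "\<bar>\<psi>\<bar> \<le> pi" unfolding \<psi>_def using Arg_bounded[of "\<Lambda> / lam"] by auto
    hence "norm (cis \<psi> - 1) \<ge> \<bar>\<psi>\<bar> / 3" by (rule norm_cis_minus_one_ge)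
    ultimately show ?thesis by linarith
  qed
  \<comment> \<open>Capping \<gamma> at 1 makes the powers of 1/\<gamma> increasing in the
    exponent.\<close>
  hence "norm (lam - \<Lambda>) \<ge> min \<gamma> 1 * real n powr (- \<tau>)" if "n \<ge> 1" "\<Lambda> ^ n = 1" for n \<Lambda>
    using that by (smt (verit) mult_right_mono powr_ge_zero)
  thus "\<exists>\<gamma>>0. \<gamma> \<le> 1 \<and> (\<forall>n \<Lambda>. n \<ge> 1 \<longrightarrow> \<Lambda> ^ n = 1 \<longrightarrow> norm (lam - \<Lambda>) \<ge> \<gamma> * real n powr (- \<tau>))"
    using \<gamma> by (intro exI[of _ "min \<gamma> 1"]) auto
qed

lemma diophantine_points_not_root:
  assumes "lam \<in> diophantine_points \<tau>" "n \<ge> 1"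
  shows "lam ^ n \<noteq> 1"
proof
  assume "lam ^ n = 1"
  moreover obtain \<gamma> where "\<gamma> > 0" "\<And>n \<Lambda>. n \<ge> 1 \<Longrightarrow> \<Lambda> ^ n = 1 \<Longrightarrow> norm (lam - \<Lambda>) \<ge> \<gamma> * real n powr (- \<tau>)"
    using diophantine_points_separation(2)[OF assms(1)] by blast
  ultimately have "\<gamma> * real n powr (- \<tau>) \<le> norm (lam - lam)" using assms(2) by blast
  thus False using \<open>\<gamma> > 0\<close> assms(2) by (simp add: mult_le_0_iff)
qed

lemma B_holomorphic_on_cong:
  assumes "\<And>q. q \<in> \<Delta> \<Longrightarrow> f q = g q"
  shows "B_holomorphic_on r f \<Delta> \<longleftrightarrow> B_holomorphic_on r g \<Delta>"
proof -
  have "((\<lambda>w. B_norm r (\<lambda>z. (f w z - f q z) / (w - q) - D z)) \<longlongrightarrow> 0) (at q within \<Delta>) \<longleftrightarrow>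
        ((\<lambda>w. B_norm r (\<lambda>z. (g w z - g q z) / (w - q) - D z)) \<longlongrightarrow> 0) (at q within \<Delta>)"
    if "q \<in> \<Delta>" for q D
    by (rule tendsto_cong) (use assms that in \<open>auto simp: eventually_at_filter\<close>)
  thus ?thesis unfolding B_holomorphic_on_def using assms by simp
qed

lemma gevrey_asymptotic_on_cong:
  assumes "\<And>q. q \<in> \<Delta> \<Longrightarrow> f q = g q"
  shows "gevrey_asymptotic_on \<sigma> lam r \<Delta> f a \<longleftrightarrow> gevrey_asymptotic_on \<sigma> lam r \<Delta> g a"
  unfolding gevrey_asymptotic_on_def using B_holomorphic_on_cong[OF assms] assms by simp

lemma gevrey_asymptotic_on_subset:
  "gevrey_asymptotic_on \<sigma> lam r \<Delta> f a \<Longrightarrow> \<Delta>' \<subseteq> \<Delta> \<Longrightarrow> gevrey_asymptotic_on \<sigma> lam r \<Delta>' f a"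
  unfolding gevrey_asymptotic_on_def by (meson B_holomorphic_on_subset subsetD)

lemma inner_disk_norm_less:
  fixes lam q :: complex
  assumes "q \<in> ball (of_real (1 - \<rho>) * lam) \<rho>" "norm lam = 1" "\<rho> < 1"
  shows "norm q < 1"
proof -
  have "norm (of_real (1 - \<rho>) * lam) = 1 - \<rho>" using assms by (simp add: norm_mult del: of_real_diff)
  thus ?thesis using norm_triangle_ineq2[of q "of_real (1 - \<rho>) * lam"] assms(1)
    by (simp add: dist_norm norm_minus_commute)
qed

lemma outer_disk_norm_greater:
  fixes lam q :: complex
  assumes "q \<in> ball (of_real (1 + \<rho>) * lam) \<rho>" "norm lam = 1" "\<rho> > 0"
  shows "norm q > 1"
proof -
  have "norm (of_real (1 + \<rho>) * lam) = 1 + \<rho>" using assms by (simp add: norm_mult del: of_real_add)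
  thus ?thesis using norm_triangle_ineq2[of "of_real (1 + \<rho>) * lam" q] assms(1)
    by (simp add: dist_norm)
qed

lemma power_neq_one: "norm q \<noteq> 1 \<Longrightarrow> n \<ge> 1 \<Longrightarrow> (q::complex) ^ n \<noteq> 1"
  using norm_root_unity by blast

text \<open>Coefficientwise, the factor q^n - 1 in \<open>delta_poly\<close> cancels the small
  divisor and leaves the partial fractions of one half circle. The result makes sense wherever
  \<open>q\<close> avoids those poles, which is what permits crossing the circle.\<close>

lemma hadamard_delta_fun:
  assumes f: "f = mode_series c (\<lambda>n. root_mean UNIV (Suc n) q)" and q: "norm q \<noteq> 1"
    and r: "r > 0"
    and summ: "\<And>X z. z \<in> ball 0 r \<Longrightarrow> summable (\<lambda>n. c n * root_mean X (Suc n) q * z ^ Suc n)"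
    and z: "z \<in> ball 0 r"
  shows "(f \<odot> delta_fun s lam q) z = mode_series c (\<lambda>n. root_mean (half_circle s lam) (Suc n) q) z"
proof -
  have qn: "q ^ Suc n \<noteq> 1" for n using power_neq_one[OF q, of "Suc n"] by simp
  \<comment> \<open>Index shift: \<open>mode_series\<close> begins at z^1, so the coefficient at 0
    is 0.\<close>
  define a where "a n = (case n of 0 \<Rightarrow> 0 | Suc m \<Rightarrow> c m * root_mean UNIV (Suc m) q)" for n
  have a: "a 0 = 0" "a (Suc n) = c n * root_mean UNIV (Suc n) q" for n by (auto simp: a_def)
  have ta: "taylor_coeff f n = a n" for n
  proof (rule taylor_coeff_eqI[OF r])
    fix z :: complex assume "z \<in> ball 0 r"
    hence "(\<lambda>n. a (Suc n) * z ^ Suc n) sums f z"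
      using summ[of z UNIV] by (simp add: f mode_series_def a(2) summable_sums)
    thus "(\<lambda>n. a n * z ^ n) sums f z" using sums_Suc_iff[of "\<lambda>n. a n * z ^ n" "f z"] a(1) by simp
  qed
  have coeff_eq: "taylor_coeff f (Suc n) * taylor_coeff (delta_fun s lam q) (Suc n) * z ^ Suc n
      = c n * root_mean (half_circle s lam) (Suc n) q * z ^ Suc n" for n
  proof -
    have "root_mean UNIV (Suc n) q * delta_poly s lam (Suc n) q = root_mean (half_circle s lam) (Suc n) q"
    proof -
      have "root_mean UNIV (Suc n) q * delta_poly s lam (Suc n) q
          = 1 / (q ^ Suc n - 1) * ((q ^ Suc n - 1) * root_mean (half_circle s lam) (Suc n) q)"
        using inverse_power_minus_one_eq[of "Suc n" q] delta_poly_eq[of "Suc n" q s lam] qn[of n]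
        by (simp del: power_Suc half_circle.simps)
      thus ?thesis using qn[of n] by (simp del: power_Suc half_circle.simps)
    qed
    thus ?thesis by (simp add: ta a(2) taylor_coeff_delta_fun mult_ac del: power_Suc half_circle.simps)
  qed
  have "(\<lambda>n. taylor_coeff f (Suc n) * taylor_coeff (delta_fun s lam q) (Suc n) * z ^ Suc n)
      sums mode_series c (\<lambda>n. root_mean (half_circle s lam) (Suc n) q) z"
    unfolding coeff_eq mode_series_def by (rule summable_sums[OF summ[OF z]])
  hence "(\<lambda>n. taylor_coeff f n * taylor_coeff (delta_fun s lam q) n * z ^ n)
      sums mode_series c (\<lambda>n. root_mean (half_circle s lam) (Suc n) q) z"
    using sums_Suc_iff[of "\<lambda>n. taylor_coeff f n * taylor_coeff (delta_fun s lam q) n * z ^ n"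
       "mode_series c (\<lambda>n. root_mean (half_circle s lam) (Suc n) q) z"] by (simp add: ta[of 0] a(1))
  thus ?thesis unfolding hadamard_def by (rule sums_unique[symmetric])
qed

text \<open>Common source of both membership claims, for which only the decay of \<open>c\<close>
  matters. The formula for \<open>f\<close> is required off the unit circle, where no denominator
  vanishes.\<close>

lemma mode_series_gevrey_odot:
  fixes \<tau> r M \<theta> :: real and c :: "nat \<Rightarrow> complex"
  assumes \<tau>: "\<tau> \<ge> 2" and lam: "lam \<in> diophantine_points \<tau>"
    and r: "r > 0" and \<theta>: "0 < \<theta>" "\<theta> < 1" and M: "M \<ge> 0"
    and c: "\<And>n. norm (c n) * r ^ Suc n \<le> M * \<theta> ^ n"
    and f: "\<And>q. norm q \<noteq> 1 \<Longrightarrow> f q = mode_series c (\<lambda>n. 1 / (q ^ Suc n - 1))"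
  shows "f \<in> gevrey_odot (\<tau> / 2) lam r"
proof -
  note n1 = diophantine_points_separation(1)[OF lam]
  obtain \<gamma> where \<gamma>: "0 < \<gamma>" "\<gamma> \<le> 1"
    and sep: "\<And>n \<Lambda>. n \<ge> 1 \<Longrightarrow> \<Lambda> ^ n = 1 \<Longrightarrow> norm (lam - \<Lambda>) \<ge> \<gamma> * real n powr (- \<tau>)"
    using diophantine_points_separation(2)[OF lam] by blast
  have \<tau>0: "\<tau> \<ge> 0" using \<tau> by simp
  define F where "F X q = mode_series c (\<lambda>n. root_mean X (Suc n) q)" for X q
  have fF: "f q = F UNIV q" if "norm q \<noteq> 1" for q
  proof -
    have "1 / (q ^ Suc n - 1) = root_mean UNIV (Suc n) q" for n
      by (rule inverse_power_minus_one_eq) (use power_neq_one[OF that, of "Suc n"] in auto)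
    thus ?thesis unfolding f[OF that] F_def by (simp del: power_Suc)
  qed
  define \<Delta> where "\<Delta> \<rho> = ball (of_real (1 + \<rho>) * lam) \<bar>\<rho>\<bar>" for \<rho> :: real
  have \<Delta>1: "\<Delta> \<rho> \<subseteq> ball lam 1" if "\<bar>\<rho>\<bar> \<le> 1 / 4" for \<rho>
  proof
    fix q assume "q \<in> \<Delta> \<rho>"
    moreover have "norm (lam - of_real (1 + \<rho>) * lam) = \<bar>\<rho>\<bar>"
      using n1 by (simp add: algebra_simps norm_mult)
    ultimately show "q \<in> ball lam 1"
      using norm_triangle_ineq[of "lam - of_real (1 + \<rho>) * lam" "of_real (1 + \<rho>) * lam - q"] that
      by (simp add: \<Delta>_def dist_norm)
  qed
  let ?Dm = "\<Delta> (- 1/4)" and ?Dp = "\<Delta> (1/4)"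
  \<comment> \<open>Working on the union of the two disks yields one series for both sides, as
    \<open>gevrey_expansion\<close> demands.\<close>
  have disks: "\<exists>a. gevrey_asymptotic_on \<tau> lam r (?Dm \<union> ?Dp) (F X) a" for X
  proof -
    have "\<exists>a. gevrey_asymptotic_on (\<tau> / real 1) lam r (?Dm \<union> ?Dp)
       (\<lambda>t. mode_series c (\<lambda>n. root_mean X (Suc n) (lam + 1 * (t - lam) ^ 1))) a"
    proof (rule gevrey_asymptotic_root_mean[OF r \<theta> M c \<tau>0 \<gamma> sep, where \<kappa>="1/6"])
      show "1 / 6 * norm (lam - \<Lambda>) ^ 2 \<le> norm (lam + 1 * (t - lam) ^ 1 - \<Lambda>)"
        if "t \<in> ?Dm \<union> ?Dp" "norm \<Lambda> = 1" for t \<Lambda>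
        using tangent_disk_distance[OF n1 that(2), of "-1/4" t] tangent_disk_distance[OF n1 that(2), of "1/4" t] that(1)
        unfolding \<Delta>_def by auto
    qed (use \<Delta>1[of "-1/4"] \<Delta>1[of "1/4"] in \<open>auto simp: \<Delta>_def\<close>)
    thus ?thesis by (simp add: F_def[abs_def])
  qed
  \<comment> \<open>The extension is the half-circle sum itself, given by the same formula on disks
    and cardioid.\<close>
  have card: "F (half_circle s lam) \<in> gevrey_cardioid s (\<tau> / 2) lam r" for s
  proof -
    let ?D = "ball (of_real (1 + 1/4) * 1) (1/4) :: complex set"
    have "\<exists>a. gevrey_asymptotic_on (\<tau> / real 2) 1 r ?D
       (\<lambda>t. mode_series c (\<lambda>n. root_mean (half_circle s lam) (Suc n) (lam + (lam * side_sign s * \<i>) * (t - 1) ^ 2))) a"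
    proof (rule gevrey_asymptotic_root_mean[OF r \<theta> M c \<tau>0 \<gamma> sep, where \<kappa>="1/4"])
      show "norm (lam * side_sign s * \<i>) = 1" using n1 by (cases s) (auto simp: norm_mult)
      show "?D \<subseteq> ball 1 1"
      proof
        fix t assume "t \<in> ?D"
        thus "t \<in> ball 1 1" using norm_triangle_ineq[of "1 - of_real (1 + 1/4)" "of_real (1 + 1/4) - t"]
          by (simp add: dist_norm)
      qed
    qed (use cardioid_distance[OF n1] in auto)
    moreover have "lam + (lam * side_sign s * \<i>) * (u - 1) ^ 2 = lam * (1 + side_sign s * \<i> * (u - 1)\<^sup>2)" for u
      by (simp add: algebra_simps)
    ultimately have "\<exists>a. gevrey_asymptotic_on (\<tau> / 2) 1 r ?D (\<lambda>u. F (half_circle s lam) (lam * (1 + side_sign s * \<i> * (u - 1)\<^sup>2))) a"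
      by (simp add: F_def del: half_circle.simps)
    moreover have "?D \<in> outer_disks 1" unfolding outer_disks_def by (intro CollectI exI[of _ "1/4"]) auto
    ultimately show ?thesis unfolding gevrey_cardioid_def gevrey_plus_def by blast
  qed
  have Dm: "?Dm \<in> inner_disks lam" unfolding inner_disks_def
    by (intro CollectI exI[of _ "1/4"]) (auto simp: \<Delta>_def)
  have Dp: "?Dp \<in> outer_disks lam" unfolding outer_disks_def
    by (intro CollectI exI[of _ "1/4"]) (auto simp: \<Delta>_def)
  have q1: "norm q \<noteq> 1" if "q \<in> ?Dm \<union> ?Dp" for q
    using that inner_disk_norm_less[of q "1/4" lam] outer_disk_norm_greater[of q "1/4" lam] n1
    by (auto simp: \<Delta>_def)
  have feq: "f q = F UNIV q" if "q \<in> ?Dm \<union> ?Dp" for q using fF[OF q1[OF that]] .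
  obtain a where a: "gevrey_asymptotic_on \<tau> lam r (?Dm \<union> ?Dp) (F UNIV) a" using disks by blast
  hence af: "gevrey_asymptotic_on \<tau> lam r (?Dm \<union> ?Dp) f a"
    using gevrey_asymptotic_on_cong[of "?Dm \<union> ?Dp" f "F UNIV"] feq by simp
  hence gev: "f \<in> gevrey (2 * (\<tau> / 2)) lam r"
    unfolding gevrey_def gevrey_expansion_def
    by (simp, intro exI[of _ a] conjI bexI[OF _ Dm] bexI[OF _ Dp] gevrey_asymptotic_on_subset[OF af]) auto
  have "hadamard_extends s (\<tau> / 2) lam r f" for s
    unfolding hadamard_extends_def
  proof (intro bexI[OF _ Dm] bexI[OF _ Dp] conjI bexI[OF _ card] ballI)
    show "B_holomorphic_on r f ?Dm" "B_holomorphic_on r f ?Dp"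
      using af unfolding gevrey_asymptotic_on_def by (auto intro: B_holomorphic_on_subset)
    have "B_holomorphic_on r (F (half_circle s lam)) (?Dm \<union> ?Dp)"
      using disks[of "half_circle s lam"] unfolding gevrey_asymptotic_on_def by blast
    thus "B_holomorphic_on r (F (half_circle s lam)) ?Dm" "B_holomorphic_on r (F (half_circle s lam)) ?Dp"
      by (auto intro: B_holomorphic_on_subset)
    fix q z :: complex assume q: "q \<in> ?Dm \<union> ?Dp" and z: "z \<in> ball 0 r"
    \<comment> \<open>For fixed \<open>q\<close> off the circle all roots are at distance at least
      \<delta>. This crude, \<open>q\<close>-dependent bound is used for summability only.\<close>
    define \<delta> where "\<delta> = \<bar>norm q - 1\<bar>"
    have \<delta>: "\<delta> > 0" using q1[OF q] by (simp add: \<delta>_def)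
    have rm: "norm (root_mean X (Suc n) q) \<le> 1 / \<delta> * real (Suc n) powr 0" for X n
    proof -
      have "norm (\<Lambda> * (1 / (q - \<Lambda>))) \<le> 1 / \<delta>" if "\<Lambda> ^ Suc n = 1" for \<Lambda>
      proof -
        have L: "norm \<Lambda> = 1" using norm_root_unity[OF _ that] by simp
        hence "norm (q - \<Lambda>) \<ge> \<delta>" using norm_triangle_ineq3[of q \<Lambda>] by (simp add: \<delta>_def)
        hence "1 / norm (q - \<Lambda>) \<le> 1 / \<delta>" using \<delta> by (intro frac_le) auto
        thus ?thesis using L by (simp add: norm_mult norm_divide)
      qed
      hence "norm ((\<Sum>\<Lambda>\<in>{\<Lambda>. \<Lambda> ^ Suc n = 1} \<inter> X. \<Lambda> * (1 / (q - \<Lambda>))) / of_nat (Suc n)) \<le> 1 / \<delta>"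
        using \<delta> by (intro norm_sum_roots_le) auto
      thus ?thesis by (simp add: root_mean_def del: power_Suc of_nat_Suc)
    qed
    show "F (half_circle s lam) q z = (f q \<odot> delta_fun s lam q) z"
      unfolding F_def
    proof (rule hadamard_delta_fun[symmetric, OF _ q1[OF q] r _ z])
      show "f q = mode_series c (\<lambda>n. root_mean UNIV (Suc n) q)" using feq[OF q] by (simp add: F_def)
      show "summable (\<lambda>n. c n * root_mean X (Suc n) q * z ^ Suc n)" if "z \<in> ball 0 r" for X z
        by (rule mode_series_summable[OF r \<theta> M c rm]) (use \<delta> that in auto)
    qed
  qed
  thus ?thesis using gev unfolding gevrey_odot_def by blast
qed

section \<open>Coefficient decay and membership of the two kinds of solutions\<close>

lemma holomorphic_coeff_decay:
  assumes g: "g \<in> B r1" and r: "0 < r2" "r2 < r1"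
  shows "\<exists>M \<theta>. M \<ge> 0 \<and> 0 < \<theta> \<and> \<theta> < 1 \<and> (\<forall>n. norm (taylor_coeff g (Suc n)) * r2 ^ Suc n \<le> M * \<theta> ^ n)"
proof -
  obtain M where M: "M \<ge> 0" "\<And>z. z \<in> ball 0 r1 \<Longrightarrow> norm (g z) \<le> M" using B_boundedE[OF g] by blast
  \<comment> \<open>Cauchy's estimate on a circle strictly between the radii gives the ratio
    \<theta> = r2/\<rho> < 1.\<close>
  define \<rho> where "\<rho> = (r1 + r2) / 2"
  have \<rho>: "0 < \<rho>" "r2 < \<rho>" "\<rho> < r1" using r by (auto simp: \<rho>_def)
  have "norm (taylor_coeff g (Suc n)) * r2 ^ Suc n \<le> M * (r2 / \<rho>) ^ n" for n
  proof -
    have "norm (taylor_coeff g (Suc n)) \<le> M / \<rho> ^ Suc n"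
      by (rule taylor_coeff_bound) (use g \<rho> M in \<open>auto simp: B_def\<close>)
    hence "norm (taylor_coeff g (Suc n)) * r2 ^ Suc n \<le> M / \<rho> ^ Suc n * r2 ^ Suc n"
      using r by (intro mult_right_mono) auto
    also have "\<dots> = M * (r2 / \<rho>) ^ n * (r2 / \<rho>)" by (simp add: power_divide mult_ac)
    also have "\<dots> \<le> M * (r2 / \<rho>) ^ n * 1" using M \<rho> r by (intro mult_left_mono) auto
    finally show ?thesis by simp
  qed
  thus ?thesis using M \<rho> r by (intro exI[of _ M] exI[of _ "r2 / \<rho>"]) auto
qed

lemma solution_gevrey_odot:
  assumes "\<tau> \<ge> 2" "lam \<in> diophantine_points \<tau>" "0 < r2" "r2 < r1" "g \<in> B r1"
  shows "solution g \<in> gevrey_odot (\<tau> / 2) lam r2"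
proof -
  obtain M \<theta> where M: "M \<ge> 0" and \<theta>: "0 < \<theta>" "\<theta> < 1"
    and c: "\<And>n. norm (taylor_coeff g (Suc n)) * r2 ^ Suc n \<le> M * \<theta> ^ n"
    using holomorphic_coeff_decay[OF assms(5,3,4)] by blast
  show ?thesis
    by (rule mode_series_gevrey_odot[OF assms(1,2,3) \<theta> M c]) (auto simp: solution_def mode_series_def)
qed

lemma fundamental_solution_gevrey_odot:
  assumes "\<tau> \<ge> 2" "lam \<in> diophantine_points \<tau>" "0 < r" "r < 1"
  shows "fundamental_solution \<in> gevrey_odot (\<tau> / 2) lam r"
  by (rule mode_series_gevrey_odot[OF assms(1,2,3), where c="\<lambda>_. 1" and M=r and \<theta>=r])
     (use assms in \<open>auto simp: fundamental_solution_def mode_series_def\<close>)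

section \<open>Flat functions on a tangent disk\<close>

lemma exp_decay_half_plane_zero:
  fixes H :: "complex \<Rightarrow> complex"
  assumes hol: "H holomorphic_on {s. Re s > a}" and a: "a < 1"
    and bd: "\<And>s. Re s \<ge> 1 \<Longrightarrow> norm (H s) \<le> C * exp (- \<kappa> * norm s)" and \<kappa>: "\<kappa> > 0"
    and s: "Re s > 1"
  shows "H s = 0"
proof -
  \<comment> \<open>With this b, the factor exp (- b s Ln s) grows at most like exp (\<kappa> |s|), which the decay of H absorbs,
    and it compensates exp (K s) far away for every K. Letting K tend to infinity gives H = 0.\<close>
  define b where "b = 2 * \<kappa> / pi"
  have b: "b > 0" using \<kappa> by (simp add: b_def)
  have C: "C \<ge> 0"
    using bd[of 1] norm_ge_zero[of "H 1"] by (smt (verit) exp_gt_zero mult_neg_pos one_complex.sel(1))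
  define P where "P K s = H s * exp (of_nat K * s - of_real b * (s * Ln s))" for K :: nat and s
  have normP: "norm (P K s) = norm (H s) * exp (K * Re s - b * (Re s * ln (norm s) - Im s * Im (Ln s)))"
    if "Re s \<ge> 1" for K s
  proof -
    have "s \<noteq> 0" using that by auto
    thus ?thesis by (simp add: P_def norm_mult norm_exp_eq_Re)
  qed
  have Pbd: "norm (P K s) \<le> C * exp (Re s * (K - b * ln (norm s)))" if s: "Re s \<ge> 1" for K s
  proof -
    have "s \<noteq> 0" using s by auto
    have "\<bar>Im (Ln s)\<bar> \<le> pi / 2" using Re_Ln_pos_le[OF \<open>s \<noteq> 0\<close>] s by simp
    hence "\<bar>Im s\<bar> * \<bar>Im (Ln s)\<bar> \<le> norm s * (pi / 2)"
      using abs_Im_le_cmod by (intro mult_mono) auto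
    hence "Im s * Im (Ln s) \<le> norm s * (pi / 2)"
      unfolding abs_mult[symmetric] by (rule order_trans[OF abs_ge_self])
    hence "b * (Im s * Im (Ln s)) \<le> b * (norm s * (pi / 2))" using b by (intro mult_left_mono) auto
    also have "\<dots> = \<kappa> * norm s" by (simp add: b_def)
    finally have "exp (K * Re s - b * (Re s * ln (norm s) - Im s * Im (Ln s)))
        \<le> exp (\<kappa> * norm s + Re s * (K - b * ln (norm s)))"
      by (simp add: algebra_simps)
    hence "norm (P K s) \<le> (C * exp (- \<kappa> * norm s)) * exp (\<kappa> * norm s + Re s * (K - b * ln (norm s)))"
      unfolding normP[OF s] using bd[OF s] C by (intro mult_mono) auto
    also have "\<dots> = C * exp (Re s * (K - b * ln (norm s)))"
      by (simp add: exp_add[symmetric] mult.assoc)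
    finally show ?thesis .
  qed
  have Phol: "P K holomorphic_on {s. Re s > max a 0}" for K
    unfolding P_def
    by (intro holomorphic_intros holomorphic_on_subset[OF hol]) (auto simp: complex_nonpos_Reals_iff)
  have key: "norm (P K s) \<le> C * exp K" for K :: nat
  proof -
    \<comment> \<open>R is large enough to enclose \<open>s\<close> and to make ln |z| >= K/b on the
      arc, where the bound for \<open>P\<close> is then at most C. On the line Re z = 1 it is at
      most C exp K because ln |z| >= 0.\<close>
    define R where "R = max (norm s) (exp (K / b))"
    define S where "S = {s. Re s \<ge> 1} \<inter> cball 0 R"
    have "closed S" unfolding S_def by (intro closed_Int closed_halfspace_Re_ge closed_cball)
    have "open ({s. Re s > 1} \<inter> ball 0 R)" by (intro open_Int open_halfspace_Re_gt open_ball)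
    hence int: "{s. Re s > 1} \<inter> ball 0 R \<subseteq> interior S"
      by (intro interior_maximal) (auto simp: S_def)
    have sub: "S \<subseteq> {s. Re s > max a 0}" using a by (auto simp: S_def)
    show ?thesis
    proof (rule maximum_modulus_frontier[where S=S and f="P K" and \<xi>=s])
      show "P K holomorphic_on interior S"
        by (rule holomorphic_on_subset[OF Phol]) (use sub interior_subset in blast)
      show "continuous_on (closure S) (P K)"
        unfolding closure_closed[OF \<open>closed S\<close>]
        by (rule continuous_on_subset[OF holomorphic_on_imp_continuous_on[OF Phol] sub])
      show "bounded S" unfolding S_def by (meson bounded_Int bounded_cball)
      show "s \<in> S" using s by (auto simp: S_def R_def)
      fix z assume "z \<in> frontier S"
      hence z: "z \<in> S" "z \<notin> interior S" using \<open>closed S\<close> by (auto simp: frontier_def)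
      hence Re: "Re z \<ge> 1" by (auto simp: S_def)
      hence nz: "norm z \<ge> 1" using complex_Re_le_cmod[of z] by linarith
      have "Re z * (K - b * ln (norm z)) \<le> K"
      proof (cases "Re z = 1")
        case True
        have "b * ln (norm z) \<ge> 0" using b nz by (intro mult_nonneg_nonneg ln_ge_zero) auto
        thus ?thesis using True by simp
      next
        case False
        hence "norm z = R" using z int Re by (force simp: S_def)
        hence "norm z \<ge> exp (K / b)" by (simp add: R_def)
        hence "ln (norm z) \<ge> K / b" using nz by (subst ln_ge_iff) auto
        hence "K - b * ln (norm z) \<le> 0" using b by (simp add: field_simps)
        hence "Re z * (K - b * ln (norm z)) \<le> 0" using Re by (intro mult_nonneg_nonpos) auto
        thus ?thesis by (smt (verit) of_nat_0_le_iff)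
      qed
      hence "C * exp (Re z * (K - b * ln (norm z))) \<le> C * exp K" using C by (intro mult_left_mono) auto
      thus "norm (P K z) \<le> C * exp K" using Pbd[OF Re, of K] by linarith
    qed
  qed
  define E where "E = exp (- b * (Re s * ln (norm s) - Im s * Im (Ln s)))"
  \<comment> \<open>Dividing by exp (K Re s) leaves exp(-(Re s - 1))^K, which tends to 0 precisely
    because Re s > 1.\<close>
  have le: "norm (H s) * E \<le> C * exp (- (Re s - 1)) ^ K" for K :: nat
  proof -
    have "norm (H s) * E * exp (K * Re s) = norm (P K s)"
      using s by (simp add: normP E_def exp_add[symmetric] mult.assoc)
    also have "\<dots> \<le> C * exp K" by (rule key)
    finally have "norm (H s) * E * exp (K * Re s) * exp (- (K * Re s)) \<le> C * exp K * exp (- (K * Re s))"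
      by (rule mult_right_mono) auto
    thus ?thesis by (simp add: exp_add[symmetric] mult.assoc exp_of_nat_mult[symmetric] algebra_simps exp_minus_inverse)
  qed
  have "(\<lambda>K. C * exp (- (Re s - 1)) ^ K) \<longlonglongrightarrow> C * 0"
    using s by (intro tendsto_mult tendsto_const LIMSEQ_realpow_zero) auto
  hence "norm (H s) * E \<le> C * 0" by (rule LIMSEQ_le_const) (use le in auto)
  thus ?thesis by (simp add: E_def mult_le_0_iff)
qed

text \<open>Instead of choosing the best N, the bounds are multiplied by y^N / N! and summed. With y
  = 1/(2 c1 x) the right side is a geometric series of sum 2 c0 and the left side is A exp
  y.\<close>

lemma factorial_bound_imp_exp_bound:
  fixes A c0 c1 x :: real
  assumes bd: "\<And>N::nat. A \<le> c0 * c1 ^ N * fact N * x ^ N" and c1: "c1 > 0" and x: "x > 0"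
  shows "A \<le> 2 * c0 * exp (- (1 / (2 * c1)) * (1 / x))"
proof -
  define y where "y = 1 / (2 * c1 * x)"
  have y: "y > 0" using c1 x by (simp add: y_def)
  have "A * (y ^ N / fact N) \<le> c0 * (1 / 2) ^ N" for N
  proof -
    have "A * (y ^ N / fact N) \<le> c0 * c1 ^ N * fact N * x ^ N * (y ^ N / fact N)"
      using y by (intro mult_right_mono bd) auto
    also have "\<dots> = c0 * (c1 * x * y) ^ N" by (simp add: power_mult_distrib)
    also have "c1 * x * y = 1 / 2" using c1 x by (simp add: y_def)
    finally show ?thesis .
  qed
  moreover have "(\<lambda>N. A * (y ^ N / fact N)) sums (A * exp y)"
    using exp_converges[of y] by (intro sums_mult) (simp add: divide_inverse mult.commute)
  moreover have "(\<lambda>N. c0 * (1 / 2) ^ N) sums (c0 * 2)"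
    using geometric_sums[of "1 / 2 :: real"] by (intro sums_mult) simp
  ultimately have "A * exp y \<le> c0 * 2" by (rule sums_le)
  hence "A * exp y * exp (- y) \<le> c0 * 2 * exp (- y)" by (rule mult_right_mono) auto
  hence "A \<le> c0 * 2 * exp (- y)" by (simp add: mult.assoc exp_minus_inverse)
  thus ?thesis by (simp add: y_def mult_ac)
qed

text \<open>Watson's uniqueness theorem in its borderline case: w = 1/(u - 1) maps the disk onto Re
  w > 1/(2 \<rho>), and the factorial bounds become exponential decay in |w|.\<close>

lemma gevrey_one_flat_zero:
  fixes F :: "complex \<Rightarrow> complex"
  assumes hol: "F holomorphic_on ball (1 + of_real \<rho>) \<rho>" and \<rho>: "\<rho> > 0"
    and bd: "\<And>N u. u \<in> ball (1 + of_real \<rho>) \<rho> \<Longrightarrow> norm (F u) \<le> c0 * c1 ^ N * fact N * norm (u - 1) ^ N"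
    and c1: "c1 > 0" and u: "u \<in> ball (1 + of_real \<rho>) \<rho>"
  shows "F u = 0"
proof -
  define D where "D = ball (1 + of_real \<rho> :: complex) \<rho>"
  have inD: "1 + 1 / w \<in> D" if "Re w > 1 / (2 * \<rho>)" for w
  proof -
    have w0: "w \<noteq> 0" using that \<rho> by (auto simp: field_simps)
    have "2 * \<rho> * Re w > 1" using that \<rho> by (simp add: field_simps)
    have "(norm (1 - of_real \<rho> * w))\<^sup>2 = (norm (of_real \<rho> * w))\<^sup>2 + (1 - 2 * \<rho> * Re w)"
      unfolding cmod_power2 by (simp add: power2_eq_square algebra_simps)
    hence "(norm (1 - of_real \<rho> * w))\<^sup>2 < (norm (of_real \<rho> * w))\<^sup>2" using \<open>2 * \<rho> * Re w > 1\<close> by simp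
    hence "norm (1 - of_real \<rho> * w) < norm (of_real \<rho> * w)" by (rule power2_less_imp_less) auto
    hence *: "norm (1 - of_real \<rho> * w) < \<rho> * norm w" using \<rho> by (simp add: norm_mult)
    have "1 / w - of_real \<rho> = (1 - of_real \<rho> * w) / w" using w0 by (simp add: field_simps)
    hence "norm (1 / w - of_real \<rho>) < \<rho>" using * w0 by (simp add: norm_divide pos_divide_less_eq)
    thus ?thesis unfolding D_def by (simp add: dist_norm norm_minus_commute algebra_simps)
  qed
  define v where "v = u - 1"
  have v: "norm (v - of_real \<rho>) < \<rho>" using u by (simp add: v_def dist_norm norm_minus_commute algebra_simps)
  hence v0: "v \<noteq> 0" using \<rho> by auto
  have Rev: "Re (1 / v) > 1 / (2 * \<rho>)"
  proof -
    have "(norm (v - of_real \<rho>))\<^sup>2 < \<rho>\<^sup>2" using v \<rho> by (intro power_strict_mono) auto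
    hence "(norm v)\<^sup>2 < 2 * \<rho> * Re v" unfolding cmod_power2 by (simp add: power2_eq_square algebra_simps)
    moreover have "(norm v)\<^sup>2 > 0" using v0 by simp
    ultimately have "1 / (2 * \<rho>) < Re v / (norm v)\<^sup>2"
      using \<rho> by (simp only: pos_less_divide_eq pos_divide_less_eq mult_pos_pos) (simp add: field_simps)
    thus ?thesis by (simp add: Re_divide cmod_power2)
  qed
  \<comment> \<open>Rescaling by a value strictly between the edge of the half plane and the given
    point puts the edge at a < 1 and the point to the right of 1.\<close>
  obtain w0 where w0: "1 / (2 * \<rho>) < w0" "w0 < Re (1 / v)" using dense[OF Rev] by blast
  have w0p: "w0 > 0" using w0 \<rho> by (smt (verit) divide_pos_pos)
  define a where "a = 1 / (2 * \<rho>) / w0"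
  have a: "a < 1" unfolding a_def using w0(1) w0p by (subst pos_divide_less_eq) auto
  have Re_gt: "Re (of_real w0 * s) > 1 / (2 * \<rho>)" if "Re s > a" for s
  proof -
    have "1 / (2 * \<rho>) < Re s * w0" using that w0p unfolding a_def by (subst (asm) pos_divide_less_eq) auto
    thus ?thesis by (simp add: mult.commute)
  qed
  define H where "H s = F (1 + 1 / (of_real w0 * s))" for s
  have "H (1 / v / of_real w0) = 0"
  proof (rule exp_decay_half_plane_zero[where H=H and a=a and C="2 * c0" and \<kappa>="w0 / (2 * c1)"])
    have "(\<lambda>s. 1 + 1 / (of_real w0 * s)) holomorphic_on {s. Re s > a}"
      using Re_gt \<rho> w0p by (intro holomorphic_intros) (force simp: a_def)
    moreover have "(\<lambda>s. 1 + 1 / (of_real w0 * s)) ` {s. Re s > a} \<subseteq> D" using inD Re_gt by auto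
    ultimately have "F \<circ> (\<lambda>s. 1 + 1 / (of_real w0 * s)) holomorphic_on {s. Re s > a}"
      using hol unfolding D_def by (intro holomorphic_on_compose_gen[where t=D]) (auto simp: D_def)
    thus "H holomorphic_on {s. Re s > a}" by (simp add: H_def[abs_def] o_def)
    show "norm (H s) \<le> 2 * c0 * exp (- (w0 / (2 * c1)) * norm s)" if "Re s \<ge> 1" for s
    proof -
      have s0: "s \<noteq> 0" using that by auto
      have "1 + 1 / (of_real w0 * s) \<in> D" by (rule inD[OF Re_gt]) (use that a in simp)
      hence "norm (H s) \<le> c0 * c1 ^ N * fact N * (1 / (w0 * norm s)) ^ N" for N
        using bd[of "1 + 1 / (of_real w0 * s)" N] w0p by (simp add: H_def D_def norm_divide norm_mult)
      hence "norm (H s) \<le> 2 * c0 * exp (- (1 / (2 * c1)) * (1 / (1 / (w0 * norm s))))"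
        by (rule factorial_bound_imp_exp_bound[OF _ c1]) (use w0p s0 in auto)
      thus ?thesis by simp
    qed
    show "Re (1 / v / of_real w0) > 1" unfolding Re_divide_of_real using w0 w0p by (subst pos_less_divide_eq) auto
  qed (use a w0p c1 in auto)
  thus ?thesis using v0 w0p by (simp add: H_def v_def)
qed

text \<open>Uniqueness of asymptotic expansions along one ray: once the lower coefficients vanish,
  truncation after order k leaves \<beta>_k t^k = O(t^(k+1)).\<close>

lemma asymptotic_poly_coeffs_zero:
  fixes \<beta> :: "nat \<Rightarrow> complex" and \<omega> :: complex
  assumes \<omega>: "\<omega> \<noteq> 0" and t0: "t0 > 0"
    and bd: "\<And>N. \<exists>C. \<forall>t. 0 < t \<and> t < t0 \<longrightarrow> norm (\<Sum>k<N. \<beta> k * (of_real t * \<omega>) ^ k) \<le> C * t ^ N"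
  shows "\<beta> k = 0"
proof (induction k rule: less_induct)
  case (less k)
  obtain C where C: "\<And>t. 0 < t \<and> t < t0 \<Longrightarrow> norm (\<Sum>j<Suc k. \<beta> j * (of_real t * \<omega>) ^ j) \<le> C * t ^ Suc k"
    using bd[of "Suc k"] by blast
  have "norm (\<beta> k) * norm \<omega> ^ k \<le> C * t" if t: "0 < t \<and> t < t0" for t
  proof -
    have "(\<Sum>j<Suc k. \<beta> j * (of_real t * \<omega>) ^ j) = \<beta> k * (of_real t * \<omega>) ^ k" using less by simp
    hence "norm (\<beta> k) * norm \<omega> ^ k * t ^ k \<le> C * t * t ^ k" using C[OF t] t
      by (simp add: norm_mult norm_power power_mult_distrib mult_ac)
    thus ?thesis using t by simp
  qed
  hence ev: "\<forall>\<^sub>F t in at_right 0. norm (\<beta> k) * norm \<omega> ^ k \<le> C * t"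
    using t0 by (auto simp: eventually_at_right_field intro!: exI[of _ t0])
  have "((\<lambda>t. C * t) \<longlongrightarrow> C * 0) (at_right 0)" by (intro tendsto_intros)
  hence "norm (\<beta> k) * norm \<omega> ^ k \<le> C * 0"
    by (rule tendsto_lowerbound[OF _ ev]) simp
  moreover have "norm \<omega> ^ k > 0" using \<omega> by simp
  ultimately show ?case by (auto simp: mult_le_0_iff)
qed

section \<open>Quasianalyticity\<close>

lemma taylor_coeff_asymptotic_remainder:
  assumes "f \<in> B r" "\<And>k. a k \<in> B r" "r > 0"
  shows "taylor_coeff (\<lambda>z. f z - (\<Sum>k<N. a k z * x ^ k)) n
    = taylor_coeff f n - (\<Sum>k<N. taylor_coeff (a k) n * x ^ k)"
proof (rule taylor_coeff_eqI[OF assms(3)])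
  fix z :: complex assume z: "z \<in> ball 0 r"
  have "(\<lambda>n. taylor_coeff f n * z ^ n - (\<Sum>k<N. taylor_coeff (a k) n * z ^ n * x ^ k))
     sums (f z - (\<Sum>k<N. a k z * x ^ k))"
    using assms z by (intro sums_diff sums_sum sums_mult2 taylor_coeff_sums[where r=r]) (auto simp: B_def)
  thus "(\<lambda>n. (taylor_coeff f n - (\<Sum>k<N. taylor_coeff (a k) n * x ^ k)) * z ^ n)
     sums (f z - (\<Sum>k<N. a k z * x ^ k))"
    by (simp add: left_diff_distrib sum_distrib_right mult.assoc mult.commute[of "z ^ _"])
qed

lemma taylor_coeff_le_B_norm:
  assumes "A \<in> B r" "r > 0"
  shows "norm (taylor_coeff A n) \<le> B_norm r A / (r / 2) ^ n"
  by (rule taylor_coeff_bound[of A r]) (use assms norm_le_B_norm in \<open>auto simp: B_def\<close>)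

lemma B_eqI_taylor_coeff:
  assumes "A \<in> B r" "C \<in> B r" "\<And>n. taylor_coeff A n = taylor_coeff C n" "z \<in> ball 0 r"
  shows "A z = C z"
proof -
  have "(\<lambda>n. taylor_coeff A n * z ^ n) sums A z" "(\<lambda>n. taylor_coeff A n * z ^ n) sums C z"
    using taylor_coeff_sums[of A r z] taylor_coeff_sums[of C r z] assms by (auto simp: B_def)
  thus ?thesis by (rule sums_unique2)
qed

lemma gevrey_asymptotic_remainder_B:
  assumes "gevrey_asymptotic_on \<sigma> l r \<Delta> f a" "q \<in> \<Delta>"
  shows "(\<lambda>z. f q z - (\<Sum>k<N. a k z * (q - l) ^ k)) \<in> B r"
  using assms unfolding gevrey_asymptotic_on_def
  by (intro B_diff B_sum B_cmult) (auto dest: B_holomorphic_on_B)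

lemma gevrey_asymptotic_diff_bound:
  assumes f: "gevrey_asymptotic_on \<sigma> l r \<Delta> f a" and g: "gevrey_asymptotic_on \<sigma> l r \<Delta> g b"
    and ab: "\<And>k z. z \<in> ball 0 r \<Longrightarrow> a k z = b k z" and \<sigma>: "\<sigma> \<ge> 0"
  obtains c0 c1 where "c0 > 0" "c1 > 0"
    "\<And>N q z. q \<in> \<Delta> \<Longrightarrow> z \<in> ball 0 r
      \<Longrightarrow> norm (f q z - g q z) \<le> c0 * c1 ^ N * Gamma (1 + real N * \<sigma>) * norm (q - l) ^ N"
proof -
  obtain c0 c1 where c: "c0 > 0" "c1 > 0" and cb: "\<And>N q. q \<in> \<Delta> \<Longrightarrow>
      B_norm r (\<lambda>z. f q z - (\<Sum>n<N. a n z * (q - l) ^ n)) \<le> c0 * c1 ^ N * Gamma (1 + real N * \<sigma>) * norm (q - l) ^ N"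
    using f unfolding gevrey_asymptotic_on_def by blast
  obtain d0 d1 where d: "d0 > 0" "d1 > 0" and db: "\<And>N q. q \<in> \<Delta> \<Longrightarrow>
      B_norm r (\<lambda>z. g q z - (\<Sum>n<N. b n z * (q - l) ^ n)) \<le> d0 * d1 ^ N * Gamma (1 + real N * \<sigma>) * norm (q - l) ^ N"
    using g unfolding gevrey_asymptotic_on_def by blast
  show ?thesis
  proof (rule that[of "c0 + d0" "max c1 d1"])
    fix N q z assume q: "q \<in> \<Delta>" and z: "z \<in> ball (0::complex) r"
    define W where "W = Gamma (1 + real N * \<sigma>) * norm (q - l) ^ N"
    have W: "W \<ge> 0" unfolding W_def using \<sigma> by (intro mult_nonneg_nonneg Gamma_real_nonneg) (auto simp: add_pos_nonneg)
    have "norm (f q z - (\<Sum>n<N. a n z * (q - l) ^ n)) \<le> c0 * c1 ^ N * W"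
      using norm_le_B_norm[OF gevrey_asymptotic_remainder_B[OF f q] z] cb[OF q]
      by (force simp: W_def mult.assoc intro: order_trans)
    also have "\<dots> \<le> c0 * max c1 d1 ^ N * W" using c W by (intro mult_mono power_mono) auto
    finally have 1: "norm (f q z - (\<Sum>n<N. a n z * (q - l) ^ n)) \<le> c0 * max c1 d1 ^ N * W" .
    have "norm (g q z - (\<Sum>n<N. b n z * (q - l) ^ n)) \<le> d0 * d1 ^ N * W"
      using norm_le_B_norm[OF gevrey_asymptotic_remainder_B[OF g q] z] db[OF q]
      by (force simp: W_def mult.assoc intro: order_trans)
    also have "\<dots> \<le> d0 * max c1 d1 ^ N * W" using d W by (intro mult_mono power_mono) auto
    finally have 2: "norm (g q z - (\<Sum>n<N. a n z * (q - l) ^ n)) \<le> d0 * max c1 d1 ^ N * W"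
      using ab[OF z] by simp
    have "norm (f q z - g q z) \<le> norm (f q z - (\<Sum>n<N. a n z * (q - l) ^ n)) + norm (g q z - (\<Sum>n<N. a n z * (q - l) ^ n))"
      using norm_triangle_ineq4[of "f q z - (\<Sum>n<N. a n z * (q - l) ^ n)" "g q z - (\<Sum>n<N. a n z * (q - l) ^ n)"] by simp
    also have "\<dots> \<le> c0 * max c1 d1 ^ N * W + d0 * max c1 d1 ^ N * W" by (rule add_mono[OF 1 2])
    finally show "norm (f q z - g q z) \<le> (c0 + d0) * max c1 d1 ^ N * Gamma (1 + real N * \<sigma>) * norm (q - l) ^ N"
      by (simp add: W_def algebra_simps)
  qed (use c d in auto)
qed

text \<open>Descent to scalar expansions. The constant may depend on n and N, which is enough to
  identify expansion coefficients; the Gevrey growth is exploited in norm afterwards.\<close>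

lemma gevrey_asymptotic_coeff_bound:
  assumes f: "gevrey_asymptotic_on \<sigma> l r \<Delta> f a" and r: "r > 0"
  shows "\<exists>C. \<forall>q\<in>\<Delta>. norm (taylor_coeff (f q) n - (\<Sum>k<N. taylor_coeff (a k) n * (q - l) ^ k)) \<le> C * norm (q - l) ^ N"
proof -
  obtain c0 c1 where cb: "\<And>N q. q \<in> \<Delta> \<Longrightarrow>
      B_norm r (\<lambda>z. f q z - (\<Sum>n<N. a n z * (q - l) ^ n)) \<le> c0 * c1 ^ N * Gamma (1 + real N * \<sigma>) * norm (q - l) ^ N"
    using f unfolding gevrey_asymptotic_on_def by blast
  have "norm (taylor_coeff (f q) n - (\<Sum>k<N. taylor_coeff (a k) n * (q - l) ^ k))
      \<le> c0 * c1 ^ N * Gamma (1 + real N * \<sigma>) / (r / 2) ^ n * norm (q - l) ^ N" if q: "q \<in> \<Delta>" for q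
  proof -
    have "f q \<in> B r" "\<And>k. a k \<in> B r" using f q unfolding gevrey_asymptotic_on_def by (auto dest: B_holomorphic_on_B)
    hence "norm (taylor_coeff (f q) n - (\<Sum>k<N. taylor_coeff (a k) n * (q - l) ^ k))
        = norm (taylor_coeff (\<lambda>z. f q z - (\<Sum>k<N. a k z * (q - l) ^ k)) n)"
      by (subst taylor_coeff_asymptotic_remainder[OF _ _ r]) auto
    also have "\<dots> \<le> B_norm r (\<lambda>z. f q z - (\<Sum>n<N. a n z * (q - l) ^ n)) / (r / 2) ^ n"
      by (rule taylor_coeff_le_B_norm[OF gevrey_asymptotic_remainder_B[OF f q] r])
    also have "\<dots> \<le> c0 * c1 ^ N * Gamma (1 + real N * \<sigma>) * norm (q - l) ^ N / (r / 2) ^ n"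
      using r by (intro divide_right_mono cb[OF q]) auto
    finally show ?thesis by simp
  qed
  thus ?thesis by blast
qed

text \<open>\<open>\<odot>\<close> is a \<open>suminf\<close>, so coefficients can be read off only
  where the series is known to converge. A small disk suffices, since Taylor coefficients are
  local.\<close>

lemma taylor_coeff_hadamard_delta:
  assumes f: "f \<in> B r" and r: "r > 0" and h: "\<And>z. z \<in> ball 0 r \<Longrightarrow> h z = (f \<odot> delta_fun s lam q) z"
  shows "taylor_coeff h n = taylor_coeff f n * delta_poly s lam n q"
proof -
  \<comment> \<open>Combines Cauchy's (r/2)^(-n) for \<open>f\<close> with (1 + |q|)^n for
    \<open>delta_poly\<close>.\<close>
  define R where "R = r / 2 / (1 + norm q)"
  have q1: "1 + norm q > 0" by (simp add: add_pos_nonneg)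
  have R: "R > 0" "R \<le> r" using r q1 by (auto simp: R_def field_simps add_pos_nonneg)
  show ?thesis
  proof (rule taylor_coeff_eqI[OF R(1)])
    fix z :: complex assume z: "z \<in> ball 0 R"
    let ?t = "\<lambda>n. taylor_coeff f n * delta_poly s lam n q * z ^ n"
    let ?y = "norm z * (1 + norm q) / (r / 2)"
    have y: "?y < 1" using z r q1 by (simp add: R_def field_simps)
    have "norm (?t n) \<le> B_norm r f * ?y ^ n" for n
    proof -
      have "norm (delta_poly s lam n q) \<le> (1 + norm q) ^ n"
      proof (cases "n \<ge> 1")
        case True
        thus ?thesis unfolding delta_poly_def
          by (intro order_trans[OF norm_sum norm_delta_poly_sum_le])
      next
        case False
        thus ?thesis by (simp add: delta_poly_def not_le)
      qed
      hence "norm (?t n) \<le> B_norm r f / (r / 2) ^ n * (1 + norm q) ^ n * norm z ^ n"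
        unfolding norm_mult norm_power using taylor_coeff_le_B_norm[OF f r, of n] B_norm_nonneg[OF f r] r q1
        by (intro mult_mono) auto
      also have "B_norm r f / (r / 2) ^ n * (1 + norm q) ^ n * norm z ^ n = B_norm r f * ?y ^ n"
        by (simp only: power_divide power_mult_distrib) simp
      finally show ?thesis .
    qed
    hence bound: "norm (?t n) \<le> B_norm r f * ?y ^ n" for n .
    have "?y \<ge> 0" using r q1 by (intro divide_nonneg_pos mult_nonneg_nonneg) auto
    hence "norm ?y < 1" using y by simp
    hence "summable (\<lambda>n. B_norm r f * ?y ^ n)" by (intro summable_mult summable_geometric)
    hence "summable ?t" by (rule summable_comparison_test'[of _ 0]) (rule bound)
    moreover have "h z = (\<Sum>n. ?t n)"
      using h[of z] z R by (simp add: hadamard_def taylor_coeff_delta_fun)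
    ultimately show "?t sums h z" by (simp add: summable_sums)
  qed
qed

section \<open>Tangent disks on both sides of the circle, indexed by a sign e\<close>

definition tangent_disk :: "complex \<Rightarrow> real \<Rightarrow> real \<Rightarrow> complex set" where
  "tangent_disk lam e \<rho> = ball (of_real (1 + e * \<rho>) * lam) \<rho>"

lemma tangent_disk_mono:
  assumes "norm lam = 1" "\<bar>e\<bar> = 1" "\<rho> \<le> \<rho>'"
  shows "tangent_disk lam e \<rho> \<subseteq> tangent_disk lam e \<rho>'"
proof
  fix q assume q: "q \<in> tangent_disk lam e \<rho>"
  have "of_real (1 + e * \<rho>') * lam - of_real (1 + e * \<rho>) * lam = of_real (e * (\<rho>' - \<rho>)) * lam"
    by (simp add: algebra_simps)
  hence "norm (of_real (1 + e * \<rho>') * lam - of_real (1 + e * \<rho>) * lam) = \<rho>' - \<rho>"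
    using assms by (simp add: norm_mult abs_mult del: of_real_diff of_real_mult)
  thus "q \<in> tangent_disk lam e \<rho>'"
    using q norm_triangle_ineq[of "of_real (1 + e * \<rho>') * lam - of_real (1 + e * \<rho>) * lam" "of_real (1 + e * \<rho>) * lam - q"]
    by (simp add: tangent_disk_def dist_norm)
qed

lemma radial_in_tangent_disk:
  assumes "norm lam = 1" "\<bar>e\<bar> = 1" "0 < x" "x < 2 * \<rho>"
  shows "of_real (1 + e * x) * lam \<in> tangent_disk lam e \<rho>"
proof -
  have "of_real (1 + e * \<rho>) * lam - of_real (1 + e * x) * lam = of_real (e * (\<rho> - x)) * lam"
    by (simp add: algebra_simps)
  hence "norm (of_real (1 + e * \<rho>) * lam - of_real (1 + e * x) * lam) = \<bar>\<rho> - x\<bar>"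
    using assms by (simp add: norm_mult abs_mult del: of_real_diff of_real_mult)
  thus ?thesis using assms by (simp add: tangent_disk_def dist_norm)
qed

lemma inner_disks_eq: "inner_disks lam = {tangent_disk lam (-1) \<rho> | \<rho>. 0 < \<rho> \<and> \<rho> < 1}"
  unfolding inner_disks_def tangent_disk_def by simp

lemma outer_disks_eq: "outer_disks lam = {tangent_disk lam 1 \<rho> | \<rho>. 0 < \<rho>}"
  unfolding outer_disks_def tangent_disk_def by simp

text \<open>Identity theorem, with the midpoint of a radial segment as accumulation point. It passes
  vanishing from the cardioid, which contains such a segment, to the whole tangent disk.\<close>

lemma tangent_disk_zero_from_radial:
  assumes g: "g holomorphic_on tangent_disk lam e \<rho>" and lam: "norm lam = 1" and e: "\<bar>e\<bar> = 1"
    and \<rho>: "\<rho> > 0" and x1: "x1 > 0"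
    and zero: "\<And>x. 0 < x \<Longrightarrow> x < x1 \<Longrightarrow> g (of_real (1 + e * x) * lam) = 0"
    and q: "q \<in> tangent_disk lam e \<rho>"
  shows "g q = 0"
proof -
  define x2 where "x2 = min x1 (2 * \<rho>)"
  have x2: "0 < x2" "x2 \<le> x1" "x2 \<le> 2 * \<rho>" using x1 \<rho> by (auto simp: x2_def)
  define U where "U = {of_real (1 + e * x) * lam | x. 0 < x \<and> x < x2}"
  let ?p = "of_real (1 + e * (x2 / 2)) * lam"
  show ?thesis
  proof (rule analytic_continuation[OF g, where U=U and \<xi>="?p"])
    show "open (tangent_disk lam e \<rho>)" "connected (tangent_disk lam e \<rho>)" by (auto simp: tangent_disk_def)
    show "U \<subseteq> tangent_disk lam e \<rho>" using x2 radial_in_tangent_disk[OF lam e] by (auto simp: U_def simp del: of_real_add of_real_mult)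
    show "?p \<in> tangent_disk lam e \<rho>" by (rule radial_in_tangent_disk[OF lam e]) (use x2 in auto)
    show "?p islimpt U" unfolding islimpt_approachable
    proof (intro allI impI)
      fix \<epsilon> :: real assume \<epsilon>: "\<epsilon> > 0"
      define d where "d = min \<epsilon> x2 / 4"
      have d: "d > 0" "d < \<epsilon>" "d < x2 / 2" using \<epsilon> x2 by (auto simp: d_def)
      let ?p' = "of_real (1 + e * (x2 / 2 + d)) * lam"
      have "?p' - ?p = of_real (e * d) * lam" by (simp add: algebra_simps)
      hence "norm (?p' - ?p) = d" using lam e d by (simp add: norm_mult abs_mult del: of_real_mult)
      moreover have "?p' \<in> U" unfolding U_def by (intro CollectI exI[of _ "x2 / 2 + d"]) (use d x2 in auto)
      ultimately show "\<exists>x'\<in>U. x' \<noteq> ?p \<and> dist x' ?p < \<epsilon>"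
        using d by (intro bexI[of _ ?p']) (auto simp: dist_norm)
    qed
    show "g z = 0" if "z \<in> U" for z using that zero x2 by (auto simp: U_def simp del: of_real_add of_real_mult)
  qed (rule q)
qed

text \<open>The extensions come with unrelated expansions \<open>b1\<close>, \<open>b2\<close> in
  the cardioid variable. Flatness of f1 - f2 on the inner radius forces these to agree
  coefficientwise; Watson's theorem then identifies the extensions on the cardioid, and continuation
  from the radius with sign \<open>e\<close> reaches either disk.\<close>

lemma cardioid_extensions_agree:
  fixes h1 h2 f1 f2 :: "complex \<Rightarrow> complex \<Rightarrow> complex"
  assumes r: "r > 0" and lam: "norm lam = 1" and \<rho>: "\<rho> > 0"
    and h1: "h1 \<in> gevrey_cardioid s 1 lam r" and h2: "h2 \<in> gevrey_cardioid s 1 lam r"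
    and hB1: "\<And>e. \<bar>e\<bar> = 1 \<Longrightarrow> B_holomorphic_on r h1 (tangent_disk lam e \<rho>)"
    and hB2: "\<And>e. \<bar>e\<bar> = 1 \<Longrightarrow> B_holomorphic_on r h2 (tangent_disk lam e \<rho>)"
    and fB1: "\<And>q. q \<in> tangent_disk lam (-1) \<rho> \<Longrightarrow> f1 q \<in> B r"
    and fB2: "\<And>q. q \<in> tangent_disk lam (-1) \<rho> \<Longrightarrow> f2 q \<in> B r"
    and hf1: "\<And>q z. q \<in> tangent_disk lam (-1) \<rho> \<Longrightarrow> z \<in> ball 0 r \<Longrightarrow> h1 q z = (f1 q \<odot> delta_fun s lam q) z"
    and hf2: "\<And>q z. q \<in> tangent_disk lam (-1) \<rho> \<Longrightarrow> z \<in> ball 0 r \<Longrightarrow> h2 q z = (f2 q \<odot> delta_fun s lam q) z"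
    and flat: "\<And>n N. \<exists>C. \<forall>q\<in>tangent_disk lam (-1) \<rho>. norm (taylor_coeff (f1 q) n - taylor_coeff (f2 q) n) \<le> C * norm (q - lam) ^ N"
    and e: "\<bar>e\<bar> = 1" and q: "q \<in> tangent_disk lam e \<rho>" and z: "z \<in> ball 0 r"
  shows "h1 q z = h2 q z"
proof -
  obtain \<epsilon> :: real where \<epsilon>: "side_sign s = of_real \<epsilon>" "\<epsilon> * \<epsilon> = 1" "\<bar>\<epsilon>\<bar> = 1"
    using that[of 1] that[of "-1"] by (cases s) auto
  define Q where "Q u = lam * (1 + side_sign s * \<i> * (u - 1)\<^sup>2)" for u
  obtain \<rho>1 b1 where \<rho>1: "\<rho>1 > 0" and b1: "gevrey_asymptotic_on 1 1 r (tangent_disk 1 1 \<rho>1) (\<lambda>u. h1 (Q u)) b1"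
    using h1 unfolding gevrey_cardioid_def gevrey_plus_def outer_disks_eq Q_def by blast
  obtain \<rho>2 b2 where \<rho>2: "\<rho>2 > 0" and b2: "gevrey_asymptotic_on 1 1 r (tangent_disk 1 1 \<rho>2) (\<lambda>u. h2 (Q u)) b2"
    using h2 unfolding gevrey_cardioid_def gevrey_plus_def outer_disks_eq Q_def by blast
  define \<rho>c where "\<rho>c = min \<rho>1 \<rho>2"
  define \<Delta> where "\<Delta> = tangent_disk 1 1 \<rho>c"
  have \<rho>c: "\<rho>c > 0" using \<rho>1 \<rho>2 by (simp add: \<rho>c_def)
  have G1: "gevrey_asymptotic_on 1 1 r \<Delta> (\<lambda>u. h1 (Q u)) b1"
    unfolding \<Delta>_def by (rule gevrey_asymptotic_on_subset[OF b1 tangent_disk_mono]) (auto simp: \<rho>c_def)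
  have G2: "gevrey_asymptotic_on 1 1 r \<Delta> (\<lambda>u. h2 (Q u)) b2"
    unfolding \<Delta>_def by (rule gevrey_asymptotic_on_subset[OF b2 tangent_disk_mono]) (auto simp: \<rho>c_def)
  \<comment> \<open>Q maps these two rays to the radius through lam, inside the circle for \<eta> = -1 and outside for \<eta> = 1.\<close>
  define ray where "ray \<eta> t = 1 + of_real t * (1 - of_real (\<epsilon> * \<eta>) * \<i>)" for \<eta> t :: real
  \<comment> \<open>The ray leaves 1 at 45 degrees to the axis of the disk, so it stays inside for t
    < \<rho>c.\<close>
  have ray_in: "ray \<eta> t \<in> \<Delta>" if "\<bar>\<eta>\<bar> = 1" "0 < t" "t < \<rho>c" for \<eta> t
  proof -
    have "(\<epsilon> * \<eta>)\<^sup>2 = 1" using \<epsilon> that by (metis abs_mult mult_1 abs_square_eq_1)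
    hence "(norm (of_real \<rho>c - of_real t * (1 - of_real (\<epsilon> * \<eta>) * \<i>)))\<^sup>2 = (\<rho>c - t)\<^sup>2 + t\<^sup>2"
      unfolding cmod_power2 by (simp add: power_mult_distrib)
    also have "\<dots> < \<rho>c\<^sup>2" using that mult_strict_left_mono[of t \<rho>c t] by (simp add: power2_eq_square algebra_simps)
    finally have "norm (of_real \<rho>c - of_real t * (1 - of_real (\<epsilon> * \<eta>) * \<i>)) < \<rho>c"
      by (rule power2_less_imp_less) (use \<rho>c in simp)
    thus ?thesis by (simp add: \<Delta>_def tangent_disk_def dist_norm ray_def)
  qed
  have Q_ray: "Q (ray \<eta> t) = of_real (1 + \<eta> * (2 * t\<^sup>2)) * lam" if "\<bar>\<eta>\<bar> = 1" for \<eta> t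
  proof -
    have *: "\<eta> * \<eta> = 1" using that by (metis abs_mult_self_eq mult_1)
    \<comment> \<open>The square is purely imaginary, so multiplication by \<epsilon> \<i> makes it
      real with the sign of \<eta>.\<close>
    have "(1 - of_real (\<epsilon> * \<eta>) * \<i>)\<^sup>2 = - 2 * of_real (\<epsilon> * \<eta>) * \<i>"
    proof -
      have "(\<epsilon> * \<eta>) * (\<epsilon> * \<eta>) = 1" using \<epsilon> * by (simp add: mult_ac)
      thus ?thesis by (simp add: complex_eq_iff power2_eq_square)
    qed
    hence "of_real \<epsilon> * \<i> * (of_real t * (1 - of_real (\<epsilon> * \<eta>) * \<i>))\<^sup>2 = of_real (2 * (\<epsilon> * \<epsilon>) * \<eta> * t\<^sup>2)"
      by (simp add: power_mult_distrib mult_ac)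
    thus ?thesis unfolding Q_def ray_def \<epsilon>(1) using \<epsilon>(2) by (simp add: mult_ac)
  qed
  have coeffs: "taylor_coeff (b1 k) n = taylor_coeff (b2 k) n" for k n
  proof -
    let ?\<omega> = "1 + of_real \<epsilon> * \<i>"
    have ray1: "ray (-1) t - 1 = of_real t * ?\<omega>" for t by (simp add: ray_def)
    \<comment> \<open>t < \<rho>c keeps the ray in the disk; t < 1 and t < \<rho> give t^2 < \<rho>,
      so the image lies in the inner tangent disk, and t^2 <= t turns the bound in |q - lam|^N into
      one in t^N.\<close>
    define t0 where "t0 = min (min \<rho>c 1) \<rho>"
    have t0: "t0 > 0" using \<rho>c \<rho> by (simp add: t0_def)
    have "taylor_coeff (b1 k) n - taylor_coeff (b2 k) n = 0"
    proof (rule asymptotic_poly_coeffs_zero[where \<beta>="\<lambda>k. taylor_coeff (b1 k) n - taylor_coeff (b2 k) n" and \<omega>="?\<omega>" and ?t0.0=t0])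
      show "?\<omega> \<noteq> 0" by (simp add: complex_eq_iff)
      fix N
      obtain C1 where C1: "\<And>u. u \<in> \<Delta> \<Longrightarrow> norm (taylor_coeff (h1 (Q u)) n - (\<Sum>k<N. taylor_coeff (b1 k) n * (u - 1) ^ k)) \<le> C1 * norm (u - 1) ^ N"
        using gevrey_asymptotic_coeff_bound[OF G1 r, of n N] by blast
      obtain C2 where C2: "\<And>u. u \<in> \<Delta> \<Longrightarrow> norm (taylor_coeff (h2 (Q u)) n - (\<Sum>k<N. taylor_coeff (b2 k) n * (u - 1) ^ k)) \<le> C2 * norm (u - 1) ^ N"
        using gevrey_asymptotic_coeff_bound[OF G2 r, of n N] by blast
      obtain C3 where C3: "\<And>q. q \<in> tangent_disk lam (-1) \<rho> \<Longrightarrow> norm (taylor_coeff (f1 q) n - taylor_coeff (f2 q) n) \<le> C3 * norm (q - lam) ^ N"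
        using flat[of n N] by blast
      have "norm (\<Sum>k<N. (taylor_coeff (b1 k) n - taylor_coeff (b2 k) n) * (of_real t * ?\<omega>) ^ k)
          \<le> (\<bar>C3\<bar> * 2 ^ N * 4 ^ n + C1 * norm ?\<omega> ^ N + C2 * norm ?\<omega> ^ N) * t ^ N"
        if t: "0 < t \<and> t < t0" for t
      proof -
        define u where "u = ray (-1) t"
        have u: "u \<in> \<Delta>" unfolding u_def by (rule ray_in) (use t in \<open>auto simp: t0_def\<close>)
        have tt: "t * t < t * 1" "t * t < t * \<rho>" using t by (auto intro!: mult_strict_left_mono simp: t0_def)
        have t1: "t < 1" "t < \<rho>" using t by (auto simp: t0_def)
        have t2: "0 < t\<^sup>2" "t\<^sup>2 < \<rho>" "t\<^sup>2 \<le> t" "t\<^sup>2 < 1"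
          unfolding power2_eq_square using t tt t1 by (simp, linarith+)
        have Qu: "Q u = of_real (1 + (-1) * (2 * t\<^sup>2)) * lam" unfolding u_def by (rule Q_ray) simp
        have Qin: "Q u \<in> tangent_disk lam (-1) \<rho>" unfolding Qu
          by (rule radial_in_tangent_disk[OF lam]) (use t2 in auto)
        have Ql: "norm (Q u - lam) = 2 * t\<^sup>2"
        proof -
          have "Q u - lam = of_real (- (2 * t\<^sup>2)) * lam" unfolding Qu by (simp add: algebra_simps)
          thus ?thesis using lam by (simp add: norm_mult norm_power)
        qed
        have nQ: "norm (Q u) \<le> 3" using norm_triangle_sub[of "Q u" lam] Ql lam t2 by simp
        have dn: "norm (delta_poly s lam n (Q u)) \<le> 4 ^ n"
        proof (cases "n \<ge> 1")
          case True
          have "norm (delta_poly s lam n (Q u)) \<le> (1 + norm (Q u)) ^ n"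
            unfolding delta_poly_def by (rule order_trans[OF norm_sum norm_delta_poly_sum_le[OF True]])
          also have "\<dots> \<le> 4 ^ n" using nQ by (intro power_mono) auto
          finally show ?thesis .
        qed (simp add: delta_poly_def not_le)
        have hdiff: "taylor_coeff (h1 (Q u)) n - taylor_coeff (h2 (Q u)) n
            = (taylor_coeff (f1 (Q u)) n - taylor_coeff (f2 (Q u)) n) * delta_poly s lam n (Q u)"
          using taylor_coeff_hadamard_delta[OF fB1[OF Qin] r hf1[OF Qin]]
            taylor_coeff_hadamard_delta[OF fB2[OF Qin] r hf2[OF Qin]] by (simp add: left_diff_distrib)
        have "norm (taylor_coeff (h1 (Q u)) n - taylor_coeff (h2 (Q u)) n)
            \<le> (C3 * norm (Q u - lam) ^ N) * 4 ^ n"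
          unfolding hdiff norm_mult
          using C3[OF Qin] dn order_trans[OF norm_ge_zero C3[OF Qin]] by (intro mult_mono) auto
        also have "\<dots> \<le> (\<bar>C3\<bar> * (2 * t) ^ N) * 4 ^ n"
          unfolding Ql using t2 t by (intro mult_right_mono mult_mono power_mono) auto
        finally have 3: "norm (taylor_coeff (h1 (Q u)) n - taylor_coeff (h2 (Q u)) n) \<le> \<bar>C3\<bar> * 2 ^ N * 4 ^ n * t ^ N"
          by (simp add: power_mult_distrib mult_ac)
        have nu: "norm (u - 1) ^ N = norm ?\<omega> ^ N * t ^ N"
          using t unfolding u_def ray1 by (simp add: norm_mult power_mult_distrib mult.commute)
        \<comment> \<open>Difference of the functions minus difference of the remainders: all three
          terms are O(t^N).\<close>
        have "(\<Sum>k<N. (taylor_coeff (b1 k) n - taylor_coeff (b2 k) n) * (of_real t * ?\<omega>) ^ k)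
           = (taylor_coeff (h1 (Q u)) n - taylor_coeff (h2 (Q u)) n)
             - (taylor_coeff (h1 (Q u)) n - (\<Sum>k<N. taylor_coeff (b1 k) n * (u - 1) ^ k))
             + (taylor_coeff (h2 (Q u)) n - (\<Sum>k<N. taylor_coeff (b2 k) n * (u - 1) ^ k))"
          by (simp add: u_def ray1 left_diff_distrib sum_subtractf)
        also have "norm \<dots> \<le> \<bar>C3\<bar> * 2 ^ N * 4 ^ n * t ^ N + C1 * norm (u - 1) ^ N + C2 * norm (u - 1) ^ N"
          by (intro norm_triangle_le add_mono C2[OF u] norm_triangle_le_diff C1[OF u] 3)
        finally show ?thesis unfolding nu by (simp add: algebra_simps)
      qed
      thus "\<exists>C. \<forall>t. 0 < t \<and> t < t0 \<longrightarrow> norm (\<Sum>k<N. (taylor_coeff (b1 k) n - taylor_coeff (b2 k) n) * (of_real t * ?\<omega>) ^ k) \<le> C * t ^ N"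
        by blast
    qed (rule t0)
    thus ?thesis by simp
  qed
  have bB: "b1 k \<in> B r" "b2 k \<in> B r" for k using G1 G2 unfolding gevrey_asymptotic_on_def by auto
  have beq: "b1 k z = b2 k z" if "z \<in> ball 0 r" for k z
    by (rule B_eqI_taylor_coeff[OF bB coeffs that])
  obtain c0 c1 where c: "c0 > 0" "c1 > 0" and
    cb: "\<And>N u z. u \<in> \<Delta> \<Longrightarrow> z \<in> ball 0 r
      \<Longrightarrow> norm (h1 (Q u) z - h2 (Q u) z) \<le> c0 * c1 ^ N * Gamma (1 + real N * 1) * norm (u - 1) ^ N"
    using gevrey_asymptotic_diff_bound[OF G1 G2 beq] by (metis zero_le_one)
  have \<Delta>b: "\<Delta> = ball (1 + of_real \<rho>c) \<rho>c" by (simp add: \<Delta>_def tangent_disk_def)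
  have zero: "h1 (Q u) z - h2 (Q u) z = 0" if u: "u \<in> \<Delta>" for u
  proof (rule gevrey_one_flat_zero[where F="\<lambda>u. h1 (Q u) z - h2 (Q u) z" and \<rho>=\<rho>c])
    show "(\<lambda>u. h1 (Q u) z - h2 (Q u) z) holomorphic_on ball (1 + of_real \<rho>c) \<rho>c"
      unfolding \<Delta>b[symmetric] using G1 G2 unfolding gevrey_asymptotic_on_def
      by (intro holomorphic_on_diff B_holomorphic_on_pointwise[OF _ z]) auto
    show "norm (h1 (Q u) z - h2 (Q u) z) \<le> c0 * c1 ^ N * fact N * norm (u - 1) ^ N"
      if "u \<in> ball (1 + of_real \<rho>c) \<rho>c" for N u
      using cb[OF _ z, of u N] that by (simp add: \<Delta>b Gamma_fact)
  qed (use \<rho>c c u in \<open>auto simp: \<Delta>b\<close>)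
  have "h1 q z - h2 q z = 0"
  \<comment> \<open>The parametrisation x = 2 t^2 of the radius is inverted, so t < \<rho>c becomes
    x < 2 \<rho>c^2.\<close>
  proof (rule tangent_disk_zero_from_radial[where g="\<lambda>q. h1 q z - h2 q z", OF _ lam e \<rho> _ _ q])
    show "(\<lambda>q. h1 q z - h2 q z) holomorphic_on tangent_disk lam e \<rho>"
      by (intro holomorphic_on_diff B_holomorphic_on_pointwise[OF _ z] hB1 hB2 e)
    show "2 * \<rho>c\<^sup>2 > 0" using \<rho>c by simp
    fix x assume x: "0 < x" "x < 2 * \<rho>c\<^sup>2"
    define t where "t = sqrt (x / 2)"
    have t: "t > 0" "2 * t\<^sup>2 = x" using x by (auto simp: t_def)
    have "t < \<rho>c"
    proof (rule power2_less_imp_less)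
      show "t\<^sup>2 < \<rho>c\<^sup>2" using t x by simp
    qed (use \<rho>c in simp)
    have "Q (ray e t) = of_real (1 + e * x) * lam" using Q_ray[OF e, of t] t by simp
    thus "h1 (of_real (1 + e * x) * lam) z - h2 (of_real (1 + e * x) * lam) z = 0"
      using zero[OF ray_in[OF e t(1) \<open>t < \<rho>c\<close>]] by simp
  qed
  thus ?thesis by simp
qed

lemma gevrey_odot_quasianalytic_one:
  assumes r: "r > 0" and lam: "norm lam = 1" "\<And>n. n \<ge> 1 \<Longrightarrow> lam ^ n \<noteq> 1"
  shows "gevrey_odot_quasianalytic 1 lam r"
  unfolding gevrey_odot_quasianalytic_def
proof (intro ballI allI impI)
  fix f1 f2 a
  assume f1: "f1 \<in> gevrey_odot 1 lam r" and f2: "f2 \<in> gevrey_odot 1 lam r"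
    and a: "gevrey_expansion (2 * 1) lam r f1 a \<and> gevrey_expansion (2 * 1) lam r f2 a"
  obtain R1 where R1: "0 < R1" "R1 < 1" "gevrey_asymptotic_on 2 lam r (tangent_disk lam (-1) R1) f1 a"
    using a unfolding gevrey_expansion_def inner_disks_eq by auto
  obtain R2 where R2: "0 < R2" "R2 < 1" "gevrey_asymptotic_on 2 lam r (tangent_disk lam (-1) R2) f2 a"
    using a unfolding gevrey_expansion_def inner_disks_eq by auto
  \<comment> \<open>Inner and outer disk are shrunk to a common radius, so that one statement over
    the sign e covers both.\<close>
  have ext: "\<exists>R>0. R < 1 \<and> (\<exists>h\<in>gevrey_cardioid s 1 lam r. \<forall>e. \<bar>e\<bar> = 1 \<longrightarrow>
        B_holomorphic_on r f (tangent_disk lam e R) \<and> B_holomorphic_on r h (tangent_disk lam e R) \<and>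
        (\<forall>q\<in>tangent_disk lam e R. \<forall>z\<in>ball 0 r. h q z = (f q \<odot> delta_fun s lam q) z))"
    if "f \<in> gevrey_odot 1 lam r" for f s
  proof -
    have "hadamard_extends s 1 lam r f" using that unfolding gevrey_odot_def by (cases s) auto
    then obtain Rm Rp h where R: "0 < Rm" "Rm < 1" "0 < Rp"
      and B: "B_holomorphic_on r f (tangent_disk lam (-1) Rm)" "B_holomorphic_on r f (tangent_disk lam 1 Rp)"
        "B_holomorphic_on r h (tangent_disk lam (-1) Rm)" "B_holomorphic_on r h (tangent_disk lam 1 Rp)"
      and h: "h \<in> gevrey_cardioid s 1 lam r"
      and eq: "\<And>q z. q \<in> tangent_disk lam (-1) Rm \<union> tangent_disk lam 1 Rp \<Longrightarrow> z \<in> ball 0 r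
         \<Longrightarrow> h q z = (f q \<odot> delta_fun s lam q) z"
      unfolding hadamard_extends_def inner_disks_eq outer_disks_eq by blast
    define R0 where "R0 = min Rm Rp"
    have sub: "tangent_disk lam (-1) R0 \<subseteq> tangent_disk lam (-1) Rm" "tangent_disk lam 1 R0 \<subseteq> tangent_disk lam 1 Rp"
      by (rule tangent_disk_mono[OF lam(1)]; simp add: R0_def)+
    have "B_holomorphic_on r f (tangent_disk lam e R0) \<and> B_holomorphic_on r h (tangent_disk lam e R0) \<and>
        (\<forall>q\<in>tangent_disk lam e R0. \<forall>z\<in>ball 0 r. h q z = (f q \<odot> delta_fun s lam q) z)"
      if "\<bar>e\<bar> = 1" for e
    proof -
      have "e = 1 \<or> e = -1" using that by linarith
      thus ?thesis using sub B eq by (elim disjE) (auto intro: B_holomorphic_on_subset)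
    qed
    thus ?thesis using R h by (intro exI[of _ R0]) (auto simp: R0_def)
  qed
  obtain \<rho> h1 h2 where \<rho>: "0 < \<rho>" "\<rho> < 1" "\<rho> \<le> R1" "\<rho> \<le> R2"
    and h1: "\<And>s. h1 s \<in> gevrey_cardioid s 1 lam r" and h2: "\<And>s. h2 s \<in> gevrey_cardioid s 1 lam r"
    and fB: "\<And>e. \<bar>e\<bar> = 1 \<Longrightarrow> B_holomorphic_on r f1 (tangent_disk lam e \<rho>)"
      "\<And>e. \<bar>e\<bar> = 1 \<Longrightarrow> B_holomorphic_on r f2 (tangent_disk lam e \<rho>)"
    and hB: "\<And>s e. \<bar>e\<bar> = 1 \<Longrightarrow> B_holomorphic_on r (h1 s) (tangent_disk lam e \<rho>)"
      "\<And>s e. \<bar>e\<bar> = 1 \<Longrightarrow> B_holomorphic_on r (h2 s) (tangent_disk lam e \<rho>)"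
    and hf: "\<And>s e q z. \<bar>e\<bar> = 1 \<Longrightarrow> q \<in> tangent_disk lam e \<rho> \<Longrightarrow> z \<in> ball 0 r \<Longrightarrow> h1 s q z = (f1 q \<odot> delta_fun s lam q) z"
      "\<And>s e q z. \<bar>e\<bar> = 1 \<Longrightarrow> q \<in> tangent_disk lam e \<rho> \<Longrightarrow> z \<in> ball 0 r \<Longrightarrow> h2 s q z = (f2 q \<odot> delta_fun s lam q) z"
  proof -
    obtain S1 h1 where 1: "\<And>s. S1 s > 0 \<and> S1 s < 1 \<and> h1 s \<in> gevrey_cardioid s 1 lam r \<and> (\<forall>e. \<bar>e\<bar> = 1 \<longrightarrow>
        B_holomorphic_on r f1 (tangent_disk lam e (S1 s)) \<and> B_holomorphic_on r (h1 s) (tangent_disk lam e (S1 s)) \<and>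
        (\<forall>q\<in>tangent_disk lam e (S1 s). \<forall>z\<in>ball 0 r. h1 s q z = (f1 q \<odot> delta_fun s lam q) z))"
      using ext[OF f1] by metis
    obtain S2 h2 where 2: "\<And>s. S2 s > 0 \<and> S2 s < 1 \<and> h2 s \<in> gevrey_cardioid s 1 lam r \<and> (\<forall>e. \<bar>e\<bar> = 1 \<longrightarrow>
        B_holomorphic_on r f2 (tangent_disk lam e (S2 s)) \<and> B_holomorphic_on r (h2 s) (tangent_disk lam e (S2 s)) \<and>
        (\<forall>q\<in>tangent_disk lam e (S2 s). \<forall>z\<in>ball 0 r. h2 s q z = (f2 q \<odot> delta_fun s lam q) z))"
      using ext[OF f2] by metis
    \<comment> \<open>One radius for both functions and both half circles.\<close>
    define \<rho> where "\<rho> = Min {R1, R2, S1 Lower, S1 Upper, S2 Lower, S2 Upper}"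
    have le: "\<rho> \<le> S1 s" "\<rho> \<le> S2 s" for s by (cases s; simp add: \<rho>_def)+
    have sub: "tangent_disk lam e \<rho> \<subseteq> tangent_disk lam e (S1 s)" "tangent_disk lam e \<rho> \<subseteq> tangent_disk lam e (S2 s)"
      if "\<bar>e\<bar> = 1" for e s using tangent_disk_mono[OF lam(1) that] le by auto
    show ?thesis
    proof (rule that[of \<rho> h1 h2])
      show "0 < \<rho>" "\<rho> < 1" "\<rho> \<le> R1" "\<rho> \<le> R2" using R1 R2 1 2 by (auto simp: \<rho>_def)
      fix s e assume e: "\<bar>e\<bar> = (1::real)"
      show "B_holomorphic_on r f1 (tangent_disk lam e \<rho>)" "B_holomorphic_on r (h1 s) (tangent_disk lam e \<rho>)"
        using 1 e sub(1)[OF e] by (meson B_holomorphic_on_subset)+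
      show "B_holomorphic_on r f2 (tangent_disk lam e \<rho>)" "B_holomorphic_on r (h2 s) (tangent_disk lam e \<rho>)"
        using 2 e sub(2)[OF e] by (meson B_holomorphic_on_subset)+
      fix q z assume "q \<in> tangent_disk lam e \<rho>" "z \<in> ball (0::complex) r"
      thus "h1 s q z = (f1 q \<odot> delta_fun s lam q) z" "h2 s q z = (f2 q \<odot> delta_fun s lam q) z"
        using 1[of s] 2[of s] e sub[OF e, of s] by blast+
    qed (use 1 2 in auto)
  qed
  have f1q: "f1 q \<in> B r" and f2q: "f2 q \<in> B r" if "\<bar>e\<bar> = 1" "q \<in> tangent_disk lam e \<rho>" for q e
    using fB that by (auto dest: B_holomorphic_on_B)
  have G1: "gevrey_asymptotic_on 2 lam r (tangent_disk lam (-1) \<rho>) f1 a"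
    by (rule gevrey_asymptotic_on_subset[OF R1(3) tangent_disk_mono]) (use lam \<rho> in auto)
  have G2: "gevrey_asymptotic_on 2 lam r (tangent_disk lam (-1) \<rho>) f2 a"
    by (rule gevrey_asymptotic_on_subset[OF R2(3) tangent_disk_mono]) (use lam \<rho> in auto)
  have flat: "\<exists>C. \<forall>q\<in>tangent_disk lam (-1) \<rho>. norm (taylor_coeff (f1 q) n - taylor_coeff (f2 q) n) \<le> C * norm (q - lam) ^ N" for n N
  proof -
    obtain C1 C2 where "\<forall>q\<in>tangent_disk lam (-1) \<rho>. norm (taylor_coeff (f1 q) n - (\<Sum>k<N. taylor_coeff (a k) n * (q - lam) ^ k)) \<le> C1 * norm (q - lam) ^ N"
      "\<forall>q\<in>tangent_disk lam (-1) \<rho>. norm (taylor_coeff (f2 q) n - (\<Sum>k<N. taylor_coeff (a k) n * (q - lam) ^ k)) \<le> C2 * norm (q - lam) ^ N"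
      using gevrey_asymptotic_coeff_bound[OF G1 r, of n N] gevrey_asymptotic_coeff_bound[OF G2 r, of n N] by blast
    hence "norm (taylor_coeff (f1 q) n - taylor_coeff (f2 q) n) \<le> (C1 + C2) * norm (q - lam) ^ N"
      if "q \<in> tangent_disk lam (-1) \<rho>" for q
      using that norm_triangle_ineq4[of "taylor_coeff (f1 q) n - (\<Sum>k<N. taylor_coeff (a k) n * (q - lam) ^ k)"
          "taylor_coeff (f2 q) n - (\<Sum>k<N. taylor_coeff (a k) n * (q - lam) ^ k)"]
      by (fastforce simp: distrib_right)
    thus ?thesis by blast
  qed
  have agree: "h1 s q z = h2 s q z" if "\<bar>e\<bar> = 1" "q \<in> tangent_disk lam e \<rho>" "z \<in> ball 0 r" for s e q z
    by (rule cardioid_extensions_agree[where ?f1.0=f1 and ?f2.0=f2, OF r lam(1) \<rho>(1) h1 h2 hB _ _ _ _ flat that])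
       (auto intro: f1q[of "-1"] f2q[of "-1"] hf[of "-1"])
  have main: "f1 q z = f2 q z" if e: "\<bar>e\<bar> = 1" and q: "q \<in> tangent_disk lam e \<rho>" and z: "z \<in> ball 0 r" for e q z
  proof (rule B_eqI_taylor_coeff[OF f1q[OF e q] f2q[OF e q] _ z])
    fix n
    show "taylor_coeff (f1 q) n = taylor_coeff (f2 q) n"
    proof (cases "n \<ge> 1")
      case True
      have "taylor_coeff (f1 q) n * delta_poly s lam n q = taylor_coeff (f2 q) n * delta_poly s lam n q" for s
      proof -
        have "taylor_coeff (f1 q) n * delta_poly s lam n q = taylor_coeff (h1 s q) n"
          by (rule taylor_coeff_hadamard_delta[OF f1q[OF e q] r hf(1)[OF e q], symmetric])
        also have "\<dots> = taylor_coeff (h2 s q) n" by (rule taylor_coeff_cong[OF r agree[OF e q]])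
        also have "\<dots> = taylor_coeff (f2 q) n * delta_poly s lam n q"
          by (rule taylor_coeff_hadamard_delta[OF f2q[OF e q] r hf(2)[OF e q]])
        finally show ?thesis .
      qed
      hence "taylor_coeff (f1 q) n * (delta_poly Lower lam n q + delta_poly Upper lam n q)
          = taylor_coeff (f2 q) n * (delta_poly Lower lam n q + delta_poly Upper lam n q)"
        by (simp only: distrib_left)
      thus ?thesis using delta_poly_Lower_plus_Upper[OF lam True] by simp
    next
      case False
      \<comment> \<open>The half circles add up to 1 only for n >= 1; at n = 0 both coefficients
        vanish by membership in \<open>B r\<close>.\<close>
      hence "n = 0" by simp
      thus ?thesis using f1q[OF e q] f2q[OF e q] by (simp add: taylor_coeff_0 B_def)
    qed
  qed
  show "\<exists>\<Delta>m\<in>inner_disks lam. \<exists>\<Delta>p\<in>outer_disks lam. \<forall>q\<in>\<Delta>m \<union> \<Delta>p. \<forall>z\<in>ball 0 r. f1 q z = f2 q z"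
  proof (intro bexI ballI)
    show "tangent_disk lam (-1) \<rho> \<in> inner_disks lam" "tangent_disk lam 1 \<rho> \<in> outer_disks lam"
      using \<rho> by (auto simp: inner_disks_eq outer_disks_eq)
    fix q z assume "q \<in> tangent_disk lam (-1) \<rho> \<union> tangent_disk lam 1 \<rho>" "z \<in> ball (0::complex) r"
    thus "f1 q z = f2 q z" using main[of "-1" q z] main[of 1 q z] by auto
  qed
qed

theorem theorem4p4:
  fixes \<tau> :: real and lam :: complex
  assumes "\<tau> \<ge> 2" and "lam \<in> diophantine_points \<tau>"
  shows "(\<forall>r::real. 0 < r \<and> r < 1 \<longrightarrow>
            fundamental_solution \<in> gevrey_odot (\<tau> / 2) lam r \<and>
            (\<tau> = 2 \<longrightarrow> gevrey_odot_quasianalytic (\<tau> / 2) lam r)) \<and>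
         (\<forall>(r1::real) (r2::real) g. 0 < r2 \<and> r2 < r1 \<and> g \<in> B r1 \<longrightarrow>
            solution g \<in> gevrey_odot (\<tau> / 2) lam r2 \<and>
            (\<tau> = 2 \<longrightarrow> gevrey_odot_quasianalytic (\<tau> / 2) lam r2))"
proof -
  have "gevrey_odot_quasianalytic (\<tau> / 2) lam r" if "\<tau> = 2" "0 < r" for r
    using gevrey_odot_quasianalytic_one[OF that(2) diophantine_points_separation(1) diophantine_points_not_root]
      assms that(1) by simp
  thus ?thesis
    using fundamental_solution_gevrey_odot[OF assms] solution_gevrey_odot[OF assms] by blast
qed

end
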